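(* Consider a branching random walk satisfying all the assumptions listed in the context, with $b\in(0,\frac12)$. Then for every $x\in\mathbb R$, $$\lim_{n\to\infty}\mathbb P(M_n>\alpha_n+x)=\mathbb E\big[\exp\{-\ell_\infty m^aC^*e^xW_\infty\}\big],\qquad C^*:=\sum_{j=0}^\infty\mathbb E(e^{-M_j}).$$
   Context: Branching random walk: let $\mathscr L=\sum_{i=1}^\nu\delta_{Y_i}$, where $\nu$ is an $\mathbb N_0$-valued random variable and $(Y_i)_{i\ge1}$ are i.i.d. real random variables independent of $\nu$. One particle (the root) starts at $0$; at each generation, every particle (at position $x$, say) independently dies and produces children whose positions form an independent copy of the translated point process $x+\mathscr L$. $\mathbb T$ is the genealogical tree, $|u|$ the generation and $V(u)$ the position of $u\in\mathbb T$. $M_n:=\inf_{|u|=n}V(u)$ with $\inf\emptyset=+\infty$ (and $e^{-\infty}=0$). Assumptions. $1<\mathbb E(\nu)<\infty$; $\mathscr L$ is not a.s. supported on a deterministic lattice. With $\phi(\beta):=\log\mathbb E[\sum_{|u|=1}e^{-\beta V(u)}]\in(-\infty,\infty]$: $\phi(1)=0$, the left derivative $\phi'(1-)\in(-\infty,0)$, and $\phi(\beta)=\infty$ for all $\beta>1$. Let $X$ be a real random variable under a probability $\mathbf P$ with law $\mathbf E[g(X)]=\mathbb E[\sum_{|u|=1}g(V(u))e^{-V(u)}]$ for bounded measurable $g$. There are $a\in\mathbb R$, $\lambda>0$, $b$, $x_0<0$ and a non-negative function $\ell$ with $\lim_{y\to-\infty}\ell(y)=\ell_\infty\in(0,\infty)$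 such that $\mathbf P(X\le x)=\int_{-\infty}^x\ell(y)|y|^ae^{-\lambda|y|^b}dy$ for all $x\le x_0$. With $W_n:=\sum_{|u|=n}e^{-V(u)}$ (a non-negative martingale), $\mathbb E(W_1\log_+W_1)<\infty$, where $\log_+x=\max\{\log x,0\}$. $W_\infty$ is the a.s. limit of $W_n$. Notation: $m:=-\phi'(1-)=\mathbf E(X)\in(0,\infty)$ and $\alpha_n:=\lambda(mn)^b-a\log n$. *)

theory Defs
  imports "HOL-Probability.Probability"
begin

text \<open>
  Particles carry Ulam--Harris labels: the root is \<^term>\<open>[]\<close> and the children of a
  particle \<open>u\<close> are \<open>u @ [i]\<close> with \<open>i\<close> below its offspring number. The families
  \<open>N u\<close> (offspring number) and \<open>Y u i\<close> (displacement of the \<open>i\<close>-th child of \<open>u\<close>)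
  are given for all labels, so that the point process of children of \<open>u\<close>, seen from \<open>u\<close>, is
  the sum of the Dirac masses at \<open>Y u i\<close> over \<open>i < N u\<close>.
\<close>

locale branching_random_walk = prob_space P for P :: "'a measure" +
  fixes nu :: "nat pmf"
    and mu :: "real measure"
    and N :: "nat list \<Rightarrow> 'a \<Rightarrow> nat"
    and Y :: "nat list \<Rightarrow> nat \<Rightarrow> 'a \<Rightarrow> real"
  assumes mu_prob: "prob_space mu"
    and mu_sets: "sets mu = sets borel"
    and particles_indep:
      "indep_vars (\<lambda>_. count_space UNIV \<Otimes>\<^sub>M (\<Pi>\<^sub>M i\<in>UNIV. borel))
        (\<lambda>u \<omega>. (N u \<omega>, \<lambda>i. Y u i \<omega>)) UNIV"
    and particle_law:
      "distr P (count_space UNIV \<Otimes>\<^sub>M (\<Pi>\<^sub>M i\<in>UNIV. borel)) (\<lambda>\<omega>. (N u \<omega>, \<lambda>i. Y u i \<omega>))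
        = measure_pmf nu \<Otimes>\<^sub>M (\<Pi>\<^sub>M i\<in>UNIV. mu)"

definition generation :: "(nat list \<Rightarrow> 'a \<Rightarrow> nat) \<Rightarrow> nat \<Rightarrow> 'a \<Rightarrow> nat list set" where
  "generation N n \<omega> = {u. length u = n \<and> (\<forall>k<length u. u ! k < N (take k u) \<omega>)}"

definition position :: "(nat list \<Rightarrow> nat \<Rightarrow> 'a \<Rightarrow> real) \<Rightarrow> nat list \<Rightarrow> 'a \<Rightarrow> real" where
  "position Y u \<omega> = (\<Sum>k<length u. Y (take k u) (u ! k) \<omega>)"

definition min_position ::
  "(nat list \<Rightarrow> 'a \<Rightarrow> nat) \<Rightarrow> (nat list \<Rightarrow> nat \<Rightarrow> 'a \<Rightarrow> real) \<Rightarrow> nat \<Rightarrow> 'a \<Rightarrow> ereal" where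
  "min_position N Y n \<omega> = (INF u\<in>generation N n \<omega>. ereal (position Y u \<omega>))"

definition additive_martingale ::
  "(nat list \<Rightarrow> 'a \<Rightarrow> nat) \<Rightarrow> (nat list \<Rightarrow> nat \<Rightarrow> 'a \<Rightarrow> real) \<Rightarrow> nat \<Rightarrow> 'a \<Rightarrow> real" where
  "additive_martingale N Y n \<omega> = (\<Sum>u\<in>generation N n \<omega>. exp (- position Y u \<omega>))"

text \<open>Logarithm on \<open>[0, \<infinity>]\<close>, with the conventions \<open>log 0 = -\<infinity>\<close> and \<open>log \<infinity> = \<infinity>\<close>.\<close>

definition elog :: "ennreal \<Rightarrow> ereal" where
  "elog z = (if z = 0 then -\<infinity> else if z = \<infinity> then \<infinity> else ereal (ln (enn2real z)))"

definition log_laplace ::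
  "'a measure \<Rightarrow> (nat list \<Rightarrow> 'a \<Rightarrow> nat) \<Rightarrow> (nat list \<Rightarrow> nat \<Rightarrow> 'a \<Rightarrow> real) \<Rightarrow> real \<Rightarrow> ereal" where
  "log_laplace P N Y \<beta> =
    elog (\<integral>\<^sup>+ \<omega>. (\<Sum>u\<in>generation N 1 \<omega>. ennreal (exp (- \<beta> * position Y u \<omega>))) \<partial>P)"

text \<open>
  \<open>exp_neg x\<close> is \<open>e\<close> to the power \<open>- x\<close>, with value \<open>0\<close> at \<open>\<infinity>\<close>. The value at \<open>-\<infinity>\<close>
  is irrelevant: a generation is finite, so the minimal position is never \<open>-\<infinity>\<close>.
\<close>

definition exp_neg :: "ereal \<Rightarrow> real" where
  "exp_neg x = (if x = \<infinity> then 0 else exp (- real_of_ereal x))"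

definition C_star ::
  "'a measure \<Rightarrow> (nat list \<Rightarrow> 'a \<Rightarrow> nat) \<Rightarrow> (nat list \<Rightarrow> nat \<Rightarrow> 'a \<Rightarrow> real) \<Rightarrow> ennreal" where
  "C_star P N Y = (\<Sum>j. \<integral>\<^sup>+ \<omega>. ennreal (exp_neg (min_position N Y j \<omega>)) \<partial>P)"

lemma finite_generation: "finite (generation N n \<omega>)"
proof (induction n)
  case 0
  then show ?case by (simp add: generation_def)
next
  case (Suc n)
  have "generation N (Suc n) \<omega> \<subseteq> (\<Union>u\<in>generation N n \<omega>. (\<lambda>i. u @ [i]) ` {..<N u \<omega>})"
  proof
    fix v assume v: "v \<in> generation N (Suc n) \<omega>"
    then obtain u i where ui: "v = u @ [i]"
      by (cases v rule: rev_cases) (auto simp: generation_def)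
    have len: "length u = n" and lt: "\<And>k. k < Suc n \<Longrightarrow> (u @ [i]) ! k < N (take k (u @ [i])) \<omega>"
      using v ui by (auto simp: generation_def)
    have "u ! k < N (take k u) \<omega>" if "k < n" for k
      using lt[of k] that len by (simp add: nth_append)
    moreover have "i < N u \<omega>"
      using lt[of n] len by (simp add: nth_append)
    ultimately show "v \<in> (\<Union>u\<in>generation N n \<omega>. (\<lambda>i. u @ [i]) ` {..<N u \<omega>})"
      using len ui by (auto simp: generation_def)
  qed
  then show ?case
    by (rule finite_subset) (use Suc in auto)
qed

end

theory Submission
  imports Defs
begin

text \<open>
  Under the tilted law of \<open>X\<close> everything reduces to a random walk \<open>S\<close> with drift \<open>m\<close>
  and a stretched exponential left tail, and a particle below \<open>\<alpha>\<^sub>n + x\<close> at time \<open>n\<close> owes its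
  position to one displacement of size about \<open>-mn\<close>. Chernoff bounds for truncated steps exclude
  paths without a displacement below \<open>-mn/2\<close>, and a displacement \<open>j\<close> generations before the end
  contributes at most a constant times \<open>(1 + mj)\<^sup>-\<^sup>2\<close>, because the expected number of
  successful particles is replaced by the probability that the minimum of the subtree succeeds.
  So only the last \<open>J\<close> generations matter up to an error that is small for large \<open>J\<close>. Given
  the first \<open>n - J\<close> generations, a particle at \<open>v\<close> close to \<open>mn\<close> succeeds with probability
  asymptotic to \<open>e\<^sup>-\<^sup>v\<close> times a constant proportional to the first \<open>J\<close> terms of \<open>C\<^sup>*\<close>. The
  particles are independent, so their product is close to the exponential of the corresponding
  multiple of \<open>-W\<^sub>n\<close>. The condition \<open>b < 1/2\<close> makes fluctuations of
  order \<open>n\<^sup>1\<^sup>/\<^sup>2\<close> of the position invisible to \<open>\<lambda>(mn)\<^sup>b\<close>.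

  Random walk estimates are phrased as bounds on iterated integral operators, which replaces
  events on path space by explicit supersolutions.
\<close>

section \<open>The law of the tree\<close>

text \<open>Hitting probabilities are multiplied by \<open>exp v\<close>. In this scale one
  generation is dominated by the expectation under the tilted step law, since the chance that at
  least one trial succeeds is at most the expected number of successes. For a fixed number of
  generations and a distant start this domination is asymptotically exact. The tail coefficient of
  the weighted hitting probability then grows, with each further generation, by \<open>l_inf\<close>
  times the integral of the previous function. These integrals are the terms of
  \<open>C_star\<close>. Chernoff exponents of order \<open>n powr (b - 1)\<close> match the slope
  of the tail at distance \<open>m * n\<close>. Their quadratic error over n steps is of order
  \<open>n powr (2 * b - 1)\<close>, hence negligible exactly when b is below 1/2, so the estimates
  keep the leading exponent. The two halves of the limit differ. Ignoring atypical particles can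
  only raise the probability that the minimum stays high, so the upper bound needs no control of
  them; all path estimates serve the lower bound.\<close>

abbreviation child_space :: "(nat \<times> (nat \<Rightarrow> real)) measure" where
  "child_space \<equiv> count_space UNIV \<Otimes>\<^sub>M (\<Pi>\<^sub>M i\<in>UNIV. borel)"

abbreviation tree_space :: "(nat list \<Rightarrow> nat \<times> (nat \<Rightarrow> real)) measure" where
  "tree_space \<equiv> \<Pi>\<^sub>M u\<in>UNIV. child_space"

text \<open>The recursions are proved on the canonical product space, which depends on
  \<open>nu\<close> and \<open>mu\<close> alone and where passing to a subtree is a reindexing of
  coordinates. They reach the given probability space only through the law of the sampled
  tree.\<close>

locale offspring_law =
  fixes nu :: "nat pmf" and mu :: "real measure"
  assumes mu_prob: "prob_space mu" and mu_sets [measurable_cong, simp]: "sets mu = sets borel"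
begin

sublocale mu: prob_space mu by (rule mu_prob)

lemma mu_space [simp]: "space mu = UNIV"
  using sets_eq_imp_space_eq[OF mu_sets] by simp

lemma mu_UNIV [simp]: "measure mu UNIV = 1"
  using mu.prob_space by simp

definition child_law :: "(nat \<times> (nat \<Rightarrow> real)) measure" where
  "child_law = measure_pmf nu \<Otimes>\<^sub>M (\<Pi>\<^sub>M i\<in>UNIV. mu)"

definition tree_law :: "(nat list \<Rightarrow> nat \<times> (nat \<Rightarrow> real)) measure" where
  "tree_law = (\<Pi>\<^sub>M u\<in>UNIV. child_law)"

lemma sets_child_law [simp]: "sets child_law = sets child_space"
  unfolding child_law_def by (intro sets_pair_measure_cong sets_PiM_cong) simp_all

lemma space_child_law [simp]: "space child_law = UNIV"
  using sets_eq_imp_space_eq[OF sets_child_law] by (simp add: space_pair_measure space_PiM)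

lemma sets_tree_law [simp]: "sets tree_law = sets tree_space"
  unfolding tree_law_def by (intro sets_PiM_cong) simp_all

lemma space_tree_law [simp]: "space tree_law = UNIV"
  using sets_eq_imp_space_eq[OF sets_tree_law] by (simp add: space_PiM space_pair_measure)

lemma displ_prob: "prob_space (\<Pi>\<^sub>M i\<in>(UNIV::nat set). mu)"
  by (rule prob_space_PiM) (rule mu_prob)

lemma child_prob: "prob_space child_law"
proof -
  interpret D: prob_space "\<Pi>\<^sub>M i\<in>(UNIV::nat set). mu" by (rule displ_prob)
  interpret pair_prob_space "measure_pmf nu" "\<Pi>\<^sub>M i\<in>(UNIV::nat set). mu" ..
  show ?thesis unfolding child_law_def by (rule prob_space_axioms)
qed

sublocale tree: prob_space tree_law
  unfolding tree_law_def by (rule prob_space_PiM) (rule child_prob)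

lemma measurable_subtree:
  "(\<lambda>t. \<lambda>u. t (i # u)) \<in> measurable tree_space tree_space"
  by (rule measurable_PiM_single') (auto simp: space_PiM space_pair_measure)

text \<open>Prefixing a label with \<open>i\<close> is injective, and an injective reindexing of
  identically distributed independent coordinates preserves the product law.\<close>

lemma distr_subtree: "distr tree_law tree_law (\<lambda>t. \<lambda>u. t (i # u)) = tree_law"
  using distr_PiM_reindex[of UNIV "\<lambda>_. child_law" "Cons i" UNIV] child_prob
  by (simp add: tree_law_def restrict_UNIV)

lemma distr_coord: "distr tree_law child_space (\<lambda>t. t u) = child_law"
proof -
  have "distr tree_law child_space (\<lambda>t. t u) = distr (\<Pi>\<^sub>M u\<in>(UNIV::nat list set). child_law) child_law (\<lambda>t. t u)"
    by (intro distr_cong) (simp_all add: tree_law_def)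
  also have "\<dots> = child_law"
    by (rule distr_PiM_component) (simp_all add: child_prob)
  finally show ?thesis .
qed

lemma measurable_coord: "(\<lambda>t. t u) \<in> measurable tree_law child_space"
  by (subst measurable_cong_sets[OF sets_tree_law refl]) (rule measurable_component_singleton, simp)

text \<open>A product measure is the law of its own identity map, so the characterization of
  independence by a product distribution applies directly.\<close>

lemma indep_coords: "tree.indep_vars (\<lambda>_. child_space) (\<lambda>u t. t u) UNIV"
proof -
  have "distr tree_law tree_space (\<lambda>x. x) = tree_law"
    by (rule distr_id2) (rule sets_tree_law[symmetric])
  then have *: "distr tree_law tree_space (\<lambda>x. \<lambda>i\<in>UNIV. x i) = (\<Pi>\<^sub>M i\<in>UNIV. distr tree_law child_space (\<lambda>t. t i))"
    unfolding distr_coord by (simp only: restrict_UNIV tree_law_def)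
  show ?thesis
    by (rule tree.indep_vars_iff_distr_eq_PiM[THEN iffD2, OF _ _ *]) (rule UNIV_not_empty, rule measurable_coord)
qed

lemma indep_displ: "prob_space.indep_vars (\<Pi>\<^sub>M i\<in>(UNIV::nat set). mu) (\<lambda>_. borel) (\<lambda>i y. y i) UNIV"
proof -
  interpret D: prob_space "\<Pi>\<^sub>M i\<in>(UNIV::nat set). mu" by (rule displ_prob)
  have s: "sets (\<Pi>\<^sub>M i\<in>(UNIV::nat set). mu) = sets (\<Pi>\<^sub>M i\<in>(UNIV::nat set). borel)"
    by (intro sets_PiM_cong) simp_all
  have d: "distr (\<Pi>\<^sub>M i\<in>(UNIV::nat set). mu) borel (\<lambda>t. t u) = mu" for u
  proof -
    have "distr (\<Pi>\<^sub>M i\<in>(UNIV::nat set). mu) borel (\<lambda>t. t u) = distr (\<Pi>\<^sub>M i\<in>(UNIV::nat set). mu) mu (\<lambda>t. t u)"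
      by (intro distr_cong) simp_all
    then show ?thesis
      using distr_PiM_component[of UNIV "\<lambda>_::nat. mu" u] mu_prob by simp
  qed
  have m: "(\<lambda>t. t u) \<in> measurable (\<Pi>\<^sub>M i\<in>(UNIV::nat set). mu) borel" for u
    by (subst measurable_cong_sets[OF s refl]) (rule measurable_component_singleton, simp)
  have "distr (\<Pi>\<^sub>M i\<in>(UNIV::nat set). mu) (\<Pi>\<^sub>M i\<in>(UNIV::nat set). borel) (\<lambda>x. x) = (\<Pi>\<^sub>M i\<in>(UNIV::nat set). mu)"
    by (rule distr_id2) (rule s[symmetric])
  then have *: "distr (\<Pi>\<^sub>M i\<in>(UNIV::nat set). mu) (\<Pi>\<^sub>M i\<in>(UNIV::nat set). borel) (\<lambda>x. \<lambda>i\<in>UNIV. x i)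
      = (\<Pi>\<^sub>M i\<in>UNIV. distr (\<Pi>\<^sub>M i\<in>(UNIV::nat set). mu) borel (\<lambda>t. t i))"
    unfolding d by (simp only: restrict_UNIV)
  show ?thesis
    by (rule D.indep_vars_iff_distr_eq_PiM[THEN iffD2, OF _ _ *]) (rule UNIV_not_empty, rule m)
qed

lemma nn_integral_displ_component:
  assumes g: "g \<in> borel_measurable borel"
  shows "(\<integral>\<^sup>+y. g (y i) \<partial>(\<Pi>\<^sub>M i\<in>(UNIV::nat set). mu)) = (\<integral>\<^sup>+y. g y \<partial>mu)"
proof -
  have g': "g \<in> borel_measurable mu"
    using g by (subst measurable_cong_sets[OF mu_sets refl])
  have "(\<integral>\<^sup>+y. g y \<partial>mu) = (\<integral>\<^sup>+y. g y \<partial>distr (\<Pi>\<^sub>M i\<in>(UNIV::nat set). mu) mu (\<lambda>y. y i))"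
    using distr_PiM_component[of UNIV "\<lambda>_::nat. mu" i] mu_prob by simp
  also have "\<dots> = (\<integral>\<^sup>+y. g (y i) \<partial>(\<Pi>\<^sub>M i\<in>(UNIV::nat set). mu))"
    by (rule nn_integral_distr) (simp_all add: g')
  finally show ?thesis by simp
qed

lemma displ_prod:
  assumes g: "g \<in> borel_measurable borel"
  shows "(\<integral>\<^sup>+y. (\<Prod>i<n. g (y i)) \<partial>(\<Pi>\<^sub>M i\<in>(UNIV::nat set). mu)) = (\<integral>\<^sup>+y. g y \<partial>mu) ^ n"
proof -
  interpret D: prob_space "\<Pi>\<^sub>M i\<in>(UNIV::nat set). mu" by (rule displ_prob)
  have "D.indep_vars (\<lambda>_. borel) (\<lambda>i y. g (y i)) UNIV"
    by (rule D.indep_vars_compose2[OF indep_displ]) (rule g)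
  then have "D.indep_vars (\<lambda>_. borel) (\<lambda>i y. g (y i)) {..<n}"
    by (rule D.indep_vars_subset) simp
  then show ?thesis
    using D.indep_vars_nn_integral[of "{..<n}" "\<lambda>i y. g (y i)"] nn_integral_displ_component[OF g] by simp
qed

text \<open>Both variables of the independent pair must have the same type, hence the detour over
  restrictions of the tree to the root and to its complement.\<close>

lemma root_rest:
  assumes [measurable]: "case_prod \<Phi> \<in> borel_measurable (child_space \<Otimes>\<^sub>M (\<Pi>\<^sub>M i\<in>(UNIV::nat set). tree_space))"
  shows "(\<integral>\<^sup>+t. \<Phi> (t []) (\<lambda>(i::nat) u. t (i # u)) \<partial>tree_law)
    = (\<integral>\<^sup>+c. \<integral>\<^sup>+t. \<Phi> c (\<lambda>(i::nat) u. t (i # u)) \<partial>tree_law \<partial>child_law)"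
proof -
  let ?K = "\<lambda>b. if b then {[]} else {u :: nat list. u \<noteq> []}"
  let ?A = "PiM {[]} (\<lambda>_::nat list. child_space)"
  let ?B = "PiM {u :: nat list. u \<noteq> []} (\<lambda>_. child_space)"
  let ?f = "\<lambda>t :: nat list \<Rightarrow> nat \<times> (nat \<Rightarrow> real). t []"
  let ?g = "\<lambda>t :: nat list \<Rightarrow> nat \<times> (nat \<Rightarrow> real). \<lambda>i u. t (i # u)"
  let ?rA = "\<lambda>t. restrict t {[]} :: nat list \<Rightarrow> nat \<times> (nat \<Rightarrow> real)"
  let ?rB = "\<lambda>t. restrict t {u. u \<noteq> []} :: nat list \<Rightarrow> nat \<times> (nat \<Rightarrow> real)"
  have ind: "tree.indep_vars (\<lambda>b. PiM (?K b) (\<lambda>_. child_space)) (\<lambda>b t. restrict t (?K b)) UNIV"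
    using tree.indep_vars_restrict[OF indep_coords, of UNIV ?K]
    by (auto simp: disjoint_family_on_def)
  have iv: "tree.indep_var ?A ?rA ?B ?rB"
    unfolding tree.indep_var_def
    by (rule back_subst[where P="\<lambda>x. x", OF ind]) (intro arg_cong3[where f=tree.indep_vars] ext; simp split: bool.split)
  have f [measurable]: "?f \<in> measurable ?A child_space"
    by (rule measurable_component_singleton) simp
  have g [measurable]: "?g \<in> measurable ?B (\<Pi>\<^sub>M i\<in>UNIV. tree_space)"
    by (intro measurable_PiM_single' measurable_component_singleton) (auto simp: space_PiM space_pair_measure)
  have g2 [measurable]: "?g \<in> measurable tree_space (\<Pi>\<^sub>M i\<in>UNIV. tree_space)"
    by (intro measurable_PiM_single' measurable_component_singleton) (auto simp: space_PiM space_pair_measure)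
  have rA [measurable]: "?rA \<in> measurable tree_law ?A" and rB [measurable]: "?rB \<in> measurable tree_law ?B"
   and eq: "distr tree_law ?A ?rA \<Otimes>\<^sub>M distr tree_law ?B ?rB = distr tree_law (?A \<Otimes>\<^sub>M ?B) (\<lambda>t. (?rA t, ?rB t))"
    using tree.indep_var_distribution_eq[THEN iffD1, OF iv] by iprover+
  note d = distr_coord[of "[]"]
  interpret B: prob_space "distr tree_law ?B ?rB"
    by (rule tree.prob_space_distr) (rule rB)
  have P2: "(\<lambda>p. \<Phi> (fst p []) (?g (snd p))) \<in> borel_measurable (?A \<Otimes>\<^sub>M ?B)"
    using measurable_compose[OF measurable_Pair[OF measurable_compose[OF measurable_fst f]
      measurable_compose[OF measurable_snd g]] assms] by simp
  have gm: "(\<lambda>y. \<Phi> c (?g y)) \<in> borel_measurable ?B" for c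
    using measurable_compose[OF g measurable_compose[OF measurable_Pair1' assms]]
    by (simp add: space_pair_measure space_PiM)
  have sp: "sets (child_space \<Otimes>\<^sub>M tree_law) = sets (child_space \<Otimes>\<^sub>M tree_space)"
    by (rule sets_pair_measure_cong) simp_all
  have "(\<lambda>(c, t). \<Phi> c (?g t)) \<in> borel_measurable (child_space \<Otimes>\<^sub>M tree_law)"
    unfolding measurable_cong_sets[OF sp refl]
    using measurable_compose[OF measurable_Pair[OF measurable_fst
      measurable_compose[OF measurable_snd g2]] assms]
    by (simp only: case_prod_beta' fst_conv snd_conv)
  from tree.borel_measurable_nn_integral_fst[OF this]
  have gm2: "(\<lambda>c. \<integral>\<^sup>+t. \<Phi> c (?g t) \<partial>tree_law) \<in> borel_measurable child_space"
    by (simp only: prod.case)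
  have nnd: "f \<in> borel_measurable N \<Longrightarrow> T \<in> measurable M N \<Longrightarrow> integral\<^sup>N (distr M N T) f = (\<integral>\<^sup>+x. f (T x) \<partial>M)"
    for f :: "'z \<Rightarrow> ennreal" and N and M :: "'y measure" and T
    by (rule nn_integral_distr) simp_all
  have P2': "(\<lambda>p. \<Phi> (fst p []) (?g (snd p))) \<in> borel_measurable (distr tree_law ?A ?rA \<Otimes>\<^sub>M distr tree_law ?B ?rB)"
    using P2 by (simp cong: measurable_cong_sets sets_pair_measure_cong)
  have "(\<integral>\<^sup>+t. \<Phi> (t []) (\<lambda>i u. t (i # u)) \<partial>tree_law) =
     (\<integral>\<^sup>+p. \<Phi> (fst p []) (?g (snd p)) \<partial>distr tree_law (?A \<Otimes>\<^sub>M ?B) (\<lambda>t. (?rA t, ?rB t)))"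
    by (subst nnd[OF P2 measurable_Pair[OF rA rB]]) simp
  also have "\<dots> = (\<integral>\<^sup>+x. \<integral>\<^sup>+y. \<Phi> (x []) (?g y) \<partial>distr tree_law ?B ?rB \<partial>distr tree_law ?A ?rA)"
    unfolding eq[symmetric] by (subst B.nn_integral_fst[OF P2', symmetric]) simp
  also have "\<dots> = (\<integral>\<^sup>+x. \<integral>\<^sup>+t. \<Phi> (x []) (?g t) \<partial>tree_law \<partial>distr tree_law ?A ?rA)"
    by (intro nn_integral_cong) (subst nnd[OF gm rB], simp)
  also have "\<dots> = (\<integral>\<^sup>+x. \<integral>\<^sup>+t. \<Phi> (x []) (?g t) \<partial>tree_law \<partial>tree_law)"
    by (subst nnd[OF measurable_compose[OF f gm2] rA]) simp
  also have "\<dots> = (\<integral>\<^sup>+c. \<integral>\<^sup>+t. \<Phi> c (?g t) \<partial>tree_law \<partial>distr tree_law child_space ?f)"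
    by (rule nnd[OF gm2 measurable_coord, symmetric])
  finally show ?thesis by (simp only: d)
qed

end

section \<open>Branching recursions for products and sums over a generation\<close>

text \<open>The recursion descends from the root instead of appending a last generation, so one step
  of it is one use of the branching property at the root. Products give probabilities that no
  particle is marked, sums give first moments.\<close>

primrec tree_prod :: "(real \<Rightarrow> ennreal) \<Rightarrow> nat \<Rightarrow> real \<Rightarrow> (nat list \<Rightarrow> nat \<times> (nat \<Rightarrow> real)) \<Rightarrow> ennreal" where
  "tree_prod \<theta> 0 v t = \<theta> v"
| "tree_prod \<theta> (Suc k) v t = (\<Prod>i<fst (t []). tree_prod \<theta> k (v + snd (t []) i) (\<lambda>u. t (i # u)))"

primrec tree_sum :: "(real \<Rightarrow> ennreal) \<Rightarrow> nat \<Rightarrow> real \<Rightarrow> (nat list \<Rightarrow> nat \<times> (nat \<Rightarrow> real)) \<Rightarrow> ennreal" where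
  "tree_sum \<theta> 0 v t = \<theta> v"
| "tree_sum \<theta> (Suc k) v t = (\<Sum>i<fst (t []). tree_sum \<theta> k (v + snd (t []) i) (\<lambda>u. t (i # u)))"

text \<open>The number of factors is random but countably valued, so measurability follows from the
  case of a fixed number.\<close>

lemma borel_measurable_random_prod_sum:
  fixes f :: "nat \<Rightarrow> 'z \<Rightarrow> ennreal"
  assumes f: "\<And>i. f i \<in> borel_measurable M" and g: "g \<in> measurable M (count_space UNIV)"
  shows "(\<lambda>x. \<Prod>i<g x. f i x) \<in> borel_measurable M" "(\<lambda>x. \<Sum>i<g x. f i x) \<in> borel_measurable M"
  using measurable_compose_countable[where f="\<lambda>n x. \<Prod>i<n. f i x" and g=g and M=M and N=borel]
    measurable_compose_countable[where f="\<lambda>n x. \<Sum>i<n. f i x" and g=g and M=M and N=borel]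
    f g by (auto intro!: borel_measurable_prod_ennreal borel_measurable_sum)

context offspring_law
begin

lemma nn_integral_subtree:
  assumes f: "f \<in> borel_measurable tree_space"
  shows "(\<integral>\<^sup>+t. f (\<lambda>u. t (i # u)) \<partial>tree_law) = (\<integral>\<^sup>+t. f t \<partial>tree_law)"
proof -
  have "(\<integral>\<^sup>+t. f t \<partial>tree_law) = (\<integral>\<^sup>+t. f t \<partial>distr tree_law tree_law (\<lambda>t. \<lambda>u. t (i # u)))"
    by (simp only: distr_subtree)
  also have "\<dots> = (\<integral>\<^sup>+t. f (\<lambda>u. t (i # u)) \<partial>tree_law)"
    using measurable_subtree[of i] f by (intro nn_integral_distr) (simp_all cong: measurable_cong_sets)
  finally show ?thesis by simp
qed

text \<open>The subtrees of distinct children read disjoint sets of labels, hence are independent,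
  and each has the law of the whole tree.\<close>

lemma nn_integral_subtrees_prod:
  assumes f: "\<And>i. f i \<in> borel_measurable tree_space"
  shows "(\<integral>\<^sup>+t. (\<Prod>i<n. f i (\<lambda>u. t (i # u))) \<partial>tree_law) = (\<Prod>i<n. \<integral>\<^sup>+t. f i t \<partial>tree_law)"
proof -
  have 1: "tree.indep_vars (\<lambda>i. PiM (range (Cons i)) (\<lambda>_. child_space))
     (\<lambda>i t. restrict (\<lambda>u. t u) (range (Cons i))) {..<n}"
    by (rule tree.indep_vars_restrict[OF indep_coords]) (auto simp: disjoint_family_on_def)
  have 2: "(\<lambda>r. f i (\<lambda>u. r (i # u))) \<in> borel_measurable (PiM (range (Cons i)) (\<lambda>_. child_space))" for i
    by (rule measurable_compose[OF _ f])
      (intro measurable_PiM_single' measurable_component_singleton; auto simp: space_PiM space_pair_measure)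
  have "tree.indep_vars (\<lambda>_. borel) (\<lambda>i t. f i (\<lambda>u. (restrict (\<lambda>u. t u) (range (Cons i))) (i # u))) {..<n}"
    by (rule tree.indep_vars_compose2[OF 1 2])
  then have "tree.indep_vars (\<lambda>_. borel) (\<lambda>i t. f i (\<lambda>u. t (i # u))) {..<n}"
    by simp
  from tree.indep_vars_nn_integral[OF _ this] show ?thesis
    using nn_integral_subtree[OF f] by simp
qed

lemma borel_measurable_branch:
  fixes \<Phi> :: "real \<Rightarrow> (nat list \<Rightarrow> nat \<times> (nat \<Rightarrow> real)) \<Rightarrow> ennreal"
  assumes \<Phi>: "case_prod \<Phi> \<in> borel_measurable (borel \<Otimes>\<^sub>M tree_space)"
  shows "(\<lambda>(c, r). \<Phi> (snd c i) (r i)) \<in> borel_measurable (child_space \<Otimes>\<^sub>M (\<Pi>\<^sub>M i\<in>(UNIV::nat set). tree_space))"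
proof -
  have 1: "(\<lambda>x. snd (fst x) i) \<in> borel_measurable (child_space \<Otimes>\<^sub>M (\<Pi>\<^sub>M i\<in>(UNIV::nat set). tree_space))"
    by (rule measurable_compose[OF measurable_compose[OF measurable_fst measurable_snd] measurable_component_singleton]) simp
  have 2: "(\<lambda>x. snd x i) \<in> measurable (child_space \<Otimes>\<^sub>M (\<Pi>\<^sub>M i\<in>(UNIV::nat set). tree_space)) tree_space"
    by (rule measurable_compose[OF measurable_snd measurable_component_singleton]) simp
  from measurable_compose[OF measurable_Pair[OF 1 2] \<Phi>] show ?thesis
    by (simp add: case_prod_beta')
qed

lemma measurable_displ: "(\<lambda>c. snd c i) \<in> borel_measurable child_space"
  by (rule measurable_compose[OF measurable_snd measurable_component_singleton]) simp

lemma measurable_fst_fst: "(\<lambda>x. fst (fst x)) \<in> measurable (child_space \<Otimes>\<^sub>M M) (count_space UNIV)"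
  by (rule measurable_compose[OF measurable_fst measurable_fst])

lemma section_measurable:
  fixes \<Phi> :: "real \<Rightarrow> (nat list \<Rightarrow> nat \<times> (nat \<Rightarrow> real)) \<Rightarrow> ennreal"
  assumes \<Phi>: "case_prod \<Phi> \<in> borel_measurable (borel \<Otimes>\<^sub>M tree_space)"
  shows "\<Phi> v \<in> borel_measurable tree_space"
    and "(\<lambda>v. \<integral>\<^sup>+t. \<Phi> v t \<partial>tree_law) \<in> borel_measurable borel"
proof -
  show "\<Phi> v \<in> borel_measurable tree_space"
    using measurable_compose[OF measurable_Pair1' \<Phi>, of v] by simp
  have "case_prod \<Phi> \<in> borel_measurable (borel \<Otimes>\<^sub>M tree_law)"
    using \<Phi> by (simp cong: measurable_cong_sets sets_pair_measure_cong)
  from tree.borel_measurable_nn_integral_fst[OF this]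
  show "(\<lambda>v. \<integral>\<^sup>+t. \<Phi> v t \<partial>tree_law) \<in> borel_measurable borel" by simp
qed

lemma nn_integral_child_law:
  assumes f: "case_prod f \<in> borel_measurable child_space"
  shows "(\<integral>\<^sup>+c. f (fst c) (snd c) \<partial>child_law) = (\<integral>\<^sup>+n. \<integral>\<^sup>+y. f n y \<partial>(\<Pi>\<^sub>M i\<in>(UNIV::nat set). mu) \<partial>measure_pmf nu)"
proof -
  interpret D: prob_space "\<Pi>\<^sub>M i\<in>(UNIV::nat set). mu" by (rule displ_prob)
  have "case_prod f \<in> borel_measurable child_law"
    using f by (simp cong: measurable_cong_sets)
  then have "(\<lambda>c. f (fst c) (snd c)) \<in> borel_measurable (measure_pmf nu \<Otimes>\<^sub>M (\<Pi>\<^sub>M i\<in>(UNIV::nat set). mu))"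
    by (simp only: child_law_def case_prod_beta')
  from D.nn_integral_fst[OF this] show ?thesis
    by (simp add: child_law_def)
qed

text \<open>Given the root, independence of the subtrees factors the expectation; independence of
  the displacements then leaves a power, so the generating function of \<open>nu\<close>
  appears.\<close>

lemma nn_integral_branch_prod:
  assumes \<Phi>: "case_prod \<Phi> \<in> borel_measurable (borel \<Otimes>\<^sub>M tree_space)"
  shows "(\<integral>\<^sup>+t. (\<Prod>i<fst (t []). \<Phi> (snd (t []) i) (\<lambda>u. t (i # u))) \<partial>tree_law)
    = (\<integral>\<^sup>+n. (\<integral>\<^sup>+y. \<integral>\<^sup>+t. \<Phi> y t \<partial>tree_law \<partial>mu) ^ n \<partial>measure_pmf nu)"
proof -
  have 1: "(\<lambda>(c, r). \<Prod>i<fst c. \<Phi> (snd c i) (r i)) \<in> borel_measurable (child_space \<Otimes>\<^sub>M (\<Pi>\<^sub>M i\<in>(UNIV::nat set). tree_space))"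
    using borel_measurable_random_prod_sum(1)[where f="\<lambda>i (c, r). \<Phi> (snd c i) (r i)", OF borel_measurable_branch[OF \<Phi>] measurable_fst_fst]
    by (simp add: case_prod_beta')
  have g: "(\<lambda>y. \<integral>\<^sup>+t. \<Phi> y t \<partial>tree_law) \<in> borel_measurable borel"
    by (rule section_measurable[OF \<Phi>])
  have c: "(\<lambda>x. \<integral>\<^sup>+t. \<Phi> (snd x i) t \<partial>tree_law) \<in> borel_measurable child_space" for i
    by (rule measurable_compose[OF measurable_displ g])
  have 2: "(\<lambda>(n, y). \<Prod>i<n. \<integral>\<^sup>+t. \<Phi> (y i) t \<partial>tree_law) \<in> borel_measurable child_space"
    using borel_measurable_random_prod_sum(1)[where f="\<lambda>i x. \<integral>\<^sup>+t. \<Phi> (snd x i) t \<partial>tree_law", OF c measurable_fst]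
    by (simp add: case_prod_beta')
  have "(\<integral>\<^sup>+t. (\<Prod>i<fst (t []). \<Phi> (snd (t []) i) (\<lambda>u. t (i # u))) \<partial>tree_law)
    = (\<integral>\<^sup>+c. \<integral>\<^sup>+t. (\<Prod>i<fst c. \<Phi> (snd c i) (\<lambda>u. t (i # u))) \<partial>tree_law \<partial>child_law)"
    by (rule root_rest[OF 1])
  also have "\<dots> = (\<integral>\<^sup>+c. (\<Prod>i<fst c. \<integral>\<^sup>+t. \<Phi> (snd c i) t \<partial>tree_law) \<partial>child_law)"
    by (intro nn_integral_cong nn_integral_subtrees_prod section_measurable[OF \<Phi>])
  also have "\<dots> = (\<integral>\<^sup>+n. \<integral>\<^sup>+y. (\<Prod>i<n. \<integral>\<^sup>+t. \<Phi> (y i) t \<partial>tree_law) \<partial>(\<Pi>\<^sub>M i\<in>(UNIV::nat set). mu) \<partial>measure_pmf nu)"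
    by (rule nn_integral_child_law[OF 2])
  also have "\<dots> = (\<integral>\<^sup>+n. (\<integral>\<^sup>+y. \<integral>\<^sup>+t. \<Phi> y t \<partial>tree_law \<partial>mu) ^ n \<partial>measure_pmf nu)"
    by (intro nn_integral_cong displ_prod g)
  finally show ?thesis .
qed

text \<open>Wald's identity: the number of children is independent of their displacements and
  subtrees.\<close>

lemma nn_integral_branch_sum:
  assumes \<Phi>: "case_prod \<Phi> \<in> borel_measurable (borel \<Otimes>\<^sub>M tree_space)"
  shows "(\<integral>\<^sup>+t. (\<Sum>i<fst (t []). \<Phi> (snd (t []) i) (\<lambda>u. t (i # u))) \<partial>tree_law)
    = (\<integral>\<^sup>+n. of_nat n \<partial>measure_pmf nu) * (\<integral>\<^sup>+y. \<integral>\<^sup>+t. \<Phi> y t \<partial>tree_law \<partial>mu)"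
proof -
  have 1: "(\<lambda>(c, r). \<Sum>i<fst c. \<Phi> (snd c i) (r i)) \<in> borel_measurable (child_space \<Otimes>\<^sub>M (\<Pi>\<^sub>M i\<in>(UNIV::nat set). tree_space))"
    using borel_measurable_random_prod_sum(2)[where f="\<lambda>i (c, r). \<Phi> (snd c i) (r i)", OF borel_measurable_branch[OF \<Phi>] measurable_fst_fst]
    by (simp add: case_prod_beta')
  have g: "(\<lambda>y. \<integral>\<^sup>+t. \<Phi> y t \<partial>tree_law) \<in> borel_measurable borel"
    by (rule section_measurable[OF \<Phi>])
  have c: "(\<lambda>x. \<integral>\<^sup>+t. \<Phi> (snd x i) t \<partial>tree_law) \<in> borel_measurable child_space" for i
    by (rule measurable_compose[OF measurable_displ g])
  have 2: "(\<lambda>(n, y). \<Sum>i<n. \<integral>\<^sup>+t. \<Phi> (y i) t \<partial>tree_law) \<in> borel_measurable child_space"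
    using borel_measurable_random_prod_sum(2)[where f="\<lambda>i x. \<integral>\<^sup>+t. \<Phi> (snd x i) t \<partial>tree_law", OF c measurable_fst]
    by (simp add: case_prod_beta')
  have sub: "(\<lambda>t. \<Phi> v (\<lambda>u. t (i # u))) \<in> borel_measurable tree_law" for v i
    using measurable_compose[OF measurable_subtree section_measurable(1)[OF \<Phi>]]
    by (simp cong: measurable_cong_sets)
  have yi: "(\<lambda>y. \<integral>\<^sup>+t. \<Phi> (y i) t \<partial>tree_law) \<in> borel_measurable (\<Pi>\<^sub>M i\<in>(UNIV::nat set). mu)" for i
    by (rule measurable_compose[OF measurable_component_singleton]) (use g in \<open>simp_all cong: measurable_cong_sets\<close>)
  have "(\<integral>\<^sup>+t. (\<Sum>i<fst (t []). \<Phi> (snd (t []) i) (\<lambda>u. t (i # u))) \<partial>tree_law)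
    = (\<integral>\<^sup>+c. \<integral>\<^sup>+t. (\<Sum>i<fst c. \<Phi> (snd c i) (\<lambda>u. t (i # u))) \<partial>tree_law \<partial>child_law)"
    by (rule root_rest[OF 1])
  also have "\<dots> = (\<integral>\<^sup>+c. (\<Sum>i<fst c. \<integral>\<^sup>+t. \<Phi> (snd c i) t \<partial>tree_law) \<partial>child_law)"
    by (subst nn_integral_sum) (simp_all add: sub nn_integral_subtree[OF section_measurable(1)[OF \<Phi>]])
  also have "\<dots> = (\<integral>\<^sup>+n. \<integral>\<^sup>+y. (\<Sum>i<n. \<integral>\<^sup>+t. \<Phi> (y i) t \<partial>tree_law) \<partial>(\<Pi>\<^sub>M i\<in>(UNIV::nat set). mu) \<partial>measure_pmf nu)"
    by (rule nn_integral_child_law[OF 2])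
  also have "\<dots> = (\<integral>\<^sup>+n. of_nat n * (\<integral>\<^sup>+y. \<integral>\<^sup>+t. \<Phi> y t \<partial>tree_law \<partial>mu) \<partial>measure_pmf nu)"
    by (intro nn_integral_cong, subst nn_integral_sum) (simp_all add: yi nn_integral_displ_component[OF g])
  also have "\<dots> = (\<integral>\<^sup>+n. of_nat n \<partial>measure_pmf nu) * (\<integral>\<^sup>+y. \<integral>\<^sup>+t. \<Phi> y t \<partial>tree_law \<partial>mu)"
    by (rule nn_integral_multc) simp
  finally show ?thesis .
qed

lemma shifted_subtree_measurable:
  fixes \<Phi> :: "real \<Rightarrow> (nat list \<Rightarrow> nat \<times> (nat \<Rightarrow> real)) \<Rightarrow> ennreal"
  assumes \<Phi>: "case_prod \<Phi> \<in> borel_measurable (borel \<Otimes>\<^sub>M tree_space)"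
  shows "(\<lambda>(v, t). \<Phi> (v + snd (t []) i) (\<lambda>u. t (i # u))) \<in> borel_measurable (borel \<Otimes>\<^sub>M tree_space)"
proof -
  have 0: "(\<lambda>t. t []) \<in> measurable tree_space child_space"
    by (rule measurable_component_singleton) simp
  have d: "(\<lambda>x. snd (snd x []) i) \<in> borel_measurable (borel \<Otimes>\<^sub>M tree_space)"
    by (rule measurable_compose[OF measurable_compose[OF measurable_snd 0] measurable_displ])
  have 1: "(\<lambda>x. fst x + snd (snd x []) i) \<in> borel_measurable (borel \<Otimes>\<^sub>M tree_space)"
    by (rule borel_measurable_add[OF measurable_fst d])
  have 2: "(\<lambda>x. \<lambda>u. snd x (i # u)) \<in> measurable (borel \<Otimes>\<^sub>M tree_space) tree_space"
    by (rule measurable_compose[OF measurable_snd measurable_subtree])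
  from measurable_compose[OF measurable_Pair[OF 1 2] \<Phi>] show ?thesis
    by (simp add: case_prod_beta')
qed

lemma measurable_root_count: "(\<lambda>x. fst (snd x [])) \<in> measurable (borel \<Otimes>\<^sub>M tree_space) (count_space UNIV)"
proof -
  have 0: "(\<lambda>t. t []) \<in> measurable tree_space child_space"
    by (rule measurable_component_singleton) simp
  show ?thesis
    by (rule measurable_compose[OF measurable_compose[OF measurable_snd 0] measurable_fst])
qed

lemma tree_prod_measurable:
  assumes "\<theta> \<in> borel_measurable borel"
  shows "case_prod (tree_prod \<theta> k) \<in> borel_measurable (borel \<Otimes>\<^sub>M tree_space)"
proof (induction k)
  case 0
  then show ?case
    using measurable_compose[OF measurable_fst assms] by (simp add: case_prod_beta')
next
  case (Suc k)
  show ?case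
    using borel_measurable_random_prod_sum(1)[where f="\<lambda>i (v, t). tree_prod \<theta> k (v + snd (t []) i) (\<lambda>u. t (i # u))",
        OF shifted_subtree_measurable[OF Suc] measurable_root_count]
    by (simp add: case_prod_beta')
qed

lemma tree_sum_measurable:
  assumes "\<theta> \<in> borel_measurable borel"
  shows "case_prod (tree_sum \<theta> k) \<in> borel_measurable (borel \<Otimes>\<^sub>M tree_space)"
proof (induction k)
  case 0
  then show ?case
    using measurable_compose[OF measurable_fst assms] by (simp add: case_prod_beta')
next
  case (Suc k)
  show ?case
    using borel_measurable_random_prod_sum(2)[where f="\<lambda>i (v, t). tree_sum \<theta> k (v + snd (t []) i) (\<lambda>u. t (i # u))",
        OF shifted_subtree_measurable[OF Suc] measurable_root_count]
    by (simp add: case_prod_beta')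
qed

lemma measurable_translate:
  fixes \<Phi> :: "real \<Rightarrow> (nat list \<Rightarrow> nat \<times> (nat \<Rightarrow> real)) \<Rightarrow> ennreal"
  assumes \<Phi>: "case_prod \<Phi> \<in> borel_measurable (borel \<Otimes>\<^sub>M tree_space)"
  shows "(\<lambda>(y, t). \<Phi> (v + y) t) \<in> borel_measurable (borel \<Otimes>\<^sub>M tree_space)"
proof -
  have 1: "(\<lambda>x. v + fst x) \<in> borel_measurable (borel \<Otimes>\<^sub>M tree_space)"
    by (rule borel_measurable_add[OF measurable_const measurable_fst]) simp
  from measurable_compose[OF measurable_Pair[OF 1 measurable_snd] \<Phi>] show ?thesis
    by (simp add: case_prod_beta')
qed

lemma nn_integral_tree_prod_Suc:
  assumes "\<theta> \<in> borel_measurable borel"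
  shows "(\<integral>\<^sup>+t. tree_prod \<theta> (Suc k) v t \<partial>tree_law)
    = (\<integral>\<^sup>+n. (\<integral>\<^sup>+y. \<integral>\<^sup>+t. tree_prod \<theta> k (v + y) t \<partial>tree_law \<partial>mu) ^ n \<partial>measure_pmf nu)"
  using nn_integral_branch_prod[where \<Phi>="\<lambda>y t. tree_prod \<theta> k (v + y) t", OF measurable_translate[OF tree_prod_measurable[OF assms]]]
  by simp

lemma nn_integral_tree_sum_Suc:
  assumes "\<theta> \<in> borel_measurable borel"
  shows "(\<integral>\<^sup>+t. tree_sum \<theta> (Suc k) v t \<partial>tree_law)
    = (\<integral>\<^sup>+n. of_nat n \<partial>measure_pmf nu) * (\<integral>\<^sup>+y. \<integral>\<^sup>+t. tree_sum \<theta> k (v + y) t \<partial>tree_law \<partial>mu)"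
  using nn_integral_branch_sum[where \<Phi>="\<lambda>y t. tree_sum \<theta> k (v + y) t", OF measurable_translate[OF tree_sum_measurable[OF assms]]]
  by simp

end

section \<open>From labelled particles to trees\<close>

lemma generation_0: "generation N 0 \<omega> = {[]}"
  by (auto simp: generation_def)

lemma generation_Suc:
  "generation N (Suc n) \<omega> = (\<Union>i<N [] \<omega>. Cons i ` generation (\<lambda>u. N (i # u)) n \<omega>)"
proof (intro set_eqI iffI)
  fix u assume u: "u \<in> generation N (Suc n) \<omega>"
  then obtain i w where iw: "u = i # w" "length w = n" by (cases u) (auto simp: generation_def)
  have "w ! k < N (i # take k w) \<omega>" if "k < n" for k
    using u iw that unfolding generation_def by (auto dest!: spec[of _ "Suc k"])
  moreover have "i < N [] \<omega>"
    using u iw unfolding generation_def by (auto dest!: spec[of _ 0])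
  ultimately show "u \<in> (\<Union>i<N [] \<omega>. Cons i ` generation (\<lambda>u. N (i # u)) n \<omega>)"
    using iw by (auto simp: generation_def)
next
  fix u assume "u \<in> (\<Union>i<N [] \<omega>. Cons i ` generation (\<lambda>u. N (i # u)) n \<omega>)"
  then show "u \<in> generation N (Suc n) \<omega>"
    by (auto simp: generation_def nth_Cons less_Suc_eq_0_disj split: nat.split)
qed

lemma position_Nil: "position Y [] \<omega> = 0"
  by (simp add: position_def)

lemma position_Cons: "position Y (i # u) \<omega> = Y [] i \<omega> + position (\<lambda>u. Y (i # u)) u \<omega>"
  unfolding position_def by (simp add: sum.lessThan_Suc_shift del: sum.lessThan_Suc)

text \<open>Both families vary in the induction, because the subtree of child \<open>i\<close> is
  described by the families shifted by the prefix \<open>i\<close>.\<close>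

lemma prod_generation:
  "(\<Prod>u\<in>generation N n \<omega>. \<theta> (v + position Y u \<omega>)) = tree_prod \<theta> n v (\<lambda>u. (N u \<omega>, \<lambda>i. Y u i \<omega>))"
proof (induction n arbitrary: N Y v)
  case 0
  then show ?case by (simp add: generation_0 position_Nil)
next
  case (Suc n)
  show ?case
    unfolding generation_Suc
    by (subst prod.UNION_disjoint)
      (auto simp: finite_generation prod.reindex position_Cons Suc.IH add.assoc[symmetric])
qed

lemma sum_generation:
  "(\<Sum>u\<in>generation N n \<omega>. \<theta> (v + position Y u \<omega>)) = tree_sum \<theta> n v (\<lambda>u. (N u \<omega>, \<lambda>i. Y u i \<omega>))"
proof (induction n arbitrary: N Y v)
  case 0
  then show ?case by (simp add: generation_0 position_Nil)
next
  case (Suc n)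
  show ?case
    unfolding generation_Suc
    by (subst sum.UNION_disjoint)
      (auto simp: finite_generation sum.reindex position_Cons Suc.IH add.assoc[symmetric])
qed

context branching_random_walk
begin

sublocale law: offspring_law nu mu
  by (rule offspring_law.intro) (rule mu_prob, rule mu_sets)

abbreviation (input) sample_tree :: "'a \<Rightarrow> nat list \<Rightarrow> nat \<times> (nat \<Rightarrow> real)" where
  "sample_tree \<omega> \<equiv> (\<lambda>u. (N u \<omega>, \<lambda>i. Y u i \<omega>))"

lemma measurable_particle: "(\<lambda>\<omega>. (N u \<omega>, \<lambda>i. Y u i \<omega>)) \<in> measurable P child_space"
proof -
  from particles_indep[unfolded indep_vars_def]
  have "\<forall>u\<in>UNIV. (\<lambda>\<omega>. (N u \<omega>, \<lambda>i. Y u i \<omega>)) \<in> measurable P child_space" by (rule conjunct1)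
  then show ?thesis by (rule bspec) (rule UNIV_I)
qed

lemma measurable_sample_tree: "sample_tree \<in> measurable P tree_space"
  by (intro measurable_PiM_single' measurable_particle) (auto simp: space_PiM space_pair_measure)

lemma distr_sample_tree: "distr P tree_space sample_tree = law.tree_law"
proof -
  have "distr P tree_space (\<lambda>\<omega>. \<lambda>u\<in>UNIV. (N u \<omega>, \<lambda>i. Y u i \<omega>)) = (\<Pi>\<^sub>M u\<in>UNIV. distr P child_space (\<lambda>\<omega>. (N u \<omega>, \<lambda>i. Y u i \<omega>)))"
    by (rule indep_vars_iff_distr_eq_PiM[THEN iffD1, OF _ _ particles_indep]) (rule UNIV_not_empty, rule measurable_particle)
  then show ?thesis
    by (simp only: particle_law restrict_UNIV law.tree_law_def law.child_law_def)
qed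

lemma nn_integral_sample_tree:
  assumes "f \<in> borel_measurable tree_space"
  shows "(\<integral>\<^sup>+\<omega>. f (sample_tree \<omega>) \<partial>P) = (\<integral>\<^sup>+t. f t \<partial>law.tree_law)"
proof -
  have "(\<integral>\<^sup>+t. f t \<partial>distr P tree_space sample_tree) = (\<integral>\<^sup>+\<omega>. f (sample_tree \<omega>) \<partial>P)"
    by (rule nn_integral_distr[OF measurable_sample_tree]) (use assms in simp)
  then show ?thesis
    by (simp only: distr_sample_tree)
qed

lemma borel_measurable_prod_generation:
  assumes "\<theta> \<in> borel_measurable borel"
  shows "(\<lambda>\<omega>. \<Prod>u\<in>generation N n \<omega>. \<theta> (v + position Y u \<omega>) :: ennreal) \<in> borel_measurable P"
  unfolding prod_generation
  by (rule measurable_compose[OF measurable_sample_tree law.section_measurable(1)[OF law.tree_prod_measurable[OF assms]]])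

lemma borel_measurable_sum_generation:
  assumes "\<theta> \<in> borel_measurable borel"
  shows "(\<lambda>\<omega>. \<Sum>u\<in>generation N n \<omega>. \<theta> (v + position Y u \<omega>) :: ennreal) \<in> borel_measurable P"
  unfolding sum_generation
  by (rule measurable_compose[OF measurable_sample_tree law.section_measurable(1)[OF law.tree_sum_measurable[OF assms]]])

lemma nn_integral_prod_generation:
  assumes "\<theta> \<in> borel_measurable borel"
  shows "(\<integral>\<^sup>+\<omega>. (\<Prod>u\<in>generation N n \<omega>. \<theta> (v + position Y u \<omega>)) \<partial>P) = (\<integral>\<^sup>+t. tree_prod \<theta> n v t \<partial>law.tree_law)"
  unfolding prod_generation
  by (rule nn_integral_sample_tree[OF law.section_measurable(1)[OF law.tree_prod_measurable[OF assms]]])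

lemma nn_integral_sum_generation:
  assumes "\<theta> \<in> borel_measurable borel"
  shows "(\<integral>\<^sup>+\<omega>. (\<Sum>u\<in>generation N n \<omega>. \<theta> (v + position Y u \<omega>)) \<partial>P) = (\<integral>\<^sup>+t. tree_sum \<theta> n v t \<partial>law.tree_law)"
  unfolding sum_generation
  by (rule nn_integral_sample_tree[OF law.section_measurable(1)[OF law.tree_sum_measurable[OF assms]]])

end

section \<open>Stretched exponential tails\<close>

lemma powr_diff_le:
  fixes s t b :: real
  assumes "0 < s" "s \<le> t" "0 < b" "b < 1"
  shows "t powr b - s powr b \<le> b * s powr (b - 1) * (t - s)"
proof (cases "s = t")
  case False
  then have "s < t" using assms by simp
  have "\<And>x. s \<le> x \<Longrightarrow> x \<le> t \<Longrightarrow> ((\<lambda>x. x powr b) has_real_derivative b * x powr (b - 1)) (at x)"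
    using assms by (auto intro!: has_real_derivative_powr)
  from MVT2[OF \<open>s < t\<close> this]
  obtain z where z: "s < z" "z < t" "t powr b - s powr b = (t - s) * (b * z powr (b - 1))" by auto
  have "z powr (b - 1) \<le> s powr (b - 1)"
    using z assms by (intro powr_mono2') auto
  then show ?thesis
    using z assms by (simp add: mult_left_mono mult.assoc mult.commute mult_mono)
qed simp

text \<open>Because \<open>d\<close> is at most \<open>t - d\<close>, the derivative at
  \<open>t - d\<close> can be traded for the one at \<open>d\<close>. The gain over plain
  subadditivity is the factor \<open>b\<close>: the ratio of tails at distance \<open>d\<close> then
  costs \<open>exp (lam * b * d powr b)\<close>, which the step law can still integrate.\<close>

lemma powr_diff_le_powr:
  fixes t d b :: real
  assumes "0 \<le> d" "d \<le> t / 2" "0 < b" "b < 1"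
  shows "t powr b - (t - d) powr b \<le> b * d powr b"
proof (cases "d = 0")
  case False
  then have d: "0 < d" "d \<le> t - d" using assms by auto
  have "t powr b - (t - d) powr b \<le> b * (t - d) powr (b - 1) * d"
    using powr_diff_le[of "t - d" t b] assms d by simp
  also have "\<dots> \<le> b * d powr (b - 1) * d"
    using assms d by (intro mult_right_mono mult_left_mono powr_mono2') auto
  also have "\<dots> = b * d powr b"
    using d by (simp add: powr_diff)
  finally show ?thesis .
qed simp

text \<open>One term of the exponential series suffices, with its index \<open>k\<close> so large
  that \<open>b * k\<close> reaches \<open>q\<close>.\<close>

lemma powr_exp_bound:
  fixes \<epsilon> b q :: real
  assumes "0 < \<epsilon>" "0 < b"
  obtains C where "0 < C" "\<And>r. 1 \<le> r \<Longrightarrow> r powr q * exp (- \<epsilon> * r powr b) \<le> C"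
proof -
  obtain k :: nat where k: "q \<le> b * real k"
    using real_arch_simple[of "q / b"] assms by (auto simp: field_simps)
  define C where "C = fact k / \<epsilon> ^ k"
  have "r powr q * exp (- \<epsilon> * r powr b) \<le> C" if r: "1 \<le> r" for r
  proof -
    have "(\<epsilon> * r powr b) ^ k / fact k \<le> exp (\<epsilon> * r powr b)"
      using summable_exp[of "\<epsilon> * r powr b"] sum_le_suminf[of "\<lambda>n. inverse (fact n) * (\<epsilon> * r powr b) ^ n" "{k}"] assms
      by (simp add: exp_def divide_inverse mult.commute)
    then have "exp (- \<epsilon> * r powr b) * (\<epsilon> * r powr b) ^ k \<le> fact k"
      by (simp add: exp_minus field_simps)
    then have "exp (- \<epsilon> * r powr b) * r powr (b * real k) \<le> C"
      using assms r by (simp add: C_def field_simps power_mult_distrib powr_powr[symmetric] powr_realpow)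
    moreover have "r powr q \<le> r powr (b * real k)"
      using k r by (intro powr_mono) auto
    ultimately show ?thesis
      by (smt (verit, best) exp_ge_zero mult.commute mult_left_mono)
  qed
  moreover have "0 < C" using assms by (simp add: C_def)
  ultimately show ?thesis using that by blast
qed

locale tail_shape =
  fixes a lam b :: real
  assumes lam_pos: "0 < lam" and b_pos: "0 < b" and b_less: "b < 1 / 2"
begin

text \<open>The density of the tilted step at \<open>-r\<close>, apart from the slowly converging
  factor \<open>l\<close>.\<close>

definition F :: "real \<Rightarrow> real" where
  "F r = r powr a * exp (- lam * r powr b)"

lemma F_nonneg: "0 \<le> F r"
  by (simp add: F_def)

lemma F_pos: "0 < r \<Longrightarrow> 0 < F r"
  by (simp add: F_def)

lemma F_measurable [measurable]: "F \<in> borel_measurable borel"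
  unfolding F_def[abs_def] by measurable

text \<open>The logarithmic derivative of \<open>F\<close> is nonpositive once
  \<open>lam * b * r powr b\<close> exceeds \<open>a\<close>. In terms of the logarithm
  \<open>w\<close> of the ratio \<open>s / r\<close> this is the inequality between
  \<open>exp (b * w)\<close> and \<open>1 + b * w\<close>. For positive \<open>a\<close>
  monotonicity can fail near the origin, hence the threshold \<open>r0\<close>.\<close>

lemma F_decreasing:
  obtains r0 where "1 \<le> r0" "\<And>r s. r0 \<le> r \<Longrightarrow> r \<le> s \<Longrightarrow> F s \<le> F r"
proof -
  define r0 where "r0 = max 1 ((\<bar>a\<bar> / (lam * b)) powr (1 / b))"
  have "F s \<le> F r" if rs: "r0 \<le> r" "r \<le> s" for r s
  proof -
    have r: "0 < r" "1 \<le> r" and s: "0 < s" using rs by (auto simp: r0_def)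
    have "(\<bar>a\<bar> / (lam * b)) powr (1 / b) \<le> r" using rs by (simp add: r0_def)
    then have "((\<bar>a\<bar> / (lam * b)) powr (1 / b)) powr b \<le> r powr b"
      using b_pos by (intro powr_mono2) auto
    then have "\<bar>a\<bar> / (lam * b) \<le> r powr b"
      using b_pos lam_pos by (simp add: powr_powr)
    then have ab: "a \<le> lam * b * r powr b"
      using b_pos lam_pos by (simp add: field_simps)
    define w where "w = ln (s / r)"
    have w: "0 \<le> w" using rs r by (simp add: w_def)
    have sr: "s = r * exp w" using r s by (simp add: w_def)
    have "1 + b * w \<le> exp (b * w)" by (rule exp_ge_add_one_self)
    then have "r powr b * (b * w) \<le> r powr b * (exp (b * w) - 1)"
      by (intro mult_left_mono) (linarith, simp)
    then have "lam * (r powr b * (b * w)) \<le> lam * (s powr b - r powr b)"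
      using lam_pos r by (intro mult_left_mono) (auto simp: sr powr_mult exp_powr_real algebra_simps)
    moreover have "a * w \<le> lam * b * r powr b * w"
      using ab w by (intro mult_right_mono)
    ultimately have "a * w - lam * s powr b \<le> - lam * r powr b"
      by (simp add: algebra_simps)
    then have "r powr a * exp (a * w - lam * s powr b) \<le> F r"
      unfolding F_def by (intro mult_left_mono) auto
    also have "r powr a * exp (a * w - lam * s powr b) = F s"
      using r unfolding F_def by (simp add: sr powr_mult exp_powr_real exp_diff exp_minus field_simps)
    finally show ?thesis .
  qed
  then show ?thesis using that[of r0] by (auto simp: r0_def)
qed

text \<open>This is the dominating function for shifts up to half the distance. The polynomial
  factor changes by at most a power of 2, and the exponential one costs only the rate
  \<open>lam * b\<close>.\<close>

lemma F_ratio_le: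
  assumes "0 < z" "0 \<le> d" "d \<le> z / 2"
  shows "F (z - d) \<le> 2 powr \<bar>a\<bar> * exp (lam * b * d powr b) * F z"
proof -
  have zd: "0 < z - d" "z / 2 \<le> z - d" using assms by auto
  have "(z - d) powr a \<le> 2 powr \<bar>a\<bar> * z powr a"
  proof (cases "0 \<le> a")
    case True
    have "1 * (z - d) powr a \<le> 2 powr a * z powr a"
      using True assms zd by (intro mult_mono powr_mono2) (auto simp: ge_one_powr_ge_zero)
    then show ?thesis using True by simp
  next
    case False
    have "(z - d) powr a \<le> (z / 2) powr a"
      using False assms zd by (intro powr_mono2') auto
    also have "\<dots> = 2 powr \<bar>a\<bar> * z powr a"
      using False assms by (simp add: powr_divide powr_minus field_simps)
    finally show ?thesis .
  qed
  moreover have "exp (- lam * (z - d) powr b) \<le> exp (lam * b * d powr b) * exp (- lam * z powr b)"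
  proof -
    have "z powr b - (z - d) powr b \<le> b * d powr b"
      using powr_diff_le_powr[of d z b] assms b_pos b_less by simp
    from mult_left_mono[OF this, of lam] show ?thesis
      using lam_pos by (simp add: exp_add[symmetric] algebra_simps)
  qed
  ultimately have "F (z - d) \<le> (2 powr \<bar>a\<bar> * z powr a) * (exp (lam * b * d powr b) * exp (- lam * z powr b))"
    unfolding F_def by (intro mult_mono) auto
  then show ?thesis by (simp add: F_def mult_ac)
qed

lemma powr_diff_abs:
  assumes z: "0 < z" and d: "\<bar>d\<bar> \<le> z / 2"
  shows "\<bar>(z + d) powr b - z powr b\<bar> \<le> 2 * b * (z powr (b - 1) * \<bar>d\<bar>)"
proof -
  have h: "(z / 2) powr (b - 1) \<le> 2 * z powr (b - 1)"
  proof -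
    have "2 powr (1 - b) \<le> 2 powr (1::real)" using b_pos by (intro powr_mono) auto
    then have "z powr (b - 1) * 2 powr (1 - b) \<le> z powr (b - 1) * 2" by (intro mult_left_mono) auto
    then show ?thesis using z by (simp add: powr_divide powr_minus_divide powr_diff field_simps)
  qed
  show ?thesis
  proof (cases "0 \<le> d")
    case True
    have "(z + d) powr b - z powr b \<le> b * z powr (b - 1) * d"
      using powr_diff_le[of z "z + d" b] True z b_pos b_less by simp
    also have "\<dots> \<le> 2 * b * (z powr (b - 1) * \<bar>d\<bar>)"
      using True z b_pos by (simp add: algebra_simps)
    finally show ?thesis using True z b_pos by (simp add: powr_mono2 abs_of_nonneg)
  next
    case False
    have "z powr b - (z + d) powr b \<le> b * (z + d) powr (b - 1) * (- d)"
      using powr_diff_le[of "z + d" z b] False d z b_pos b_less by simp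
    also have "\<dots> \<le> b * (2 * z powr (b - 1)) * (- d)"
    proof -
      have "(z + d) powr (b - 1) \<le> (z / 2) powr (b - 1)"
        using False d z b_less by (intro powr_mono2') auto
      with h show ?thesis using False b_pos by (intro mult_right_mono mult_left_mono) auto
    qed
    finally show ?thesis using False d z b_pos by (simp add: powr_mono2 abs_of_nonpos mult_ac)
  qed
qed

text \<open>Shifts of smaller order than \<open>z powr (1 - b)\<close> do not change the tail: they
  move \<open>z powr b\<close> by a vanishing amount and are negligible relative to
  \<open>z\<close>.\<close>

lemma F_ratio_tendsto:
  fixes z d :: "'i \<Rightarrow> real"
  assumes z: "filterlim z at_top Fl" and d: "((\<lambda>n. z n powr (b - 1) * d n) \<longlongrightarrow> 0) Fl"
  shows "((\<lambda>n. F (z n + d n) / F (z n)) \<longlongrightarrow> 1) Fl"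
proof -
  have zpos: "\<forall>\<^sub>F n in Fl. 1 \<le> z n" using z by (auto simp: filterlim_at_top)
  have "((\<lambda>n. (z n powr (b - 1) * d n) * (z n) powr (- b)) \<longlongrightarrow> 0 * 0) Fl"
    using tendsto_neg_powr[OF _ z, of "- b"] b_pos by (intro tendsto_mult d) auto
  moreover have "\<forall>\<^sub>F n in Fl. (z n powr (b - 1) * d n) * (z n) powr (- b) = d n / z n"
    using zpos by eventually_elim (simp add: powr_diff powr_minus field_simps)
  ultimately have dz: "((\<lambda>n. d n / z n) \<longlongrightarrow> 0) Fl"
    by (simp add: tendsto_cong)
  have "\<forall>\<^sub>F n in Fl. \<bar>d n / z n\<bar> < 1 / 2"
    using order_tendstoD(2)[OF tendsto_rabs[OF dz], of "1 / 2"] by simp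
  then have small: "\<forall>\<^sub>F n in Fl. \<bar>d n\<bar> \<le> z n / 2"
    using zpos by eventually_elim (simp add: abs_divide field_simps)
  have "((\<lambda>n. (z n + d n) powr b - z n powr b) \<longlongrightarrow> 0) Fl"
  proof (rule Lim_null_comparison)
    show "\<forall>\<^sub>F n in Fl. norm ((z n + d n) powr b - z n powr b) \<le> 2 * b * \<bar>z n powr (b - 1) * d n\<bar>"
      using zpos small by eventually_elim (use powr_diff_abs in \<open>simp add: abs_mult\<close>)
    show "((\<lambda>n. 2 * b * \<bar>z n powr (b - 1) * d n\<bar>) \<longlongrightarrow> 0) Fl"
      using tendsto_mult_right_zero[OF tendsto_rabs_zero[OF d]] by simp
  qed
  then have "((\<lambda>n. (1 + d n / z n) powr a * exp (- lam * ((z n + d n) powr b - z n powr b))) \<longlongrightarrow> (1 + 0) powr a * exp (- lam * 0)) Fl"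
    by (intro tendsto_intros dz) auto
  moreover have "\<forall>\<^sub>F n in Fl. (1 + d n / z n) powr a * exp (- lam * ((z n + d n) powr b - z n powr b)) = F (z n + d n) / F (z n)"
    using zpos small
  proof eventually_elim
    case (elim n)
    then have "(z n + d n) powr a = (1 + d n / z n) powr a * z n powr a"
    proof -
      have "z n + d n = (1 + d n / z n) * z n" using elim by (simp add: distrib_right)
      moreover have "0 \<le> 1 + d n / z n" using elim by (simp add: field_simps)
      ultimately show ?thesis using elim by (simp only: powr_mult)
    qed
    then show ?case
      using elim by (simp add: F_def exp_diff exp_minus field_simps)
  qed
  ultimately show ?thesis by (simp add: tendsto_cong)
qed

end

section \<open>Hitting probabilities and the one-step change of measure\<close>

text \<open>\<open>R\<close> stands for the law of X. The density on the left is stated for all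
  Borel sets, so that arbitrary functions can be integrated against it. The exponential moment with
  parameter \<open>s1\<close> controls the right side; it is to be obtained from the behaviour of
  the log-Laplace transform to the left of 1.\<close>

locale stretched_tail = offspring_law nu mu + tail_shape a lam b
  for nu :: "nat pmf" and mu :: "real measure" and a lam b :: real +
  fixes R :: "real measure" and l :: "real \<Rightarrow> real" and l_inf l_bd x0 s1 :: real
  assumes R_prob: "prob_space R" and R_sets [measurable_cong, simp]: "sets R = sets borel"
    and nu_int: "integrable (measure_pmf nu) real"
    and nu_mean_pos: "0 < measure_pmf.expectation nu real"
    and change_law: "\<And>g :: real \<Rightarrow> ennreal. g \<in> borel_measurable borel \<Longrightarrow>
      ennreal (measure_pmf.expectation nu real) * (\<integral>\<^sup>+y. g y \<partial>mu) = (\<integral>\<^sup>+x. ennreal (exp x) * g x \<partial>R)"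
    and x0_le: "x0 \<le> - 1"
    and l_measurable [measurable]: "l \<in> borel_measurable borel"
    and l_nonneg: "\<And>y. 0 \<le> l y"
    and l_le: "\<And>y. y \<le> x0 \<Longrightarrow> l y \<le> l_bd"
    and l_lim: "(l \<longlongrightarrow> l_inf) at_bot"
    and R_left: "\<And>A. A \<in> sets borel \<Longrightarrow> A \<subseteq> {..x0} \<Longrightarrow>
      emeasure R A = (\<integral>\<^sup>+y\<in>A. ennreal (l y * F (- y)) \<partial>lborel)"
    and s1_pos: "0 < s1" and R_exp_int: "integrable R (\<lambda>x. exp (s1 * x))"
begin

sublocale R: prob_space R by (rule R_prob)

lemma R_UNIV [simp]: "measure R UNIV = 1"
  using R.prob_space sets_eq_imp_space_eq[OF R_sets] by simp

lemma R_space [simp]: "space R = UNIV"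
  using sets_eq_imp_space_eq[OF R_sets] by simp

abbreviation kappa :: real where "kappa \<equiv> measure_pmf.expectation nu real"

text \<open>\<open>gam r\<close> is the probability that one of \<open>nu\<close> independent trials succeeds, each with
  probability \<open>r\<close>.\<close>

definition gam :: "real \<Rightarrow> real" where
  "gam r = measure_pmf.expectation nu (\<lambda>n. 1 - (1 - r) ^ n)"

lemma gam_integrable: "0 \<le> (r::real) \<Longrightarrow> r \<le> 1 \<Longrightarrow> integrable (measure_pmf nu) (\<lambda>n. 1 - (1 - r) ^ n)"
  by (rule measure_pmf.integrable_const_bound[where B=1]) (auto simp: power_le_one)

lemma gam_nonneg: "0 \<le> r \<Longrightarrow> r \<le> 1 \<Longrightarrow> 0 \<le> gam r"
  unfolding gam_def by (intro integral_nonneg_AE) (auto simp: power_le_one)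

lemma gam_le_1: "0 \<le> r \<Longrightarrow> r \<le> 1 \<Longrightarrow> gam r \<le> 1"
  unfolding gam_def
  by (rule order_trans[OF integral_mono[OF gam_integrable, where g="\<lambda>_. 1"]]) auto

lemma gam_0 [simp]: "gam 0 = 0"
  by (simp add: gam_def)

lemma power_diff_le_mult:
  fixes x y :: real
  assumes "0 \<le> x" "x \<le> y" "y \<le> 1"
  shows "y ^ n - x ^ n \<le> real n * (y - x)"
proof (induction n)
  case (Suc n)
  have "y ^ Suc n - x ^ Suc n = y * (y ^ n - x ^ n) + x ^ n * (y - x)" by (simp add: algebra_simps)
  also have "\<dots> \<le> 1 * (real n * (y - x)) + 1 * (y - x)"
    using assms Suc by (intro add_mono mult_mono mult_right_mono) (auto simp: power_le_one power_mono)
  finally show ?case by (simp add: algebra_simps)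
qed simp

text \<open>The Lipschitz constant is the mean offspring number. Hence the difference of two hitting
  probabilities propagates no worse than a first moment, and an error can be followed through the
  generations by linear bounds.\<close>

lemma gam_diff:
  assumes "0 \<le> r" "r \<le> q" "q \<le> 1"
  shows "gam r \<le> gam q" "gam q - gam r \<le> kappa * (q - r)"
proof -
  have i: "integrable (measure_pmf nu) (\<lambda>n. 1 - (1 - r) ^ n)" "integrable (measure_pmf nu) (\<lambda>n. 1 - (1 - q) ^ n)"
    using assms by (auto intro!: gam_integrable)
  show "gam r \<le> gam q"
    unfolding gam_def by (intro integral_mono i) (use assms in \<open>auto intro!: power_mono\<close>)
  have "gam q - gam r = measure_pmf.expectation nu (\<lambda>n. (1 - (1 - q) ^ n) - (1 - (1 - r) ^ n))"
    unfolding gam_def by (rule Bochner_Integration.integral_diff[symmetric]) (rule i)+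
  also have "\<dots> \<le> measure_pmf.expectation nu (\<lambda>n. real n * (q - r))"
    using power_diff_le_mult[of "1 - q" "1 - r"] assms
    by (intro integral_mono Bochner_Integration.integrable_diff i integrable_mult_left) (auto intro!: nu_int)
  finally show "gam q - gam r \<le> kappa * (q - r)" by simp
qed

text \<open>The quotient is the mean of a geometric sum with n terms; it is dominated by n, which is
  integrable.\<close>

lemma gam_ratio: "((\<lambda>r. gam r / r) \<longlongrightarrow> kappa) (at 0 within {0<..1})"
  unfolding tendsto_at_iff_sequentially comp_def
proof (intro allI impI)
  fix X :: "nat \<Rightarrow> real" assume X: "\<forall>i. X i \<in> {0<..1} - {0}" "X \<longlonglongrightarrow> 0"
  have Xi: "0 < X i" "X i \<le> 1" for i using X(1) by auto
  have eq: "gam (X i) / X i = measure_pmf.expectation nu (\<lambda>n. \<Sum>j<n. (1 - X i) ^ j)" for i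
    unfolding gam_def using Xi[of i]
    by (subst Bochner_Integration.integral_divide_zero[symmetric])
      (auto intro!: Bochner_Integration.integral_cong simp: field_simps one_diff_power_eq)
  show "(\<lambda>i. gam (X i) / X i) \<longlonglongrightarrow> kappa"
    unfolding eq
  proof (rule integral_dominated_convergence[where w=real])
    show "AE n in measure_pmf nu. (\<lambda>i. \<Sum>j<n. (1 - X i) ^ j) \<longlonglongrightarrow> real n"
    proof (rule AE_I2)
      fix n
      have "(\<lambda>i. \<Sum>j<n. (1 - X i) ^ j) \<longlonglongrightarrow> (\<Sum>j<n. (1 - 0) ^ j)"
        by (intro tendsto_intros X)
      then show "(\<lambda>i. \<Sum>j<n. (1 - X i) ^ j) \<longlonglongrightarrow> real n" by simp
    qed
    fix i
    have "(\<Sum>j<n. (1 - X i) ^ j) \<le> (\<Sum>j<n. 1)" for n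
      using Xi[of i] by (intro sum_mono) (auto simp: power_le_one)
    then show "AE n in measure_pmf nu. norm (\<Sum>j<n. (1 - X i) ^ j) \<le> real n"
      using Xi[of i] by (intro AE_I2) (auto simp: sum_nonneg)
  qed (auto intro: nu_int)
qed

lemma gam_measurable [measurable]: "gam \<in> borel_measurable borel"
proof -
  have 1: "(\<lambda>p. 1 - (1 - fst p) ^ n :: real) \<in> borel_measurable (borel \<Otimes>\<^sub>M measure_pmf nu)" for n :: nat
    by (intro borel_measurable_diff borel_measurable_power borel_measurable_const measurable_fst)
  have 2: "snd \<in> measurable (borel \<Otimes>\<^sub>M measure_pmf nu) (count_space UNIV)"
    using measurable_snd[of borel "measure_pmf nu"] by (simp only: measurable_pmf_measure2)
  have "(\<lambda>(r, n). 1 - (1 - r) ^ n :: real) \<in> borel_measurable (borel \<Otimes>\<^sub>M measure_pmf nu)"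
    using measurable_compose_countable[where f="\<lambda>n p. 1 - (1 - fst p) ^ n :: real" and g=snd, OF 1 2] by (simp only: case_prod_beta')
  from measure_pmf.borel_measurable_lebesgue_integral[OF this]
  show ?thesis by (simp add: gam_def[abs_def])
qed

text \<open>\<open>hit \<theta> k v\<close> is the probability that a particle at \<open>v\<close> has a marked descendant
  \<open>k\<close> generations later, when a particle at \<open>z\<close> is marked independently with
  probability \<open>\<theta> z\<close>.\<close>

primrec hit :: "(real \<Rightarrow> real) \<Rightarrow> nat \<Rightarrow> real \<Rightarrow> real" where
  "hit \<theta> 0 = \<theta>"
| "hit \<theta> (Suc k) = (\<lambda>v. gam (\<integral>y. hit \<theta> k (v + y) \<partial>mu))"

definition target :: "(real \<Rightarrow> real) \<Rightarrow> bool" where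
  "target \<theta> \<longleftrightarrow> \<theta> \<in> borel_measurable borel \<and> (\<forall>v. 0 \<le> \<theta> v \<and> \<theta> v \<le> 1)"

lemma targetD: "target \<theta> \<Longrightarrow> \<theta> \<in> borel_measurable borel" "target \<theta> \<Longrightarrow> 0 \<le> \<theta> v" "target \<theta> \<Longrightarrow> \<theta> v \<le> 1"
  by (auto simp: target_def)

lemma target_integrable:
  assumes "target \<theta>" shows "integrable mu (\<lambda>y. \<theta> (v + y))"
proof (rule mu.integrable_const_bound[where B=1])
  note [measurable] = targetD(1)[OF assms]
  show "(\<lambda>y. \<theta> (v + y)) \<in> borel_measurable mu" by measurable
qed (use targetD[OF assms] in auto)

lemma target_integral:
  assumes "target \<theta>" shows "0 \<le> (\<integral>y. \<theta> (v + y) \<partial>mu)" "(\<integral>y. \<theta> (v + y) \<partial>mu) \<le> 1"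
proof -
  show "0 \<le> (\<integral>y. \<theta> (v + y) \<partial>mu)"
    by (intro integral_nonneg_AE) (use targetD[OF assms] in auto)
  have "(\<integral>y. \<theta> (v + y) \<partial>mu) \<le> (\<integral>y. 1 \<partial>mu)"
    by (intro integral_mono target_integrable[OF assms]) (use targetD[OF assms] in auto)
  then show "(\<integral>y. \<theta> (v + y) \<partial>mu) \<le> 1" by (simp add: mu_UNIV)
qed

lemma target_step:
  assumes "target \<theta>" shows "target (\<lambda>v. gam (\<integral>y. \<theta> (v + y) \<partial>mu))"
proof -
  note [measurable] = targetD(1)[OF assms]
  have "(\<lambda>v. \<integral>y. \<theta> (v + y) \<partial>mu) \<in> borel_measurable borel"
    by (rule mu.borel_measurable_lebesgue_integral) measurable
  from measurable_compose[OF this gam_measurable]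
  show ?thesis
    unfolding target_def using target_integral[OF assms] by (auto intro!: gam_nonneg gam_le_1)
qed

lemma target_hit: "target \<theta> \<Longrightarrow> target (hit \<theta> k)"
  by (induction k) (auto intro: target_step)

lemma hit_mono:
  assumes "target \<theta>" "target \<psi>" "\<And>v. \<theta> v \<le> \<psi> v"
  shows "hit \<theta> k v \<le> hit \<psi> k v"
proof (induction k arbitrary: v)
  case (Suc k)
  have "(\<integral>y. hit \<theta> k (v + y) \<partial>mu) \<le> (\<integral>y. hit \<psi> k (v + y) \<partial>mu)"
    by (intro integral_mono target_integrable target_hit assms Suc)
  then show ?case
    using target_integral[OF target_hit[OF assms(1), of k], of v] target_integral[OF target_hit[OF assms(2), of k], of v]
    by (simp add: gam_diff)
qed (use assms in simp)

lemma hit_add: "hit (hit \<theta> j) k = hit \<theta> (k + j)"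
  by (induction k) auto

lemma hit_shift: "hit (\<lambda>x. \<theta> (x + c)) k v = hit \<theta> k (v + c)"
  by (induction k arbitrary: v) (simp_all add: add.assoc add.commute[of _ c])

text \<open>The branching step turns the failure probability of one child into its generating
  function, and the complement of that is \<open>gam\<close>.\<close>

lemma nn_integral_tree_prod_hit:
  assumes \<theta>: "target \<theta>"
  shows "(\<integral>\<^sup>+t. tree_prod (\<lambda>v. ennreal (1 - \<theta> v)) k v t \<partial>tree_law) = ennreal (1 - hit \<theta> k v)"
proof (induction k arbitrary: v)
  case 0
  then show ?case by (simp add: tree.emeasure_space_1 flip: space_tree_law)
next
  case (Suc k)
  note [measurable] = targetD(1)[OF \<theta>]
  let ?I = "\<integral>y. hit \<theta> k (v + y) \<partial>mu"
  note I = target_integral[OF target_hit[OF \<theta>, of k], of v]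
  have "(\<integral>\<^sup>+y. ennreal (1 - hit \<theta> k (v + y)) \<partial>mu) = ennreal (\<integral>y. 1 - hit \<theta> k (v + y) \<partial>mu)"
    using target_integrable[OF target_hit[OF \<theta>]] targetD[OF target_hit[OF \<theta>]]
    by (intro nn_integral_eq_integral) auto
  also have "(\<integral>y. 1 - hit \<theta> k (v + y) \<partial>mu) = 1 - ?I"
    using target_integrable[OF target_hit[OF \<theta>]] by (subst Bochner_Integration.integral_diff) (auto simp: mu_UNIV)
  finally have 1: "(\<integral>\<^sup>+y. ennreal (1 - hit \<theta> k (v + y)) \<partial>mu) = ennreal (1 - ?I)" .
  have "(\<integral>\<^sup>+n. ennreal (1 - ?I) ^ n \<partial>measure_pmf nu) = (\<integral>\<^sup>+n. ennreal ((1 - ?I) ^ n) \<partial>measure_pmf nu)"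
    using I by (intro nn_integral_cong) (simp add: ennreal_power)
  also have "\<dots> = ennreal (measure_pmf.expectation nu (\<lambda>n. (1 - ?I) ^ n))"
    using I by (intro nn_integral_eq_integral measure_pmf.integrable_const_bound[where B=1]) (auto simp: power_le_one)
  also have "measure_pmf.expectation nu (\<lambda>n. (1 - ?I) ^ n) = 1 - gam ?I"
    unfolding gam_def using I
    by (subst Bochner_Integration.integral_diff)
      (auto intro!: measure_pmf.integrable_const_bound[where B=1] simp: power_le_one)
  finally show ?case
    using nn_integral_tree_prod_Suc[of "\<lambda>v. ennreal (1 - \<theta> v)" k v] by (simp add: Suc.IH 1)
qed

text \<open>The many-to-one formula for one generation. Carrying the weight \<open>exp v\<close>
  along with the function absorbs the density \<open>exp x\<close> of the change of measure, so
  afterwards only an expectation over one step of the tilted walk is left.\<close>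

lemma change_hit:
  assumes f: "f \<in> borel_measurable borel" "\<And>x. 0 \<le> f x" and int: "integrable mu (\<lambda>y. f (v + y))"
  shows "ennreal (exp v * (kappa * (\<integral>y. f (v + y) \<partial>mu))) = (\<integral>\<^sup>+x. ennreal (exp (v + x) * f (v + x)) \<partial>R)"
proof -
  note [measurable] = f(1)
  have "ennreal (exp v * (kappa * (\<integral>y. f (v + y) \<partial>mu))) = ennreal (exp v) * (ennreal kappa * ennreal (\<integral>y. f (v + y) \<partial>mu))"
    using nu_mean_pos f(2) by (simp add: ennreal_mult' ennreal_mult'' integral_nonneg_AE)
  also have "ennreal (\<integral>y. f (v + y) \<partial>mu) = (\<integral>\<^sup>+y. ennreal (f (v + y)) \<partial>mu)"
    using int f(2) by (intro nn_integral_eq_integral[symmetric]) auto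
  also have "ennreal kappa * (\<integral>\<^sup>+y. ennreal (f (v + y)) \<partial>mu) = (\<integral>\<^sup>+x. ennreal (exp x) * ennreal (f (v + x)) \<partial>R)"
    by (rule change_law) measurable
  also have "ennreal (exp v) * \<dots> = (\<integral>\<^sup>+x. ennreal (exp v) * (ennreal (exp x) * ennreal (f (v + x))) \<partial>R)"
    by (rule nn_integral_cmult[symmetric]) measurable
  also have "\<dots> = (\<integral>\<^sup>+x. ennreal (exp (v + x) * f (v + x)) \<partial>R)"
    by (intro nn_integral_cong) (simp add: f ennreal_mult' exp_add mult.assoc)
  finally show ?thesis .
qed

text \<open>With \<open>r\<close> zero this is the first moment bound on a hitting probability. With
  a smaller target \<open>r\<close> it controls what is lost when the target shrinks.\<close>

lemma step_le:
  assumes q: "target q" and r: "target r" and rq: "\<And>x. r x \<le> q x"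
    and d: "\<And>x. ennreal (exp (v + x) * (q (v + x) - r (v + x))) \<le> d x"
  shows "ennreal (exp v * (gam (\<integral>y. q (v + y) \<partial>mu) - gam (\<integral>y. r (v + y) \<partial>mu))) \<le> (\<integral>\<^sup>+x. d x \<partial>R)"
proof -
  note [measurable] = targetD(1)[OF q] targetD(1)[OF r]
  have "(\<integral>y. r (v + y) \<partial>mu) \<le> (\<integral>y. q (v + y) \<partial>mu)"
    by (intro integral_mono target_integrable q r rq)
  then have "gam (\<integral>y. q (v + y) \<partial>mu) - gam (\<integral>y. r (v + y) \<partial>mu) \<le> kappa * ((\<integral>y. q (v + y) \<partial>mu) - (\<integral>y. r (v + y) \<partial>mu))"
    by (intro gam_diff target_integral q r)
  also have "(\<integral>y. q (v + y) \<partial>mu) - (\<integral>y. r (v + y) \<partial>mu) = (\<integral>y. q (v + y) - r (v + y) \<partial>mu)"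
    by (rule Bochner_Integration.integral_diff[symmetric]) (intro target_integrable q r)+
  finally have "ennreal (exp v * (gam (\<integral>y. q (v + y) \<partial>mu) - gam (\<integral>y. r (v + y) \<partial>mu)))
      \<le> ennreal (exp v * (kappa * (\<integral>y. q (v + y) - r (v + y) \<partial>mu)))"
    by (intro ennreal_leI mult_left_mono) auto
  also have "\<dots> = (\<integral>\<^sup>+x. ennreal (exp (v + x) * (q (v + x) - r (v + x))) \<partial>R)"
    using change_hit[of "\<lambda>x. q x - r x" v] rq
    by (simp add: target_integrable q r)
  also have "\<dots> \<le> (\<integral>\<^sup>+x. d x \<partial>R)"
    by (intro nn_integral_mono d)
  finally show ?thesis .
qed

end

section \<open>Exponential moments and the tail of one tilted step\<close>

lemma integrable_cauchy: "integrable lborel (\<lambda>x::real. 1 / (1 + x\<^sup>2))"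
  using integrable_inverse_1_plus_square
  by (simp add: set_integrable_def inverse_eq_divide)

context stretched_tail
begin

lemma R_left_density:
  "density R (\<lambda>x. indicator {..x0} x) = density lborel (\<lambda>y. ennreal (indicator {..x0} y * (l y * F (- y))))"
proof (rule measure_eqI)
  fix A assume "A \<in> sets (density R (\<lambda>x. indicator {..x0} x))"
  then have A [measurable]: "A \<in> sets borel" by simp
  have "emeasure (density R (\<lambda>x. indicator {..x0} x)) A = (\<integral>\<^sup>+x. indicator (A \<inter> {..x0}) x \<partial>R)"
    by (subst emeasure_density, simp, simp, rule nn_integral_cong) (auto split: split_indicator)
  also have "\<dots> = emeasure R (A \<inter> {..x0})"
    by (rule nn_integral_indicator) simp
  also have "\<dots> = (\<integral>\<^sup>+y\<in>A \<inter> {..x0}. ennreal (l y * F (- y)) \<partial>lborel)"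
    by (rule R_left) auto
  also have "\<dots> = emeasure (density lborel (\<lambda>y. ennreal (indicator {..x0} y * (l y * F (- y))))) A"
    by (subst emeasure_density) (auto intro!: nn_integral_cong split: split_indicator)
  finally show "emeasure (density R (\<lambda>x. indicator {..x0} x)) A
    = emeasure (density lborel (\<lambda>y. ennreal (indicator {..x0} y * (l y * F (- y))))) A" .
qed simp

lemma R_left_nn_integral:
  assumes [measurable]: "g \<in> borel_measurable borel"
  shows "(\<integral>\<^sup>+x. indicator {..x0} x * g x \<partial>R) = (\<integral>\<^sup>+x. ennreal (indicator {..x0} x * (l x * F (- x))) * g x \<partial>lborel)"
proof -
  have "(\<integral>\<^sup>+x. indicator {..x0} x * g x \<partial>R) = (\<integral>\<^sup>+x. g x \<partial>density R (\<lambda>x. indicator {..x0} x))"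
    by (subst nn_integral_density) auto
  also have "\<dots> = (\<integral>\<^sup>+x. ennreal (indicator {..x0} x * (l x * F (- x))) * g x \<partial>lborel)"
    unfolding R_left_density by (subst nn_integral_density) auto
  finally show ?thesis .
qed

lemma R_left_integral:
  fixes g :: "real \<Rightarrow> real"
  assumes [measurable]: "g \<in> borel_measurable borel"
  shows "(\<integral>x. indicator {..x0} x * g x \<partial>R) = (\<integral>x. indicator {..x0} x * (l x * F (- x)) * g x \<partial>lborel)"
proof -
  have "(\<integral>x. indicator {..x0} x * g x \<partial>R) = (\<integral>x. g x \<partial>density R (\<lambda>x. ennreal (indicator {..x0} x)))"
    by (subst integral_density) auto
  also have "(\<lambda>x. ennreal (indicator {..x0} x)) = (\<lambda>x. indicator {..x0} x)"
    by (auto split: split_indicator)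
  also have "(\<integral>x. g x \<partial>density R (\<lambda>x. indicator {..x0} x)) = (\<integral>x. indicator {..x0} x * (l x * F (- x)) * g x \<partial>lborel)"
    unfolding R_left_density using l_nonneg F_nonneg by (subst integral_density) auto
  finally show ?thesis .
qed

lemma l_bd_nonneg: "0 \<le> l_bd"
  using l_le[of x0] l_nonneg[of x0] by simp

lemma nn_integral_cauchy_finite: "(\<integral>\<^sup>+x. ennreal (C * (1 / (1 + x\<^sup>2))) \<partial>lborel) < \<infinity>" if "0 \<le> C"
proof -
  have "integrable lborel (\<lambda>x. C * (1 / (1 + x\<^sup>2)))"
    by (intro integrable_mult_right integrable_cauchy)
  then have "(\<integral>\<^sup>+x. ennreal (C * (1 / (1 + x\<^sup>2))) \<partial>lborel) = ennreal (\<integral>x. C * (1 / (1 + x\<^sup>2)) \<partial>lborel)"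
    using that by (intro nn_integral_eq_integral) auto
  then show ?thesis by simp
qed

text \<open>The left tail decays at the exact rate \<open>lam\<close>, so every rate
  \<open>\<eta> * lam\<close> with \<eta> below 1 is integrable, with a polynomial to spare. On the
  right the moment with parameter \<open>s1\<close> dominates the square.\<close>

lemma exp_moment:
  assumes \<eta>: "0 \<le> \<eta>" "\<eta> < 1"
  shows "integrable R (\<lambda>x. (1 + x\<^sup>2) * exp (\<eta> * lam * (max 0 (- x)) powr b))"
proof -
  let ?g = "\<lambda>x::real. (1 + x\<^sup>2) * exp (\<eta> * lam * (max 0 (- x)) powr b)"
  have g0: "0 \<le> ?g x" for x by simp
  have gm [measurable]: "?g \<in> borel_measurable borel" by measurable
  \<comment> \<open>The exponent collects \<open>a\<close> from the density, 2 from the factor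
    \<open>1 + x\<^sup>2\<close> of the integrand, and 2 more to leave an integrable Cauchy
    density.\<close>
  obtain C where C: "0 < C" "\<And>r. 1 \<le> r \<Longrightarrow> r powr (a + 4) * exp (- ((1 - \<eta>) * lam) * r powr b) \<le> C"
    using powr_exp_bound[of "(1 - \<eta>) * lam" b "a + 4"] \<eta> lam_pos b_pos by auto
  have left: "(\<integral>\<^sup>+x. indicator {..x0} x * ennreal (?g x) \<partial>R) < \<infinity>"
  proof -
    have "(\<integral>\<^sup>+x. ennreal (indicator {..x0} x * (l x * F (- x))) * ennreal (?g x) \<partial>lborel)
      \<le> (\<integral>\<^sup>+x. ennreal (l_bd * (4 * C) * (1 / (1 + x\<^sup>2))) \<partial>lborel)"
    proof (rule nn_integral_mono)
      fix x :: real
      show "ennreal (indicator {..x0} x * (l x * F (- x))) * ennreal (?g x) \<le> ennreal (l_bd * (4 * C) * (1 / (1 + x\<^sup>2)))"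
      proof (cases "x \<le> x0")
        case True
        define r where "r = - x"
        have r: "1 \<le> r" using True x0_le by (simp add: r_def)
        have "1 * 1 \<le> r * r" using r by (intro mult_mono) auto
        then have "1 + r\<^sup>2 \<le> 2 * r\<^sup>2" by (simp add: power2_eq_square)
        then have "(1 + r\<^sup>2) * (1 + r\<^sup>2) \<le> (2 * r\<^sup>2) * (2 * r\<^sup>2)" by (intro mult_mono) auto
        also have "\<dots> = 4 * r powr 4" using r by (simp add: powr_numeral power2_eq_square power4_eq_xxxx)
        finally have q: "(1 + r\<^sup>2) * (1 + r\<^sup>2) \<le> 4 * r powr 4" .
        have "F r * ((1 + r\<^sup>2) * exp (\<eta> * lam * r powr b)) * (1 + r\<^sup>2)
          = ((1 + r\<^sup>2) * (1 + r\<^sup>2)) * (r powr a * exp (- ((1 - \<eta>) * lam) * r powr b))"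
          by (simp add: F_def exp_add[symmetric] algebra_simps mult_exp_exp)
        also have "\<dots> \<le> (4 * r powr 4) * (r powr a * exp (- ((1 - \<eta>) * lam) * r powr b))"
          by (intro mult_right_mono q) auto
        also have "\<dots> = 4 * (r powr (a + 4) * exp (- ((1 - \<eta>) * lam) * r powr b))"
          by (simp add: powr_add)
        also have "\<dots> \<le> 4 * C" using C(2)[OF r] by simp
        finally have "F r * ((1 + r\<^sup>2) * exp (\<eta> * lam * r powr b)) * (1 + r\<^sup>2) \<le> 4 * C" .
        then have "F r * ((1 + r\<^sup>2) * exp (\<eta> * lam * r powr b)) \<le> 4 * C * (1 / (1 + r\<^sup>2))"
          by (simp add: pos_le_divide_eq add_pos_nonneg)
        then have "l x * (F r * ((1 + r\<^sup>2) * exp (\<eta> * lam * r powr b))) \<le> l_bd * (4 * C * (1 / (1 + r\<^sup>2)))"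
          by (rule mult_mono[OF l_le[OF True] _ l_bd_nonneg]) (simp add: F_nonneg)
        moreover have "max 0 (- x) = r" using r by (simp add: r_def)
        ultimately show ?thesis
          using True l_nonneg F_nonneg
          by (simp add: ennreal_mult'[symmetric] r_def mult_ac ennreal_leI)
      next
        case False
        then show ?thesis by simp
      qed
    qed
    also have "\<dots> < \<infinity>" using C l_bd_nonneg by (intro nn_integral_cauchy_finite) auto
    finally show ?thesis by (subst R_left_nn_integral) auto
  qed
  \<comment> \<open>The exponential covers the bounded stretch between \<open>x0\<close> and 0. The
    term \<open>2 / s1\<^sup>2\<close> comes from the quadratic Taylor bound of
    \<open>exp (s1 * x)\<close>.\<close>
  define K where "K = exp (lam * (- x0) powr b) * (1 + x0\<^sup>2 + 2 / s1\<^sup>2)"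
  have right: "indicator {x0<..} x * ennreal (?g x) \<le> ennreal (K * (1 + exp (s1 * x)))" for x
  proof (cases "x0 < x")
    case True
    have e: "exp (\<eta> * lam * (max 0 (- x)) powr b) \<le> exp (lam * (- x0) powr b)"
    proof -
      have "(max 0 (- x)) powr b \<le> (- x0) powr b"
        using True x0_le b_pos by (intro powr_mono2) auto
      then have "\<eta> * (lam * (max 0 (- x)) powr b) \<le> 1 * (lam * (- x0) powr b)"
        using \<eta> lam_pos by (intro mult_mono) auto
      then show ?thesis by (simp add: mult.assoc)
    qed
    have "x\<^sup>2 \<le> x0\<^sup>2 + 2 / s1\<^sup>2 * exp (s1 * x)"
    proof (cases "0 \<le> x")
      case True
      have "1 + s1 * x + (s1 * x)\<^sup>2 / 2 \<le> exp (s1 * x)"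
        using True s1_pos by (intro exp_lower_Taylor_quadratic) auto
      then have "(s1 * x)\<^sup>2 \<le> 2 * exp (s1 * x)"
        using True s1_pos mult_nonneg_nonneg[of s1 x] by linarith
      then have "x\<^sup>2 \<le> 2 / s1\<^sup>2 * exp (s1 * x)"
        using s1_pos by (simp add: field_simps power_mult_distrib)
      then show ?thesis using zero_le_power2[of x0] by linarith
    next
      case False
      have "x\<^sup>2 \<le> x0\<^sup>2" using False \<open>x0 < x\<close> by (intro abs_le_square_iff[THEN iffD1]) auto
      then show ?thesis using s1_pos by (simp add: add_increasing2)
    qed
    then have "1 + x\<^sup>2 \<le> (1 + x0\<^sup>2 + 2 / s1\<^sup>2) * (1 + exp (s1 * x))"
    proof -
      have "1 + x\<^sup>2 \<le> (1 + x0\<^sup>2) * 1 + 2 / s1\<^sup>2 * exp (s1 * x)" using \<open>x\<^sup>2 \<le> _\<close> by simp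
      also have "\<dots> \<le> (1 + x0\<^sup>2) * (1 + exp (s1 * x)) + 2 / s1\<^sup>2 * (1 + exp (s1 * x))"
        by (intro add_mono mult_left_mono) auto
      finally show ?thesis by (simp only: distrib_right)
    qed
    then have "?g x \<le> ((1 + x0\<^sup>2 + 2 / s1\<^sup>2) * (1 + exp (s1 * x))) * exp (lam * (- x0) powr b)"
      using e by (intro mult_mono) (auto intro: order_trans[rotated])
    then show ?thesis using True by (simp add: K_def mult_ac ennreal_leI)
  qed simp
  have "(\<integral>\<^sup>+x. indicator {x0<..} x * ennreal (?g x) \<partial>R) \<le> (\<integral>\<^sup>+x. ennreal (K * (1 + exp (s1 * x))) \<partial>R)"
    by (intro nn_integral_mono right)
  also have "\<dots> = ennreal (\<integral>x. K * (1 + exp (s1 * x)) \<partial>R)"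
    using R_exp_int by (intro nn_integral_eq_integral) (auto simp: K_def)
  also have "\<dots> < \<infinity>" by simp
  finally have right': "(\<integral>\<^sup>+x. indicator {x0<..} x * ennreal (?g x) \<partial>R) < \<infinity>" .
  have "(\<integral>\<^sup>+x. ennreal (?g x) \<partial>R) = (\<integral>\<^sup>+x. indicator {..x0} x * ennreal (?g x) + indicator {x0<..} x * ennreal (?g x) \<partial>R)"
    by (intro nn_integral_cong) (auto split: split_indicator)
  also have "\<dots> = (\<integral>\<^sup>+x. indicator {..x0} x * ennreal (?g x) \<partial>R) + (\<integral>\<^sup>+x. indicator {x0<..} x * ennreal (?g x) \<partial>R)"
    by (rule nn_integral_add) auto
  also have "\<dots> < \<infinity>" using left right' by (simp add: ennreal_add_less_top)
  finally show ?thesis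
    by (intro integrableI_nonneg) auto
qed

lemma exp_moment_simple:
  assumes "0 \<le> \<eta>" "\<eta> < 1"
  shows "integrable R (\<lambda>x. exp (\<eta> * lam * (max 0 (- x)) powr b))"
  by (rule Bochner_Integration.integrable_bound[OF exp_moment[OF assms]])
    (auto intro!: AE_I2 simp: mult_le_cancel_right1 )

lemma R_square_int: "integrable R (\<lambda>x. x\<^sup>2)"
  by (rule Bochner_Integration.integrable_bound[OF exp_moment[of 0]]) auto

lemma R_int: "integrable R (\<lambda>x. x)"
proof (rule Bochner_Integration.integrable_bound[OF exp_moment[of 0]])
  have "\<bar>x\<bar> \<le> 1 + x\<^sup>2" for x :: real
    using zero_le_power2[of "\<bar>x\<bar> - 1"] by (simp add: power2_eq_square algebra_simps abs_if split: if_splits)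
  then show "AE x in R. norm x \<le> norm ((1 + x\<^sup>2) * exp (0 * lam * (max 0 (- x)) powr b))"
    by (intro AE_I2) simp
qed auto

definition U :: "(real \<Rightarrow> real) \<Rightarrow> real \<Rightarrow> real" where
  "U h z = (\<integral>x. h (z + x) \<partial>R)"

text \<open>\<open>U h z\<close> is large either because the step is moderate and \<open>h\<close> has its tail (the term
  \<open>c\<close>), or because the step is close to \<open>-z\<close> (the integral term).\<close>

lemma U_tail:
  assumes h [measurable]: "h \<in> borel_measurable borel" and h0: "\<And>w. 0 \<le> h w" and h1: "\<And>w. h w \<le> 1"
    and hexp: "\<And>w. h w \<le> exp w" and hlim: "((\<lambda>w. h w / F w) \<longlongrightarrow> c) at_top"
  shows "integrable lborel h" "((\<lambda>z. U h z / F z) \<longlongrightarrow> c + l_inf * (\<integral>w. h w \<partial>lborel)) at_top"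
proof -
  obtain r0 where r0: "1 \<le> r0" "\<And>r s. r0 \<le> r \<Longrightarrow> r \<le> s \<Longrightarrow> F s \<le> F r"
    using F_decreasing by blast
  define K where "K = \<bar>c\<bar> + 1"
  have "\<forall>\<^sub>F w in at_top. h w / F w < K"
    by (rule order_tendstoD(2)[OF hlim]) (simp add: K_def)
  then obtain w1 where w1: "\<And>w. w1 \<le> w \<Longrightarrow> h w / F w < K" by (auto simp: eventually_at_top_linorder)
  define w0 where "w0 = max w1 r0"
  have w0: "1 \<le> w0" "r0 \<le> w0" using r0 by (auto simp: w0_def)
  have hF: "h w \<le> K * F w" if "w0 \<le> w" for w
    using w1[of w] that w0 F_pos[of w] by (simp add: w0_def field_simps)
  have K: "0 < K" by (simp add: K_def)
  define A where "A = 2 powr \<bar>a\<bar>"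
  have A: "1 \<le> A" by (simp add: A_def ge_one_powr_ge_zero)
  have Fr: "F (z - d) \<le> A * exp (lam * b * d powr b) * F z" if "0 < z" "0 \<le> d" "d \<le> z / 2" for z d
    unfolding A_def by (rule F_ratio_le) (use that in auto)
  \<comment> \<open>Beyond \<open>w0\<close> the function is at most \<open>K * F\<close>.
    Multiplied by the cost \<open>exp (lam * b * w powr b)\<close> it still decays at the rate
    \<open>(1 - b) * lam\<close>; the 2 added to \<open>a\<close> makes room for a Cauchy
    density.\<close>
  obtain C where C: "0 < C" "\<And>r. 1 \<le> r \<Longrightarrow> r powr (a + 2) * exp (- ((1 - b) * lam) * r powr b) \<le> C"
    using powr_exp_bound[of "(1 - b) * lam" b "a + 2"] lam_pos b_pos b_less by auto
  define C2 where "C2 = (1 + w0\<^sup>2) * exp (lam * b * w0 powr b) + K * (2 * C)"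
  have C2: "0 < C2" using K C by (simp add: C2_def add_pos_pos add_pos_nonneg)
  have hpos: "h w * exp (lam * b * w powr b) \<le> C2 * (1 / (1 + w\<^sup>2))" if "0 < w" for w
  proof -
    have "h w * exp (lam * b * w powr b) * (1 + w\<^sup>2) \<le> C2"
    proof (cases "w \<le> w0")
      case True
      have "h w * exp (lam * b * w powr b) * (1 + w\<^sup>2) \<le> 1 * exp (lam * b * w0 powr b) * (1 + w0\<^sup>2)"
        using True that h0 h1 lam_pos b_pos
        by (intro mult_mono) (auto intro!: mult_left_mono powr_mono2 power_mono)
      also have "\<dots> \<le> C2" using K C by (simp add: C2_def)
      finally show ?thesis .
    next
      case False
      then have w: "1 \<le> w" using w0 by simp
      then have "1 * 1 \<le> w * w" by (intro mult_mono) auto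
      then have q: "1 + w\<^sup>2 \<le> 2 * w powr 2" using w by (simp add: powr_numeral power2_eq_square)
      have "h w * exp (lam * b * w powr b) * (1 + w\<^sup>2) \<le> (K * F w) * exp (lam * b * w powr b) * (2 * w powr 2)"
        using False h0 K F_nonneg q by (intro mult_mono hF) auto
      also have "\<dots> = K * (2 * (w powr (a + 2) * exp (- ((1 - b) * lam) * w powr b)))"
        by (simp add: F_def powr_add mult_exp_exp algebra_simps)
      also have "\<dots> \<le> K * (2 * C)" using C(2)[OF w] K by simp
      also have "\<dots> \<le> C2" using w0 by (simp add: C2_def)
      finally show ?thesis .
    qed
    then show ?thesis by (simp add: pos_le_divide_eq add_pos_nonneg)
  qed
  have hneg: "exp w \<le> 2 * (1 / (1 + w\<^sup>2))" if "w \<le> 0" for w :: real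
  proof -
    have "1 + (- w) + (- w)\<^sup>2 / 2 \<le> exp (- w)"
      using that by (intro exp_lower_Taylor_quadratic) auto
    then have "1 + w\<^sup>2 \<le> 2 * exp (- w)" using that by simp
    then show ?thesis by (simp add: exp_minus field_simps add_pos_nonneg)
  qed
  define D where "D = l_bd * (2 + A * C2)"
  have D: "0 \<le> D" using l_bd_nonneg A C2 by (simp add: D_def)
  show hint: "integrable lborel h"
  proof (rule Bochner_Integration.integrable_bound)
    show "integrable lborel (\<lambda>w. (2 + C2) * (1 / (1 + w\<^sup>2)))"
      by (intro integrable_mult_right integrable_cauchy)
    have "h w \<le> (2 + C2) * (1 / (1 + w\<^sup>2))" for w
    proof (cases "0 < w")
      case True
      have "h w * 1 \<le> h w * exp (lam * b * w powr b)"
        using lam_pos b_pos h0 by (intro mult_left_mono) auto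
      also note hpos[OF True]
      also have "C2 * (1 / (1 + w\<^sup>2)) \<le> (2 + C2) * (1 / (1 + w\<^sup>2))" by (intro mult_right_mono) auto
      finally show ?thesis by simp
    next
      case False
      then have "h w \<le> 2 * (1 / (1 + w\<^sup>2))" using hexp[of w] hneg[of w] by linarith
      also have "\<dots> \<le> (2 + C2) * (1 / (1 + w\<^sup>2))" using C2 by (intro mult_right_mono) auto
      finally show ?thesis .
    qed
    then show "AE w in lborel. norm (h w) \<le> norm ((2 + C2) * (1 / (1 + w\<^sup>2)))"
      using h0 C2 by (intro AE_I2) (auto simp: abs_mult intro: order_trans)
  qed simp
  \<comment> \<open>Half of \<open>z\<close> exceeds \<open>w0\<close>, so that after a moderate
    step the walk is still in the tail region of \<open>h\<close>; it also exceeds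
    \<open>- x0\<close>, so that a large step lies where the density is known.\<close>
  define Z where "Z = 2 * max w0 (- x0)"
  \<comment> \<open>Steps above \<open>- z / 2\<close>: the tail of \<open>h\<close> at
    \<open>z + x\<close> compared with \<open>F z\<close> is dominated by the moment of rate
    \<open>b * lam\<close>, which is integrable as \<open>b\<close> is below 1.\<close>
  have part1: "((\<lambda>z. \<integral>x. indicator {- z / 2<..} x * (h (z + x) / F z) \<partial>R) \<longlongrightarrow> (\<integral>x. c \<partial>R)) at_top"
  proof (rule integral_dominated_convergence_at_top[where w="\<lambda>x. K * A * exp (b * lam * (max 0 (- x)) powr b)"])
    show "integrable R (\<lambda>x. K * A * exp (b * lam * (max 0 (- x)) powr b))"
      using b_pos b_less by (intro integrable_mult_right exp_moment_simple) auto
    show "\<forall>\<^sub>F z in at_top. AE x in R. norm (indicator {- z / 2<..} x * (h (z + x) / F z)) \<le> K * A * exp (b * lam * (max 0 (- x)) powr b)"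
      using eventually_ge_at_top[of Z]
    proof eventually_elim
      case (elim z)
      then have z: "2 * w0 \<le> z" "0 < z" using w0 by (auto simp: Z_def)
      have "h (z + x) \<le> K * A * exp (b * lam * (max 0 (- x)) powr b) * F z" if x: "- z / 2 < x" for x
      proof (cases "0 \<le> x")
        case True
        have "h (z + x) \<le> K * F (z + x)" using z True w0 by (intro hF) auto
        also have "\<dots> \<le> K * F z" using z True w0 K by (intro mult_left_mono r0) auto
        also have "\<dots> \<le> A * (K * F z)" using mult_right_mono[OF A, of "K * F z"] K F_nonneg[of z] by simp
        also have "\<dots> = K * A * exp (b * lam * (max 0 (- x)) powr b) * F z" using True b_pos by simp
        finally show ?thesis .
      next
        case False
        have "h (z + x) \<le> K * F (z - (- x))" using z x by (simp add: hF)
        also have "\<dots> \<le> K * (A * exp (lam * b * (- x) powr b) * F z)"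
          using z x False K by (intro mult_left_mono Fr) auto
        also have "\<dots> = K * A * exp (b * lam * (max 0 (- x)) powr b) * F z" using False by (simp add: mult_ac)
        finally show ?thesis .
      qed
      then show ?case
        using z F_pos[of z] h0 K A
        by (intro AE_I2) (auto simp: pos_divide_le_eq abs_mult split: split_indicator)
    qed
    show "AE x in R. ((\<lambda>z. indicator {- z / 2<..} x * (h (z + x) / F z)) \<longlongrightarrow> c) at_top"
    proof (rule AE_I2)
      fix x :: real
      have 1: "filterlim (\<lambda>z. z + x) at_top at_top"
        by (rule filterlim_tendsto_add_at_top[OF tendsto_const filterlim_ident, of x, simplified add.commute])
      have "((\<lambda>z. z powr (b - 1) * x) \<longlongrightarrow> 0 * x) at_top"
        using b_less by (intro tendsto_intros tendsto_neg_powr filterlim_ident) auto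
      then have 2: "((\<lambda>z. F (z + x) / F z) \<longlongrightarrow> 1) at_top"
        by (intro F_ratio_tendsto filterlim_ident) simp
      have "((\<lambda>z. (h (z + x) / F (z + x)) * (F (z + x) / F z)) \<longlongrightarrow> c * 1) at_top"
        by (intro tendsto_mult 2 filterlim_compose[OF hlim 1])
      then have "((\<lambda>z. (h (z + x) / F (z + x)) * (F (z + x) / F z)) \<longlongrightarrow> c) at_top" by (rule tendsto_eq_rhs) simp
      moreover have "\<forall>\<^sub>F z in at_top. (h (z + x) / F (z + x)) * (F (z + x) / F z) = indicator {- z / 2<..} x * (h (z + x) / F z)"
        using eventually_gt_at_top[of "2 * \<bar>x\<bar>"]
      proof eventually_elim
        case (elim z)
        then have "0 < z + x" "- z / 2 < x" by auto
        then show ?case using F_pos[of "z + x"] by simp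
      qed
      ultimately show "((\<lambda>z. indicator {- z / 2<..} x * (h (z + x) / F z)) \<longlongrightarrow> c) at_top"
        by (rule Lim_transform_eventually)
    qed
  qed auto
  \<comment> \<open>Steps at or below \<open>- z / 2\<close>, written in terms of the landing point
    \<open>w = z + x\<close>: the density of the step relative to \<open>F z\<close> converges to
    \<open>l_inf\<close> for each fixed \<open>w\<close>, leaving the integral of
    \<open>h\<close>.\<close>
  have part2: "((\<lambda>z. \<integral>w. indicator {..z / 2} w * (h w * (l (w - z) * (F (z - w) / F z))) \<partial>lborel) \<longlongrightarrow> (\<integral>w. h w * l_inf \<partial>lborel)) at_top"
  proof (rule integral_dominated_convergence_at_top[where w="\<lambda>w. D * (1 / (1 + w\<^sup>2))"])
    show "integrable lborel (\<lambda>w. D * (1 / (1 + w\<^sup>2)))"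
      by (intro integrable_mult_right integrable_cauchy)
    show "\<forall>\<^sub>F z in at_top. AE w in lborel. norm (indicator {..z / 2} w * (h w * (l (w - z) * (F (z - w) / F z)))) \<le> D * (1 / (1 + w\<^sup>2))"
      using eventually_ge_at_top[of Z]
    proof eventually_elim
      case (elim z)
      then have z: "2 * w0 \<le> z" "0 < z" "- x0 \<le> z / 2" using w0 by (auto simp: Z_def)
      have "h w * (l (w - z) * (F (z - w) / F z)) \<le> D * (1 / (1 + w\<^sup>2))" if w: "w \<le> z / 2" for w
      proof -
        have lw: "l (w - z) \<le> l_bd" using w z by (intro l_le) auto
        have "h w * (F (z - w) / F z) \<le> (2 + A * C2) * (1 / (1 + w\<^sup>2))"
        proof (cases "0 < w")
          case True
          have "F (z - w) / F z \<le> A * exp (lam * b * w powr b)"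
            using Fr[of z w] True w z F_pos[of z] by (simp add: pos_divide_le_eq)
          then have "h w * (F (z - w) / F z) \<le> h w * (A * exp (lam * b * w powr b))"
            by (intro mult_left_mono h0)
          also have "\<dots> = A * (h w * exp (lam * b * w powr b))" by simp
          also have "\<dots> \<le> A * (C2 * (1 / (1 + w\<^sup>2)))" using A by (intro mult_left_mono hpos True) auto
          also have "\<dots> \<le> (2 + A * C2) * (1 / (1 + w\<^sup>2))" by (simp add: add_divide_distrib distrib_right)
          finally show ?thesis .
        next
          case False
          have "F (z - w) \<le> F z" using False z w0 by (intro r0) auto
          then have "F (z - w) / F z \<le> 1" using F_pos[of z] z by simp
          then have "h w * (F (z - w) / F z) \<le> exp w * 1"
            using hexp h0 F_nonneg by (intro mult_mono) auto
          also have "\<dots> \<le> 2 * (1 / (1 + w\<^sup>2))" using hneg False by simp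
          also have "\<dots> \<le> (2 + A * C2) * (1 / (1 + w\<^sup>2))" using A C2 by (intro mult_right_mono) auto
          finally show ?thesis .
        qed
        then have "l (w - z) * (h w * (F (z - w) / F z)) \<le> l_bd * ((2 + A * C2) * (1 / (1 + w\<^sup>2)))"
          by (rule mult_mono[OF lw _ l_bd_nonneg]) (simp add: h0 F_nonneg)
        then show ?thesis by (simp add: D_def mult_ac)
      qed
      then show ?case
        using h0 l_nonneg F_nonneg D
        by (intro AE_I2) (auto simp: abs_mult split: split_indicator)
    qed
    show "AE w in lborel. ((\<lambda>z. indicator {..z / 2} w * (h w * (l (w - z) * (F (z - w) / F z)))) \<longlongrightarrow> h w * l_inf) at_top"
    proof (rule AE_I2)
      fix w :: real
      have 1: "filterlim (\<lambda>z. w - z) at_bot at_top"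
      proof -
        have "filterlim (\<lambda>z. - w + z) at_top at_top"
          by (rule filterlim_tendsto_add_at_top[OF tendsto_const filterlim_ident])
        then show ?thesis by (simp add: filterlim_uminus_at_bot)
      qed
      have "((\<lambda>z. z powr (b - 1) * (- w)) \<longlongrightarrow> 0 * (- w)) at_top"
        using b_less by (intro tendsto_intros tendsto_neg_powr filterlim_ident) auto
      then have 2: "((\<lambda>z. F (z + - w) / F z) \<longlongrightarrow> 1) at_top"
        by (intro F_ratio_tendsto filterlim_ident) simp
      have "((\<lambda>z. h w * (l (w - z) * (F (z - w) / F z))) \<longlongrightarrow> h w * (l_inf * 1)) at_top"
        using 2 by (intro tendsto_mult tendsto_const filterlim_compose[OF l_lim 1]) simp
      then have "((\<lambda>z. h w * (l (w - z) * (F (z - w) / F z))) \<longlongrightarrow> h w * l_inf) at_top" by (rule tendsto_eq_rhs) simp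
      moreover have "\<forall>\<^sub>F z in at_top. h w * (l (w - z) * (F (z - w) / F z)) = indicator {..z / 2} w * (h w * (l (w - z) * (F (z - w) / F z)))"
        using eventually_gt_at_top[of "2 * \<bar>w\<bar>"] by eventually_elim auto
      ultimately show "((\<lambda>z. indicator {..z / 2} w * (h w * (l (w - z) * (F (z - w) / F z)))) \<longlongrightarrow> h w * l_inf) at_top"
        by (rule Lim_transform_eventually)
    qed
  qed auto
  have "((\<lambda>z. (\<integral>x. indicator {- z / 2<..} x * (h (z + x) / F z) \<partial>R)
      + (\<integral>w. indicator {..z / 2} w * (h w * (l (w - z) * (F (z - w) / F z))) \<partial>lborel)) \<longlongrightarrow> c + l_inf * (\<integral>w. h w \<partial>lborel)) at_top"
    by (rule tendsto_eq_rhs[OF tendsto_add[OF part1 part2]]) simp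
  moreover have "\<forall>\<^sub>F z in at_top. (\<integral>x. indicator {- z / 2<..} x * (h (z + x) / F z) \<partial>R)
      + (\<integral>w. indicator {..z / 2} w * (h w * (l (w - z) * (F (z - w) / F z))) \<partial>lborel) = U h z / F z"
    using eventually_ge_at_top[of Z]
  proof eventually_elim
    case (elim z)
    then have z: "2 * w0 \<le> z" "0 < z" "- x0 \<le> z / 2" using w0 by (auto simp: Z_def)
    have i: "integrable R (\<lambda>x. h (z + x) / F z)"
      using h0 h1 F_pos[OF z(2)] by (intro R.integrable_const_bound[where B="1 / F z"]) (auto intro!: AE_I2 divide_right_mono)
    have i2: "integrable R (\<lambda>x. indicator {- z / 2<..} x * (h (z + x) / F z))"
      by (rule Bochner_Integration.integrable_bound[OF i]) (auto split: split_indicator)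
    have i3: "integrable R (\<lambda>x. indicator {.. - z / 2} x * (h (z + x) / F z))"
      by (rule Bochner_Integration.integrable_bound[OF i]) (auto split: split_indicator)
    have "(\<integral>w. indicator {..z / 2} w * (h w * (l (w - z) * (F (z - w) / F z))) \<partial>lborel)
      = (\<integral>x. indicator {..z / 2} (z + x) * (h (z + x) * (l x * (F (- x) / F z))) \<partial>lborel)"
      using lborel_integral_real_affine[of 1 "\<lambda>w. indicator {..z / 2} w * (h w * (l (w - z) * (F (z - w) / F z)))" z] by simp
    also have "\<dots> = (\<integral>x. indicator {..x0} x * (l x * F (- x)) * (indicator {.. - z / 2} x * (h (z + x) / F z)) \<partial>lborel)"
      using z by (intro Bochner_Integration.integral_cong) (auto split: split_indicator)
    also have "\<dots> = (\<integral>x. indicator {..x0} x * (indicator {.. - z / 2} x * (h (z + x) / F z)) \<partial>R)"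
      by (rule R_left_integral[symmetric]) measurable
    also have "\<dots> = (\<integral>x. indicator {.. - z / 2} x * (h (z + x) / F z) \<partial>R)"
      using z by (intro Bochner_Integration.integral_cong) (auto split: split_indicator)
    finally have "(\<integral>x. indicator {- z / 2<..} x * (h (z + x) / F z) \<partial>R)
      + (\<integral>w. indicator {..z / 2} w * (h w * (l (w - z) * (F (z - w) / F z))) \<partial>lborel)
      = (\<integral>x. indicator {- z / 2<..} x * (h (z + x) / F z) + indicator {.. - z / 2} x * (h (z + x) / F z) \<partial>R)"
      using Bochner_Integration.integral_add[OF i2 i3] by simp
    also have "\<dots> = (\<integral>x. h (z + x) / F z \<partial>R)"
      by (intro Bochner_Integration.integral_cong) (auto split: split_indicator)
    also have "\<dots> = U h z / F z" by (simp add: U_def)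
    finally show ?case .
  qed
  ultimately show "((\<lambda>z. U h z / F z) \<longlongrightarrow> c + l_inf * (\<integral>w. h w \<partial>lborel)) at_top"
    by (rule Lim_transform_eventually)
qed

end

text \<open>The remainder carries an exponential only for positive \<open>t\<close>. Applied to a
  negative multiple of the step, it charges an exponential moment to the left tail alone.\<close>

lemma exp_le_quadratic: "exp t \<le> 1 + t + t\<^sup>2 * exp (max 0 t)" for t :: real
proof -
  have "1 - t \<le> exp (- t)" using exp_ge_add_one_self[of "- t"] by simp
  then have "(1 - t) * exp t \<le> exp (- t) * exp t" by (intro mult_right_mono) auto
  then have 1: "exp t - 1 \<le> t * exp t" by (simp add: exp_minus algebra_simps)
  show ?thesis
  proof (cases "0 \<le> t")
    case True
    have "t * (exp t - 1) \<le> t * (t * exp t)" using 1 True by (intro mult_left_mono)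
    then show ?thesis using 1 True by (simp add: power2_eq_square algebra_simps)
  next
    case False
    have "t * (exp t - 1) \<le> t * t"
      using False exp_ge_add_one_self[of t] by (intro mult_left_mono_neg) linarith+
    then show ?thesis using 1 False by (simp add: power2_eq_square algebra_simps)
  qed
qed

section \<open>The exponentially weighted law of the minimum\<close>

locale stretched_step = stretched_tail nu mu a lam b R l l_inf l_bd x0 s1
  for nu mu a lam b R l l_inf l_bd x0 s1 +
  fixes m :: real
  assumes R_mean: "(\<integral>x. x \<partial>R) = m" and m_pos: "0 < m"
begin

definition chi0 :: "real \<Rightarrow> real" where "chi0 = indicator {..0}"

text \<open>\<open>tilt j w\<close> is \<open>e\<^sup>w P(M\<^sub>j \<le> -w)\<close>; its integral is the \<open>j\<close>-th term of \<open>C\<^sup>*\<close>.\<close>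

definition tilt :: "nat \<Rightarrow> real \<Rightarrow> real" where "tilt j w = exp w * hit chi0 j w"

lemma target_chi0: "target chi0"
  by (auto simp: target_def chi0_def)

lemma target_zero: "target (\<lambda>_. 0)"
  by (simp add: target_def)

lemma tilt_measurable [measurable]: "tilt j \<in> borel_measurable borel"
  using targetD(1)[OF target_hit[OF target_chi0]] unfolding tilt_def[abs_def] by measurable

lemma tilt_nonneg: "0 \<le> tilt j w"
  using targetD(2)[OF target_hit[OF target_chi0]] by (simp add: tilt_def)

lemma tilt_le_exp: "tilt j w \<le> exp w"
  using targetD(3)[OF target_hit[OF target_chi0]] by (simp add: tilt_def)

lemma tilt_Suc_le: "ennreal (tilt (Suc j) w) \<le> (\<integral>\<^sup>+x. ennreal (tilt j (w + x)) \<partial>R)"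
  using step_le[OF target_hit[OF target_chi0, of j] target_zero, of w "\<lambda>x. ennreal (tilt j (w + x))"]
    targetD(2)[OF target_hit[OF target_chi0, of j]]
  by (simp add: tilt_def)

text \<open>Markov's inequality for the additive martingale, whose mean is 1; in operator form, the
  bound 1 is preserved because \<open>R\<close> has total mass 1.\<close>

lemma tilt_le_1: "tilt j w \<le> 1"
proof (induction j arbitrary: w)
  case 0
  show ?case by (simp add: tilt_def chi0_def split: split_indicator)
next
  case (Suc j)
  have "ennreal (tilt (Suc j) w) \<le> (\<integral>\<^sup>+x. ennreal (tilt j (w + x)) \<partial>R)" by (rule tilt_Suc_le)
  also have "\<dots> \<le> (\<integral>\<^sup>+x. 1 \<partial>R)" by (intro nn_integral_mono) (simp add: Suc)
  also have "\<dots> = 1" using R.emeasure_space_1 by simp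
  finally show ?case by simp
qed

lemma tilt_integral_finite: "(\<integral>\<^sup>+x. ennreal (tilt j (w + x)) \<partial>R) = ennreal (U (tilt j) w)"
  unfolding U_def
  by (intro nn_integral_eq_integral R.integrable_const_bound[where B=1]) (auto simp: tilt_nonneg tilt_le_1)

text \<open>The nonlinearity of branching is isolated in a scalar factor in front of the linear
  operator \<open>U\<close>. The value 1 chosen for \<open>r = 0\<close> is harmless, since
  \<open>U\<close> vanishes there as well.\<close>

lemma tilt_Suc_eq:
  "tilt (Suc j) w = (let r = \<integral>y. hit chi0 j (w + y) \<partial>mu in if r = 0 then 1 else gam r / (kappa * r)) * U (tilt j) w"
proof -
  define r where "r = (\<integral>y. hit chi0 j (w + y) \<partial>mu)"
  have r: "0 \<le> r" unfolding r_def by (intro target_integral target_hit target_chi0)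
  have "ennreal (exp w * (kappa * r)) = ennreal (U (tilt j) w)"
    unfolding tilt_integral_finite[symmetric] r_def
    using change_hit[of "hit chi0 j" w] targetD[OF target_hit[OF target_chi0, of j]]
      target_integrable[OF target_hit[OF target_chi0, of j]]
    by (simp add: tilt_def)
  moreover have "0 \<le> U (tilt j) w"
    unfolding U_def by (intro integral_nonneg_AE) (simp add: tilt_nonneg)
  ultimately have eq: "U (tilt j) w = exp w * (kappa * r)"
    using r nu_mean_pos by simp
  show ?thesis
    using nu_mean_pos unfolding Let_def r_def[symmetric] eq
    by (simp add: tilt_def r_def[symmetric])
qed

lemma hit_mean_le: "(\<integral>y. hit chi0 j (w + y) \<partial>mu) \<le> exp (- w) / kappa"
proof -
  have "ennreal (exp w * (kappa * (\<integral>y. hit chi0 j (w + y) \<partial>mu))) = (\<integral>\<^sup>+x. ennreal (tilt j (w + x)) \<partial>R)"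
    using change_hit[of "hit chi0 j" w] targetD[OF target_hit[OF target_chi0, of j]]
      target_integrable[OF target_hit[OF target_chi0, of j]]
    by (simp add: tilt_def)
  also have "\<dots> \<le> (\<integral>\<^sup>+x. 1 \<partial>R)"
    by (intro nn_integral_mono) (simp add: tilt_le_1)
  also have "\<dots> = 1" using R.emeasure_space_1 by simp
  finally have "exp w * (kappa * (\<integral>y. hit chi0 j (w + y) \<partial>mu)) \<le> 1" by simp
  then show ?thesis using nu_mean_pos by (simp add: exp_minus field_simps)
qed

text \<open>From a distant start the mean hitting probability \<open>r\<close> is at most
  \<open>exp (- w) / kappa\<close>, hence small, and there several successes are negligible against
  one.\<close>

lemma tilt_ratio: "((\<lambda>w. (let r = \<integral>y. hit chi0 j (w + y) \<partial>mu in if r = 0 then 1 else gam r / (kappa * r))) \<longlongrightarrow> 1) at_top"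
proof (rule tendstoI)
  fix e :: real assume e: "0 < e"
  let ?r = "\<lambda>w. \<integral>y. hit chi0 j (w + y) \<partial>mu"
  have "\<forall>\<^sub>F r in at 0 within {0<..1}. dist (gam r / r) kappa < e * kappa"
    using e nu_mean_pos by (intro tendstoD[OF gam_ratio]) auto
  then obtain d where d: "0 < d" "\<And>r. 0 < r \<Longrightarrow> r \<le> 1 \<Longrightarrow> r < d \<Longrightarrow> \<bar>gam r / r - kappa\<bar> < e * kappa"
    unfolding eventually_at by (auto simp: dist_real_def)
  have "((\<lambda>w. exp (- w) / kappa) \<longlongrightarrow> 0) at_top"
    using nu_mean_pos by (intro tendsto_divide_zero filterlim_compose[OF exp_at_bot filterlim_uminus_at_bot_at_top])
  then have "\<forall>\<^sub>F w in at_top. exp (- w) / kappa < d"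
    using d by (intro order_tendstoD)
  then show "\<forall>\<^sub>F w in at_top. dist (let r = ?r w in if r = 0 then 1 else gam r / (kappa * r)) 1 < e"
  proof eventually_elim
    case (elim w)
    have r: "0 \<le> ?r w" "?r w \<le> 1" "?r w < d"
      using target_integral[OF target_hit[OF target_chi0], where v=w] hit_mean_le[of j w] elim by auto
    show ?case
    proof (cases "?r w = 0")
      case False
      with r have "\<bar>gam (?r w) / ?r w - kappa\<bar> < e * kappa" by (intro d) auto
      moreover have "gam (?r w) / (kappa * ?r w) - 1 = (gam (?r w) / ?r w - kappa) / kappa"
        using nu_mean_pos by (simp add: field_simps)
      ultimately have "\<bar>gam (?r w) / (kappa * ?r w) - 1\<bar> < e"
        using nu_mean_pos by (simp only: abs_divide) (simp add: pos_divide_less_eq)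
      then show ?thesis using False by (simp add: Let_def dist_real_def)
    qed (use e in simp)
  qed
qed

definition Cpart :: "nat \<Rightarrow> real" where "Cpart j = (\<Sum>i<j. \<integral>w. tilt i w \<partial>lborel)"

text \<open>Each generation passes on the tail coefficient already present and adds
  \<open>l_inf\<close> times the integral of the current function, the contribution of a large
  displacement made in that generation.\<close>

lemma tilt_tail: "((\<lambda>w. tilt j w / F w) \<longlongrightarrow> l_inf * Cpart j) at_top"
proof (induction j)
  case 0
  have ev: "\<forall>\<^sub>F w in at_top. 0 = tilt 0 w / F w"
    using eventually_gt_at_top[of 0] by eventually_elim (simp add: tilt_def chi0_def)
  then show ?case
    using Lim_transform_eventually[OF tendsto_const ev] by (simp only: Cpart_def lessThan_0 sum.empty mult_zero_right)
next
  case (Suc j)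
  have "((\<lambda>z. U (tilt j) z / F z) \<longlongrightarrow> l_inf * Cpart j + l_inf * (\<integral>w. tilt j w \<partial>lborel)) at_top"
    by (rule U_tail(2)) (auto simp: tilt_nonneg tilt_le_1 tilt_le_exp Suc)
  from tendsto_mult[OF tilt_ratio[of j] this]
  have "((\<lambda>w. tilt (Suc j) w / F w) \<longlongrightarrow> 1 * (l_inf * Cpart j + l_inf * (\<integral>w. tilt j w \<partial>lborel))) at_top"
    unfolding tilt_Suc_eq times_divide_eq_right .
  then show ?case
    by (rule tendsto_eq_rhs) (simp add: Cpart_def distrib_left)
qed

lemma tilt_lborel_integrable: "integrable lborel (tilt j)"
  by (rule U_tail(1)[OF _ _ _ _ tilt_tail]) (auto simp: tilt_nonneg tilt_le_1 tilt_le_exp)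

section \<open>Chernoff bounds with truncated steps\<close>

text \<open>The coefficient of the second-order error in every Chernoff bound below. The fraction
  9/10 is a fixed rate below 1 that leaves room for all slopes in use.\<close>

definition Kq :: real where
  "Kq = (\<integral>x. (1 + x\<^sup>2) * exp (9 / 10 * lam * (max 0 (- x)) powr b) \<partial>R)"

lemma Kq_nonneg: "0 \<le> Kq"
  unfolding Kq_def by (intro integral_nonneg_AE) auto

text \<open>For a step between \<open>- L\<close> and 0, write \<open>s * u\<close> as
  \<open>s * u powr (1 - b) * u powr b\<close>; the truncation turns this into at most
  \<open>9 / 10 * lam * u powr b\<close>, for which the step law has a moment. Thus the Laplace
  transform keeps its Gaussian-type expansion with mean \<open>m\<close> although the full
  exponential moment is infinite.\<close>

lemma trunc_exp:
  assumes s: "0 \<le> s" and L: "0 \<le> L" and sL: "s * L powr (1 - b) \<le> 9 / 10 * lam"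
  shows "(\<integral>\<^sup>+x. ennreal (exp (- (s * x)) * indicator {- L..} x) \<partial>R) \<le> ennreal (exp (- (s * m) + Kq * s\<^sup>2))"
proof -
  let ?E = "\<lambda>x. (1 + x\<^sup>2) * exp (9 / 10 * lam * (max 0 (- x)) powr b)"
  have iE: "integrable R ?E" by (rule exp_moment) auto
  have pt: "exp (- (s * x)) * indicator {- L..} x \<le> 1 - s * x + s\<^sup>2 * ?E x" for x
  proof (cases "- L \<le> x")
    case True
    have mx: "max 0 (- (s * x)) \<le> 9 / 10 * lam * (max 0 (- x)) powr b"
    proof (cases "x < 0")
      case neg: True
      define u where "u = - x"
      have u: "0 < u" "u \<le> L" using neg True by (auto simp: u_def)
      have "s * u = (s * u powr (1 - b)) * u powr b" using u by (simp add: mult.assoc powr_add[symmetric])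
      also have "\<dots> \<le> (s * L powr (1 - b)) * u powr b"
        using u s b_less by (intro mult_right_mono mult_left_mono powr_mono2) auto
      also have "\<dots> \<le> 9 / 10 * lam * u powr b" by (intro mult_right_mono sL) auto
      finally have "s * u \<le> 9 / 10 * lam * u powr b" .
      moreover have "0 \<le> 9 / 10 * lam * u powr b" using lam_pos by simp
      ultimately show ?thesis using u by (auto simp: u_def)
    next
      case False
      then show ?thesis using s lam_pos by simp
    qed
    have "exp (- (s * x)) \<le> 1 + - (s * x) + (- (s * x))\<^sup>2 * exp (max 0 (- (s * x)))" by (rule exp_le_quadratic)
    also have "\<dots> \<le> 1 - s * x + s\<^sup>2 * ?E x"
    proof -
      have "x\<^sup>2 * exp (max 0 (- (s * x))) \<le> ?E x"
        using mx by (intro mult_mono) auto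
      from mult_left_mono[OF this, of "s\<^sup>2"] show ?thesis by (simp add: power_mult_distrib mult.assoc)
    qed
    finally show ?thesis using True by simp
  next
    case False
    then have "0 \<le> - (s * x)" using s L by (simp add: mult_nonneg_nonpos)
    moreover have "0 \<le> s\<^sup>2 * ?E x" by simp
    ultimately show ?thesis using False by (simp del: mult_minus_left)
  qed
  have pos: "0 \<le> 1 - s * x + s\<^sup>2 * ?E x" for x
    by (rule order_trans[OF _ pt]) simp
  have "(\<integral>\<^sup>+x. ennreal (exp (- (s * x)) * indicator {- L..} x) \<partial>R) \<le> (\<integral>\<^sup>+x. ennreal (1 - s * x + s\<^sup>2 * ?E x) \<partial>R)"
    by (intro nn_integral_mono ennreal_leI pt)
  also have "\<dots> = ennreal (\<integral>x. 1 - s * x + s\<^sup>2 * ?E x \<partial>R)"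
    using iE R_int pos by (intro nn_integral_eq_integral Bochner_Integration.integrable_add Bochner_Integration.integrable_diff integrable_mult_right) auto
  also have "(\<integral>x. 1 - s * x + s\<^sup>2 * ?E x \<partial>R) = 1 - s * m + s\<^sup>2 * Kq"
    using iE R_int by (simp add: Kq_def R_mean)
  also have "ennreal (1 - s * m + s\<^sup>2 * Kq) \<le> ennreal (exp (- (s * m) + Kq * s\<^sup>2))"
    using exp_ge_add_one_self[of "- (s * m) + Kq * s\<^sup>2"] by (intro ennreal_leI) (simp only: mult.commute[of Kq "s\<^sup>2"] diff_conv_add_uminus add.assoc)
  finally show ?thesis .
qed

text \<open>Markov's inequality at rate 7/8. It lies above the rate 3/4 that is wanted for the
  minimum, and the spare eighth absorbs the number of steps.\<close>

lemma left_tail: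
  obtains Ct where "0 < Ct" "\<And>r. 0 \<le> r \<Longrightarrow> measure R {..< - r} \<le> Ct * exp (- (7 / 8 * lam * r powr b))"
proof -
  let ?e = "\<lambda>x. exp (7 / 8 * lam * (max 0 (- x)) powr b)"
  have i: "integrable R ?e" by (rule exp_moment_simple) auto
  define Ct where "Ct = 1 + (\<integral>x. ?e x \<partial>R)"
  have "measure R {..< - r} \<le> Ct * exp (- (7 / 8 * lam * r powr b))" if r: "0 \<le> r" for r
  proof -
    have "(\<integral>x. indicator {..< - r} x * exp (7 / 8 * lam * r powr b) \<partial>R) \<le> (\<integral>x. ?e x \<partial>R)"
    proof (rule integral_mono[OF _ i])
      show "integrable R (\<lambda>x. indicator {..< - r} x * exp (7 / 8 * lam * r powr b))"
        by (intro R.integrable_const_bound[where B="exp (7 / 8 * lam * r powr b)"]) (auto split: split_indicator)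
      fix x
      show "indicator {..< - r} x * exp (7 / 8 * lam * r powr b) \<le> ?e x"
        using r b_pos lam_pos by (auto split: split_indicator intro!: powr_mono2)
    qed
    then have "measure R {..< - r} * exp (7 / 8 * lam * r powr b) \<le> Ct"
      by (simp add: Ct_def)
    then show ?thesis by (simp add: exp_minus field_simps)
  qed
  moreover have "0 < Ct" unfolding Ct_def by (intro add_pos_nonneg integral_nonneg_AE) auto
  ultimately show ?thesis using that by blast
qed

text \<open>The usual split of a random walk estimate: either one of the \<open>j\<close> steps is
  below \<open>- r\<close>, or all are truncated and the exponential Markov inequality applies.
  After a step below \<open>- r\<close> nothing better than \<open>tilt_le_1\<close> is
  used.\<close>

lemma tilt_chernoff:
  assumes s: "0 \<le> s" and r: "0 \<le> r" and sr: "s * r powr (1 - b) \<le> 9 / 10 * lam"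
  shows "tilt j w \<le> real j * measure R {..< - r} + exp (- (s * w)) * exp (- (s * m) + Kq * s\<^sup>2) ^ j"
proof (induction j arbitrary: w)
  case 0
  have "w \<le> 0 \<Longrightarrow> s * w \<le> 0" using s by (simp add: mult_nonneg_nonpos)
  then show ?case by (auto simp: tilt_def chi0_def split: split_indicator)
next
  case (Suc j)
  define \<beta> where "\<beta> = measure R {..< - r}"
  define \<tau> where "\<tau> = exp (- (s * m) + Kq * s\<^sup>2)"
  define q where "q = exp (- (s * w)) * \<tau> ^ j"
  define f where "f x = exp (- (s * x)) * indicator {- r..} x" for x
  have f0: "0 \<le> f x" for x by (simp add: f_def)
  have [measurable]: "f \<in> borel_measurable borel" unfolding f_def[abs_def] by measurable
  have q0: "0 \<le> q" "0 \<le> \<beta>" "0 \<le> \<tau>" by (auto simp: q_def \<beta>_def \<tau>_def)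
  have pt: "tilt j (w + x) \<le> real j * \<beta> + q * f x + indicator {..< - r} x" for x
  proof (cases "- r \<le> x")
    case True
    then show ?thesis
    proof -
      have "exp (- (s * (w + x))) = exp (- (s * w)) * exp (- (s * x))" by (simp add: exp_add[symmetric] distrib_left)
      then show ?thesis
        using True Suc[of "w + x"] unfolding \<beta>_def[symmetric] \<tau>_def[symmetric] q_def f_def by (simp add: mult_ac)
    qed
  next
    case False
    then show ?thesis using tilt_le_1[of j "w + x"] q0 f0[of x] by (simp add: add_increasing)
  qed
  have ftau: "(\<integral>\<^sup>+x. ennreal (f x) \<partial>R) \<le> ennreal \<tau>"
    unfolding f_def \<tau>_def by (rule trunc_exp[OF s r sr])
  have fint: "integrable R f"
    by (rule integrableI_nonneg) (use f0 ftau in \<open>auto simp: top.not_eq_extremum intro: le_less_trans\<close>)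
  have fI: "(\<integral>x. f x \<partial>R) \<le> \<tau>"
    using ftau q0 by (subst (asm) nn_integral_eq_integral[OF fint]) (simp_all add: f0)
  have "ennreal (tilt (Suc j) w) \<le> ennreal (U (tilt j) w)"
    using tilt_Suc_le[of j w] unfolding tilt_integral_finite .
  then have "tilt (Suc j) w \<le> U (tilt j) w"
    by (rule ennreal_le_iff[THEN iffD1, rotated])
      (unfold U_def, intro integral_nonneg_AE, simp add: tilt_nonneg)
  moreover have "U (tilt j) w \<le> (\<integral>x. real j * \<beta> + q * f x + indicator {..< - r} x \<partial>R)"
    unfolding U_def
    by (intro integral_mono pt Bochner_Integration.integrable_add integrable_mult_right fint
        R.integrable_const_bound[where B=1 and f="\<lambda>x. tilt j (w + x)"]
        R.integrable_const_bound[where B=1 and f="indicator {..< - r}"])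
      (auto simp: tilt_nonneg tilt_le_1)
  moreover have "(\<integral>x. real j * \<beta> + q * f x + indicator {..< - r} x \<partial>R) = real j * \<beta> + q * (\<integral>x. f x \<partial>R) + \<beta>"
    using fint by (simp add: \<beta>_def R.emeasure_eq_measure)
  moreover have "q * (\<integral>x. f x \<partial>R) \<le> q * \<tau>" by (intro mult_left_mono fI q0)
  ultimately have "tilt (Suc j) w \<le> real (Suc j) * \<beta> + q * \<tau>" by (simp add: algebra_simps)
  then show ?case unfolding q_def \<beta>_def \<tau>_def by (simp add: mult_ac)
qed

text \<open>The walk must fall \<open>r = m * j + w\<close> below its mean position. With
  \<open>j\<close> at most \<open>2 * r / m\<close>, the Chernoff error is of order
  \<open>r powr (2 * b - 1)\<close>, which is bounded. The rate 3/4 exceeds \<open>b\<close> by at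
  least 1/4, as the weighted bound requires.\<close>

lemma tilt_left_tail:
  obtains CA where "0 < CA"
    "\<And>j w. 1 \<le> m * real j + w \<Longrightarrow> m * real j / 2 \<le> m * real j + w \<Longrightarrow>
      tilt j w \<le> CA * exp (- (3 / 4 * lam * (m * real j + w) powr b))"
proof -
  obtain Ct where Ct: "0 < Ct" "\<And>r. 0 \<le> r \<Longrightarrow> measure R {..< - r} \<le> Ct * exp (- (7 / 8 * lam * r powr b))"
    using left_tail by blast
  obtain C where C: "0 < C" "\<And>r. 1 \<le> r \<Longrightarrow> r powr 1 * exp (- (lam / 8) * r powr b) \<le> C"
    using powr_exp_bound[of "lam / 8" b 1] lam_pos b_pos by auto
  define CA where "CA = 2 / m * Ct * C + exp (Kq * (9 / 16 * lam\<^sup>2) * (2 / m))"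
  have "tilt j w \<le> CA * exp (- (3 / 4 * lam * r powr b))"
    if r1: "1 \<le> r" and r2: "m * real j / 2 \<le> r" and r: "r = m * real j + w" for j w r
  proof -
    \<comment> \<open>Chosen so that the linear gain \<open>s * r\<close> is
      \<open>3 / 4 * lam * r powr b\<close>, while the truncation at \<open>r\<close> satisfies the
      constraint with 3/4 in place of 9/10.\<close>
    define s where "s = 3 / 4 * lam * r powr (b - 1)"
    have s: "0 \<le> s" using lam_pos by (simp add: s_def)
    have j: "real j \<le> 2 / m * r" using r2 m_pos by (simp add: field_simps)
    have "s * r powr (1 - b) = 3 / 4 * lam * r powr ((b - 1) + (1 - b))" by (simp only: s_def mult.assoc powr_add)
    then have sr: "s * r powr (1 - b) = 3 / 4 * lam" using r1 by simp
    have sr2: "s * r = 3 / 4 * lam * r powr b"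
      using r1 by (simp add: s_def powr_diff)
    have "tilt j w \<le> real j * measure R {..< - r} + exp (- (s * w)) * exp (- (s * m) + Kq * s\<^sup>2) ^ j"
      by (rule tilt_chernoff) (use s r1 sr lam_pos in auto)
    also have "exp (- (s * w)) * exp (- (s * m) + Kq * s\<^sup>2) ^ j = exp (- (s * r)) * exp (Kq * s\<^sup>2 * real j)"
      by (simp add: exp_of_nat_mult[symmetric] exp_add[symmetric] r algebra_simps)
    also have "\<dots> \<le> exp (- (3 / 4 * lam * r powr b)) * exp (Kq * (9 / 16 * lam\<^sup>2) * (2 / m))"
    proof -
      have "s\<^sup>2 * real j \<le> s\<^sup>2 * (2 / m * r)" by (intro mult_left_mono j) simp
      also have "\<dots> = 9 / 16 * lam\<^sup>2 * (2 / m) * r powr (2 * b - 1)"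
      proof -
        have "r powr (b - 1) * r powr (b - 1) * r powr 1 = r powr (2 * b - 1)"
          by (simp only: powr_add[symmetric]) (rule arg_cong2[where f="(powr)"], auto)
        then show ?thesis using r1 by (simp add: s_def power2_eq_square mult_ac)
      qed
      also have "\<dots> \<le> 9 / 16 * lam\<^sup>2 * (2 / m) * 1"
      proof (rule mult_left_mono)
        have "r powr (2 * b - 1) \<le> r powr 0" using r1 b_less by (intro powr_mono) auto
        then show "r powr (2 * b - 1) \<le> 1" using r1 by simp
      qed (use m_pos in auto)
      finally have "Kq * (s\<^sup>2 * real j) \<le> Kq * (9 / 16 * lam\<^sup>2 * (2 / m) * 1)"
        by (intro mult_left_mono Kq_nonneg)
      then show ?thesis unfolding sr2 by (intro mult_left_mono) (simp_all add: mult.assoc)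
    qed
    also have "real j * measure R {..< - r} \<le> 2 / m * Ct * C * exp (- (3 / 4 * lam * r powr b))"
    proof -
      have "real j * measure R {..< - r} \<le> (2 / m * r) * (Ct * exp (- (7 / 8 * lam * r powr b)))"
        using j r1 m_pos by (intro mult_mono Ct) auto
      also have "exp (- (7 / 8 * lam * r powr b)) = exp (- (lam / 8) * r powr b) * exp (- (3 / 4 * lam * r powr b))"
        by (simp add: mult_exp_exp)
      also have "(2 / m * r) * (Ct * (exp (- (lam / 8) * r powr b) * exp (- (3 / 4 * lam * r powr b))))
        = 2 / m * Ct * (r powr 1 * exp (- (lam / 8) * r powr b)) * exp (- (3 / 4 * lam * r powr b))"
        using r1 by (simp add: mult_ac)
      also have "\<dots> \<le> 2 / m * Ct * C * exp (- (3 / 4 * lam * r powr b))"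
        using C(2)[OF r1] Ct m_pos by (intro mult_right_mono mult_left_mono) auto
      finally show ?thesis .
    qed
    finally show ?thesis by (simp add: CA_def algebra_simps)
  qed
  moreover have "0 < CA" using m_pos Ct C by (simp add: CA_def add_pos_pos)
  ultimately show ?thesis using that by blast
qed

text \<open>The exponential weight is the price of a big displacement being shorter than
  \<open>m * n\<close> by \<open>m * j + w\<close>. If the walk ends far below its mean,
  \<open>tilt_left_tail\<close> beats the weight. Otherwise \<open>w\<close> is below
  \<open>- m * j / 2\<close> and \<open>exp w\<close> beats it. The two polynomial factors on the
  right make the bound summable in \<open>j\<close> and integrable in \<open>w\<close>.\<close>

lemma tilt_weighted:
  obtains CB :: real where "0 < CB"
    "\<And>j w. tilt j w * exp (lam * b * (max 0 (m * real j + w)) powr b) \<le> CB / (1 + m * real j)\<^sup>2 * (1 / (1 + w\<^sup>2))"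
proof -
  obtain CA where CA: "0 < CA"
    "\<And>j w. 1 \<le> m * real j + w \<Longrightarrow> m * real j / 2 \<le> m * real j + w \<Longrightarrow>
      tilt j w \<le> CA * exp (- (3 / 4 * lam * (m * real j + w) powr b))"
    using tilt_left_tail by blast
  obtain C where C: "0 < C" "\<And>r. 1 \<le> r \<Longrightarrow> r powr 4 * exp (- (lam / 4) * r powr b) \<le> C"
    using powr_exp_bound[of "lam / 4" b 4] lam_pos b_pos by auto
  obtain C' :: real where C': "0 < C'" "\<And>r :: real. 1 \<le> r \<Longrightarrow> r powr 4 * exp (- (1 / 2) * r powr 1) \<le> C'"
    using powr_exp_bound[of "1 / 2" 1 4] zero_less_one half_gt_zero by blast
  \<comment> \<open>Bounds \<open>lam * u powr b\<close> wherever it exceeds \<open>u / 2\<close>,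
    that is, for \<open>u powr (1 - b)\<close> below \<open>2 * lam\<close>.\<close>
  define c1 where "c1 = lam * (2 * lam) powr (b / (1 - b))"
  have c1: "0 \<le> c1" using lam_pos by (simp add: c1_def)
  define CB where "CB = 18 * exp lam + 18 * CA * C + 18 * (1 + C') * exp c1"
  have CBp: "0 < CB" using CA C C' by (simp add: CB_def add_pos_pos)
  have poly: "(1 + p)\<^sup>2 * (1 + w\<^sup>2) \<le> 18 * (max 1 r) ^ 4" if "0 \<le> p" "p \<le> 2 * r" "\<bar>w\<bar> \<le> r" for p w r :: real
  proof -
    define M where "M = max 1 r"
    have M: "1 \<le> M" "r \<le> M" by (auto simp: M_def)
    have "(1 + p)\<^sup>2 \<le> (3 * M)\<^sup>2" using that M by (intro power_mono) auto
    moreover have "1 + w\<^sup>2 \<le> 2 * M\<^sup>2"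
    proof -
      have "\<bar>w\<bar>\<^sup>2 \<le> M\<^sup>2" using that M by (intro power_mono) auto
      moreover have "1 \<le> M\<^sup>2" using M by simp
      ultimately show ?thesis by simp
    qed
    ultimately have "(1 + p)\<^sup>2 * (1 + w\<^sup>2) \<le> (3 * M)\<^sup>2 * (2 * M\<^sup>2)" by (intro mult_mono) auto
    then show ?thesis by (simp add: M_def power2_eq_square power4_eq_xxxx)
  qed
  have main: "tilt j w * exp (lam * b * (max 0 (m * real j + w)) powr b) * ((1 + m * real j)\<^sup>2 * (1 + w\<^sup>2)) \<le> CB" for j w
  proof (cases "m * real j / 2 \<le> m * real j + w")
    case True
    define r where "r = m * real j + w"
    have mj: "0 \<le> m * real j" using m_pos by simp
    have r0: "0 \<le> r" "max 0 (m * real j + w) = r" using True mj unfolding r_def by linarith+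
    have P: "(1 + m * real j)\<^sup>2 * (1 + w\<^sup>2) \<le> 18 * (max 1 r) ^ 4"
    proof (rule poly[OF mj])
      show "m * real j \<le> 2 * r" using True mj unfolding r_def by (auto simp: field_simps)
      show "\<bar>w\<bar> \<le> r" using True mj unfolding r_def abs_le_iff by auto
    qed
    show ?thesis
    proof (cases "1 \<le> r")
      case r1: True
      have "tilt j w * exp (lam * b * r powr b) \<le> CA * exp (- (3 / 4 * lam * r powr b)) * exp (lam * b * r powr b)"
        using CA(2)[of j w] True r1 by (intro mult_right_mono) (auto simp: r_def)
      also have "\<dots> = CA * exp (- (3 / 4 - b) * (lam * r powr b))"
        by (simp add: mult.assoc mult_exp_exp algebra_simps)
      also have "\<dots> \<le> CA * exp (- (lam / 4) * r powr b)"
      proof -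
        have "1 / 4 * (lam * r powr b) \<le> (3 / 4 - b) * (lam * r powr b)"
          using b_less lam_pos by (intro mult_right_mono) auto
        then have "- (3 / 4 - b) * (lam * r powr b) \<le> - (lam / 4) * r powr b" by (simp add: algebra_simps)
        then show ?thesis using CA by (intro mult_left_mono) (simp_all only: exp_le_cancel_iff less_imp_le)
      qed
      finally have g: "tilt j w * exp (lam * b * r powr b) \<le> CA * exp (- (lam / 4) * r powr b)" .
      have "tilt j w * exp (lam * b * r powr b) * ((1 + m * real j)\<^sup>2 * (1 + w\<^sup>2))
        \<le> CA * exp (- (lam / 4) * r powr b) * (18 * (max 1 r) ^ 4)"
        by (rule mult_mono[OF g P]) (use CA in auto)
      also have "\<dots> = 18 * CA * (r powr 4 * exp (- (lam / 4) * r powr b))"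
        using r1 by (simp add: powr_numeral)
      also have "\<dots> \<le> 18 * CA * C" using C(2)[OF r1] CA by (intro mult_left_mono) auto
      also have "\<dots> \<le> CB" using C' by (simp add: CB_def)
      finally show ?thesis unfolding r0(2) .
    next
      case False
      have "r powr b \<le> 1 powr b" using False r0 b_pos by (intro powr_mono2) auto
      then have "r powr b \<le> 1" by simp
      then have "b * r powr b \<le> 1 * 1" using b_pos b_less by (intro mult_mono) auto
      then have "lam * (b * r powr b) \<le> lam * 1" using lam_pos by (intro mult_left_mono) auto
      then have g: "tilt j w * exp (lam * b * r powr b) \<le> 1 * exp lam"
        using tilt_le_1[of j w] tilt_nonneg[of j w] by (intro mult_mono) (auto simp: mult.assoc)
      have "tilt j w * exp (lam * b * r powr b) * ((1 + m * real j)\<^sup>2 * (1 + w\<^sup>2)) \<le> 1 * exp lam * (18 * (max 1 r) ^ 4)"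
        by (intro mult_mono[OF g P]) auto
      also have "\<dots> \<le> CB" using False CA C C' by (simp add: CB_def)
      finally show ?thesis unfolding r0(2) .
    qed
  next
    case False
    define u where "u = - w"
    have mj: "0 \<le> m * real j" using m_pos by simp
    have u: "0 < u" "m * real j \<le> 2 * u" using False mj unfolding u_def by linarith+
    have P: "(1 + m * real j)\<^sup>2 * (1 + w\<^sup>2) \<le> 18 * (max 1 u) ^ 4"
      by (rule poly[OF mj]) (use u in \<open>auto simp: u_def\<close>)
    have "(max 0 (m * real j + w)) powr b \<le> u powr b"
      using u b_pos by (intro powr_mono2) (auto simp: u_def)
    then have "b * (max 0 (m * real j + w)) powr b \<le> 1 * u powr b"
      using b_pos b_less by (intro mult_mono) auto
    then have "lam * (b * (max 0 (m * real j + w)) powr b) \<le> lam * (1 * u powr b)"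
      using lam_pos by (intro mult_left_mono) auto
    moreover have "lam * u powr b \<le> u / 2 + c1"
    proof (cases "2 * lam \<le> u powr (1 - b)")
      case True
      have "lam * u powr b \<le> u powr (1 - b) / 2 * u powr b" using True by (intro mult_right_mono) auto
      also have "\<dots> = u / 2" using u by (simp add: powr_add[symmetric])
      finally show ?thesis using c1 by simp
    next
      case False
      have "(u powr (1 - b)) powr (b / (1 - b)) \<le> (2 * lam) powr (b / (1 - b))"
        using False b_pos b_less by (intro powr_mono2) auto
      then have "u powr b \<le> (2 * lam) powr (b / (1 - b))" using b_less by (simp add: powr_powr)
      then have "lam * u powr b \<le> c1" unfolding c1_def using lam_pos by (intro mult_left_mono) auto
      then show ?thesis using u by simp
    qed
    ultimately have e: "lam * b * (max 0 (m * real j + w)) powr b \<le> u / 2 + c1" by (simp add: mult.assoc)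
    have "tilt j w * exp (lam * b * (max 0 (m * real j + w)) powr b) \<le> exp (- u) * exp (u / 2 + c1)"
      using tilt_le_exp[of j w] e by (intro mult_mono) (auto simp: u_def)
    also have "\<dots> = exp (- (1 / 2) * u) * exp c1" by (simp add: mult_exp_exp)
    finally have g: "tilt j w * exp (lam * b * (max 0 (m * real j + w)) powr b) \<le> exp (- (1 / 2) * u) * exp c1" .
    have "tilt j w * exp (lam * b * (max 0 (m * real j + w)) powr b) * ((1 + m * real j)\<^sup>2 * (1 + w\<^sup>2))
      \<le> exp (- (1 / 2) * u) * exp c1 * (18 * (max 1 u) ^ 4)"
      by (intro mult_mono[OF g P]) auto
    also have "\<dots> = ((max 1 u) ^ 4 * exp (- (1 / 2) * u)) * (18 * exp c1)" by (simp add: mult_ac)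
    finally have g2: "tilt j w * exp (lam * b * (max 0 (m * real j + w)) powr b) * ((1 + m * real j)\<^sup>2 * (1 + w\<^sup>2))
      \<le> ((max 1 u) ^ 4 * exp (- (1 / 2) * u)) * (18 * exp c1)" .
    have "(max 1 u) ^ 4 * exp (- (1 / 2) * u) \<le> 1 + C'"
    proof (cases "1 \<le> u")
      case True
      then show ?thesis using C'(2)[OF True] by (simp add: powr_numeral)
    next
      case False
      then show ?thesis using u C' by (simp add: add_increasing2)
    qed
    then have "((max 1 u) ^ 4 * exp (- (1 / 2) * u)) * (18 * exp c1) \<le> (1 + C') * (18 * exp c1)"
      by (intro mult_right_mono) auto
    moreover have "0 \<le> 18 * CA * C" "0 \<le> 18 * exp lam" using CA C by auto
    moreover have "CB = 18 * exp lam + 18 * CA * C + (1 + C') * (18 * exp c1)" by (simp add: CB_def mult_ac)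
    ultimately show ?thesis using g2 by linarith
  qed
  then have "tilt j w * exp (lam * b * (max 0 (m * real j + w)) powr b) \<le> CB / (1 + m * real j)\<^sup>2 * (1 / (1 + w\<^sup>2))" for j w
  proof -
    have "0 < 1 + m * real j" using m_pos by (simp add: add_pos_nonneg)
    then have "0 < (1 + m * real j)\<^sup>2 * (1 + w\<^sup>2)" by (intro mult_pos_pos) (auto simp: add_pos_nonneg)
    then show ?thesis
      using main[of j w] by (simp add: pos_le_divide_eq)
  qed
  with CBp show ?thesis using that by blast
qed

section \<open>The last big displacement\<close>

definition level :: "real \<Rightarrow> nat \<Rightarrow> real" where
  "level xx n = lam * (m * real n) powr b - a * ln (real n) + xx"

text \<open>\<open>slope_lo n\<close> is the Lipschitz constant of \<open>lam * r powr b\<close> on \<open>r \<ge> m * n / 2\<close>.\<close>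

definition slope_lo :: "nat \<Rightarrow> real" where
  "slope_lo n = lam * b * (m * real n / 2) powr (b - 1)"

lemma slope_lo_nonneg: "0 \<le> slope_lo n"
  using lam_pos b_pos by (simp add: slope_lo_def)

text \<open>The shortfall of the displacement \<open>t\<close> against \<open>m * n\<close> is split
  into \<open>p\<close>, due to the subtree that follows, and \<open>q\<close>, due to the position
  before the displacement. The first is charged a stretched exponential, the second only a linear
  exponential with the small slope \<open>slope_lo n\<close>, so that it can be propagated along the
  walk by \<open>trunc_exp\<close>. The added 1 covers negative \<open>q\<close>.\<close>

lemma F_level_le:
  obtains CF n0 where "0 < CF" "1 \<le> n0"
    "\<And>n t p q. n0 \<le> n \<Longrightarrow> m * real n / 2 \<le> t \<Longrightarrow> m * real n - t = p + q \<Longrightarrow>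
      exp (level xx n) * F t \<le> CF * (exp (lam * b * (max 0 p) powr b) * (1 + exp (slope_lo n * q)))"
proof -
  obtain r0 where r0: "1 \<le> r0" "\<And>r s. r0 \<le> r \<Longrightarrow> r \<le> s \<Longrightarrow> F s \<le> F r"
    using F_decreasing by blast
  obtain n1 :: nat where n1: "2 * r0 / m \<le> real n1" using real_arch_simple by blast
  define n0 where "n0 = max 1 n1"
  define CF where "CF = exp xx * ((m / 2) powr a + m powr a)"
  have CFp: "0 < CF" using m_pos by (simp add: CF_def add_pos_pos)
  have main: "exp (level xx n) * F t \<le> CF * (exp (lam * b * (max 0 p) powr b) * (1 + exp (slope_lo n * q)))"
    if n: "n0 \<le> n" and t: "m * real n / 2 \<le> t" and eq: "m * real n - t = p + q" for n t p q
  proof -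
    have n1': "1 \<le> real n" "2 * r0 / m \<le> real n" using n n1 by (auto simp: n0_def)
    define c where "c = m * real n / 2"
    have c: "r0 \<le> c" "0 < c" using n1' m_pos r0 by (auto simp: c_def field_simps)
    have mn: "m * real n = 2 * c" by (simp add: c_def)
    \<comment> \<open>Displacements longer than \<open>m * n\<close> are cut back to it, as
      \<open>F\<close> decreases there; this keeps \<open>G / n\<close> between \<open>m / 2\<close>
      and \<open>m\<close>, whatever the sign of \<open>a\<close>.\<close>
    define G where "G = min t (2 * c)"
    have G: "c \<le> G" "G \<le> 2 * c" "G \<le> t" using t c by (auto simp: G_def c_def)
    have Gpos: "0 < G" using G c by simp
    have FG: "F t \<le> F G" by (rule r0) (use G c in auto)
    have la: "exp (- (a * ln (real n))) = real n powr (- a)" using n1' by (simp add: powr_def)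
    have "exp (level xx n) * F G = exp xx * (real n powr (- a) * G powr a) * exp (lam * ((2 * c) powr b - G powr b))"
    proof -
      have "exp (level xx n) = exp (lam * (2 * c) powr b) * exp (- (a * ln (real n))) * exp xx"
        by (simp add: level_def mn exp_add[symmetric])
      then show ?thesis unfolding la F_def by (simp add: mult_exp_exp right_diff_distrib)
    qed
    also have "real n powr (- a) * G powr a = (G / real n) powr a"
      using n1' Gpos by (simp add: powr_divide powr_minus_divide)
    also have "exp xx * (G / real n) powr a * exp (lam * ((2 * c) powr b - G powr b))
      \<le> CF * (exp (lam * b * (max 0 p) powr b) * (1 + exp (slope_lo n * q)))"
    proof (rule mult_mono)
      have g: "m / 2 \<le> G / real n" "G / real n \<le> m" using G n1' by (auto simp: c_def field_simps)
      have "(G / real n) powr a \<le> (m / 2) powr a + m powr a"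
      proof (cases "0 \<le> a")
        case True
        then have "(G / real n) powr a \<le> m powr a" using g m_pos Gpos by (intro powr_mono2) auto
        then show ?thesis by (simp add: add_increasing)
      next
        case False
        then have "(G / real n) powr a \<le> (m / 2) powr a" using g m_pos by (intro powr_mono2') auto
        then show ?thesis by (simp add: add_increasing2)
      qed
      then show "exp xx * (G / real n) powr a \<le> CF" unfolding CF_def by (intro mult_left_mono) auto
      define D where "D = 2 * c - G"
      have D: "0 \<le> D" "D \<le> min c (max 0 p) + max 0 q"
        using G eq mn by (auto simp: D_def G_def)
      have "(2 * c) powr b - G powr b \<le> b * G powr (b - 1) * D"
        unfolding D_def using powr_diff_le[of G "2 * c" b] Gpos G b_pos b_less by simp
      also have "\<dots> \<le> b * c powr (b - 1) * D"
        using G c b_pos b_less D by (intro mult_right_mono mult_left_mono powr_mono2') auto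
      also have "\<dots> \<le> b * c powr (b - 1) * (min c (max 0 p) + max 0 q)"
        using b_pos D by (intro mult_left_mono) auto
      also have "\<dots> = b * (c powr (b - 1) * min c (max 0 p)) + b * c powr (b - 1) * max 0 q"
        by (simp add: algebra_simps)
      \<comment> \<open>The truncation at \<open>c\<close> is available because the shortfall never
        exceeds \<open>c\<close>. For \<open>u\<close> at most \<open>c\<close>, the slope at
        \<open>c\<close> is at most the slope at \<open>u\<close>.\<close>
      also have "c powr (b - 1) * min c (max 0 p) \<le> (max 0 p) powr b"
      proof (cases "p \<le> 0")
        case True
        then show ?thesis using c by simp
      next
        case False
        define u where "u = min c p"
        have u: "0 < u" "u \<le> c" "u \<le> p" using False c by (auto simp: u_def)
        have "c powr (b - 1) * u \<le> u powr (b - 1) * u"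
          using u b_less by (intro mult_right_mono powr_mono2') auto
        also have "\<dots> = u powr b" using u by (simp add: powr_diff)
        also have "\<dots> \<le> p powr b" using u b_pos by (intro powr_mono2) auto
        finally show ?thesis using False by (simp add: u_def)
      qed
      finally have "(2 * c) powr b - G powr b \<le> b * (max 0 p) powr b + b * c powr (b - 1) * max 0 q"
        using b_pos by simp
      from mult_left_mono[OF this, of lam]
      have "lam * ((2 * c) powr b - G powr b) \<le> lam * b * (max 0 p) powr b + slope_lo n * max 0 q"
        using lam_pos by (simp add: slope_lo_def c_def algebra_simps)
      then have "exp (lam * ((2 * c) powr b - G powr b)) \<le> exp (lam * b * (max 0 p) powr b + slope_lo n * max 0 q)"
        by simp
      also have "\<dots> = exp (lam * b * (max 0 p) powr b) * exp (slope_lo n * max 0 q)" by (simp add: exp_add)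
      also have "\<dots> \<le> exp (lam * b * (max 0 p) powr b) * (1 + exp (slope_lo n * q))"
        by (intro mult_left_mono) (auto simp: max_def)
      finally show "exp (lam * ((2 * c) powr b - G powr b)) \<le> exp (lam * b * (max 0 p) powr b) * (1 + exp (slope_lo n * q))" .
    qed (use CFp in auto)
    finally have "exp (level xx n) * F G \<le> CF * (exp (lam * b * (max 0 p) powr b) * (1 + exp (slope_lo n * q)))" .
    moreover have "exp (level xx n) * F t \<le> exp (level xx n) * F G"
      by (intro mult_left_mono FG) auto
    ultimately show ?thesis by linarith
  qed
  show ?thesis by (rule that[OF CFp, of n0], simp add: n0_def, rule main)
qed

text \<open>Here \<open>v\<close> is the position before a displacement that is followed by
  \<open>j\<close> generations. The exponent on the right is, up to the level, the lag of
  \<open>v\<close> behind the position expected from the drift. The decay in \<open>j\<close> is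
  what confines the displacement to the last generations.\<close>

definition jump_bound :: "real \<Rightarrow> real \<Rightarrow> nat \<Rightarrow> bool" where
  "jump_bound CJ xx n \<longleftrightarrow> (\<forall>j v.
    (\<integral>\<^sup>+x. ennreal (exp (level xx n) * tilt j (v - level xx n + x)) * indicator {..< - (m * real n / 2)} x \<partial>R)
    \<le> ennreal (CJ / (1 + m * real j)\<^sup>2 * (1 + exp (slope_lo n * (m * (real n - real j) + level xx n - v)))))"

text \<open>On the range of big displacements the law of the step has a density, which times
  \<open>exp (level xx n)\<close> is bounded by \<open>F_level_le\<close> with
  \<open>p = m * j + w\<close>, where \<open>w\<close> is the landing point relative to the level.
  \<open>tilt_weighted\<close> then pays for the cost in \<open>p\<close> and leaves a Cauchy
  density in \<open>w\<close>.\<close>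

lemma big_jump:
  obtains CJ n0 where "0 < CJ" "1 \<le> n0" "\<And>n. n0 \<le> n \<Longrightarrow> jump_bound CJ xx n"
proof -
  obtain CF n1 where CF: "0 < CF" "1 \<le> n1"
    "\<And>n t p q. n1 \<le> n \<Longrightarrow> m * real n / 2 \<le> t \<Longrightarrow> m * real n - t = p + q \<Longrightarrow>
      exp (level xx n) * F t \<le> CF * (exp (lam * b * (max 0 p) powr b) * (1 + exp (slope_lo n * q)))"
    using F_level_le by blast
  obtain CB where CB: "0 < CB"
    "\<And>j w. tilt j w * exp (lam * b * (max 0 (m * real j + w)) powr b) \<le> CB / (1 + m * real j)\<^sup>2 * (1 / (1 + w\<^sup>2))"
    using tilt_weighted by blast
  \<comment> \<open>Beyond this index \<open>- m * n / 2\<close> lies left of \<open>x0\<close>, in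
    the region of the known density.\<close>
  obtain n2 :: nat where n2: "2 * (- x0) / m \<le> real n2" using real_arch_simple by blast
  define n0 where "n0 = max n1 n2"
  define I where "I = (\<integral>w. 1 / (1 + w\<^sup>2) \<partial>lborel :: real)"
  have I: "0 \<le> I" unfolding I_def by (intro integral_nonneg_AE) auto
  define CJ where "CJ = (l_bd * CF * CB) * I + 1"
  have CJ: "0 < CJ" using l_bd_nonneg CF CB I by (simp add: CJ_def add_nonneg_pos)
  have main: "(\<integral>\<^sup>+x. ennreal (exp (level xx n) * tilt j (v - level xx n + x)) * indicator {..< - (m * real n / 2)} x \<partial>R)
      \<le> ennreal (CJ / (1 + m * real j)\<^sup>2 * (1 + exp (slope_lo n * (m * (real n - real j) + level xx n - v))))"
    if n: "n0 \<le> n" for n j v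
  proof -
    define y where "y = level xx n"
    define c where "c = m * real n / 2"
    define q where "q = m * (real n - real j) + y - v"
    have n': "n1 \<le> n" "2 * (- x0) / m \<le> real n" using n n2 by (auto simp: n0_def)
    have c: "- x0 \<le> c" using n' m_pos by (simp add: c_def field_simps)
    define g where "g x = ennreal (exp y * tilt j (v - y + x)) * indicator {..< - c} x" for x
    have [measurable]: "g \<in> borel_measurable borel" unfolding g_def by measurable
    define B where "B = l_bd * CF * (1 + exp (slope_lo n * q)) * (CB / (1 + m * real j)\<^sup>2)"
    have B: "0 \<le> B" unfolding B_def using l_bd_nonneg CF CB by (intro mult_nonneg_nonneg) auto
    have "(\<integral>\<^sup>+x. g x \<partial>R) = (\<integral>\<^sup>+x. indicator {..x0} x * g x \<partial>R)"
      using c by (intro nn_integral_cong) (auto simp: g_def split: split_indicator)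
    also have "\<dots> = (\<integral>\<^sup>+x. ennreal (indicator {..x0} x * (l x * F (- x))) * g x \<partial>lborel)"
      by (rule R_left_nn_integral) measurable
    also have "\<dots> \<le> (\<integral>\<^sup>+x. ennreal (B * (1 / (1 + (v - y + 1 * x)\<^sup>2))) \<partial>lborel)"
    proof (rule nn_integral_mono)
      fix x
      show "ennreal (indicator {..x0} x * (l x * F (- x))) * g x \<le> ennreal (B * (1 / (1 + (v - y + 1 * x)\<^sup>2)))"
      proof (cases "x < - c")
        case True
        have x0: "x \<le> x0" using True c by simp
        define w where "w = v - y + x"
        have e: "exp y * F (- x) \<le> CF * (exp (lam * b * (max 0 (m * real j + w)) powr b) * (1 + exp (slope_lo n * q)))"
          unfolding y_def by (rule CF(3)[OF n'(1)]) (use True in \<open>auto simp: c_def w_def q_def y_def algebra_simps\<close>)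
        have "(l x * F (- x)) * (exp y * tilt j w) = l x * (tilt j w * (exp y * F (- x)))" by simp
        also have "\<dots> \<le> l_bd * (tilt j w * (CF * (exp (lam * b * (max 0 (m * real j + w)) powr b) * (1 + exp (slope_lo n * q)))))"
          using tilt_nonneg F_nonneg
          by (intro mult_mono[OF l_le[OF x0] mult_left_mono[OF e] l_bd_nonneg]) auto
        also have "\<dots> = l_bd * CF * (1 + exp (slope_lo n * q)) * (tilt j w * exp (lam * b * (max 0 (m * real j + w)) powr b))"
          by (simp add: mult_ac)
        also have "\<dots> \<le> l_bd * CF * (1 + exp (slope_lo n * q)) * (CB / (1 + m * real j)\<^sup>2 * (1 / (1 + w\<^sup>2)))"
          using l_bd_nonneg CF by (intro mult_left_mono CB) auto
        also have "\<dots> = B * (1 / (1 + (v - y + 1 * x)\<^sup>2))" by (simp add: B_def w_def)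
        finally have "(l x * F (- x)) * (exp y * tilt j w) \<le> B * (1 / (1 + (v - y + 1 * x)\<^sup>2))" .
        then show ?thesis
          using True x0 l_nonneg F_nonneg tilt_nonneg
          by (simp add: g_def w_def ennreal_mult'[symmetric] ennreal_leI)
      qed (simp add: g_def)
    qed
    also have "\<dots> = (\<integral>\<^sup>+x. ennreal (B * (1 / (1 + x\<^sup>2))) \<partial>lborel)"
      by (subst nn_integral_real_affine[where c=1 and t="v - y", of "\<lambda>x. ennreal (B * (1 / (1 + x\<^sup>2)))"]) auto
    also have "\<dots> = ennreal (\<integral>x. B * (1 / (1 + x\<^sup>2)) \<partial>lborel)"
      using B by (intro nn_integral_eq_integral integrable_mult_right integrable_cauchy) auto
    also have "(\<integral>x. B * (1 / (1 + x\<^sup>2)) \<partial>lborel) = B * I"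
      unfolding I_def by (rule Bochner_Integration.integral_mult_right_zero)
    also have "B * I = (l_bd * CF * CB * I) / (1 + m * real j)\<^sup>2 * (1 + exp (slope_lo n * q))"
      by (simp add: B_def)
    also have "ennreal \<dots> \<le> ennreal (CJ / (1 + m * real j)\<^sup>2 * (1 + exp (slope_lo n * q)))"
      by (intro ennreal_leI mult_right_mono divide_right_mono) (auto simp: CJ_def)
    finally show ?thesis by (simp add: g_def y_def c_def q_def)
  qed
  have "1 \<le> n0" using CF(2) by (simp add: n0_def)
  moreover have "jump_bound CJ xx n" if "n0 \<le> n" for n
    unfolding jump_bound_def by (intro allI main[OF that])
  ultimately show ?thesis by (rule that[OF CJ])
qed

text \<open>\<open>g'\<close> dominates the one step expectation of \<open>g\<close> over steps that are at least \<open>-L\<close>.\<close>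

definition propagates :: "real \<Rightarrow> (real \<Rightarrow> real) \<Rightarrow> (real \<Rightarrow> real) \<Rightarrow> bool" where
  "propagates L g g' \<longleftrightarrow> g \<in> borel_measurable borel \<and> (\<forall>v. 0 \<le> g v) \<and> (\<forall>v. 0 \<le> g' v) \<and>
    (\<forall>v. (\<integral>\<^sup>+x. ennreal (g (v + x)) * indicator {- L..} x \<partial>R) \<le> ennreal (g' v))"

lemma propagates_const: "0 \<le> c \<Longrightarrow> propagates L (\<lambda>_. c) (\<lambda>_. c)"
proof -
  assume "0 \<le> c"
  moreover have "(\<integral>\<^sup>+x. ennreal c * indicator {- L..} x \<partial>R) \<le> (\<integral>\<^sup>+x. ennreal c \<partial>R)"
    by (intro nn_integral_mono) (auto split: split_indicator)
  moreover have "(\<integral>\<^sup>+x. ennreal c \<partial>R) = ennreal c" using R.emeasure_space_1 by simp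
  ultimately show ?thesis by (simp add: propagates_def)
qed

lemma propagates_exp:
  assumes "0 \<le> s" "0 \<le> L" "s * L powr (1 - b) \<le> 9 / 10 * lam"
  shows "propagates L (\<lambda>v. exp (s * (c - v))) (\<lambda>v. exp (s * (c - v)) * exp (- (s * m) + Kq * s\<^sup>2))"
proof -
  have "(\<integral>\<^sup>+x. ennreal (exp (s * (c - (v + x)))) * indicator {- L..} x \<partial>R)
    \<le> ennreal (exp (s * (c - v)) * exp (- (s * m) + Kq * s\<^sup>2))" for v
  proof -
    have "(\<integral>\<^sup>+x. ennreal (exp (s * (c - (v + x)))) * indicator {- L..} x \<partial>R)
      = (\<integral>\<^sup>+x. ennreal (exp (s * (c - v))) * ennreal (exp (- (s * x)) * indicator {- L..} x) \<partial>R)"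
      by (intro nn_integral_cong)
        (auto simp: ennreal_mult'[symmetric] exp_add[symmetric] algebra_simps split: split_indicator)
    also have "\<dots> = ennreal (exp (s * (c - v))) * (\<integral>\<^sup>+x. ennreal (exp (- (s * x)) * indicator {- L..} x) \<partial>R)"
      by (rule nn_integral_cmult) measurable
    also have "\<dots> \<le> ennreal (exp (s * (c - v))) * ennreal (exp (- (s * m) + Kq * s\<^sup>2))"
      by (intro mult_left_mono trunc_exp assms) auto
    finally show ?thesis by (simp add: ennreal_mult')
  qed
  then show ?thesis unfolding propagates_def by auto
qed

definition sigma2 :: real where "sigma2 = (\<integral>x. (x - m)\<^sup>2 \<partial>R)"

lemma square_step: "integrable R (\<lambda>x. (v + x - c)\<^sup>2)" "(\<integral>x. (v + x - c)\<^sup>2 \<partial>R) = (v + m - c)\<^sup>2 + sigma2"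
proof -
  have i: "integrable R (\<lambda>x. (x - m)\<^sup>2)"
    using R_square_int R_int by (simp add: power2_diff)
  have eq: "(\<lambda>x. (v + x - c)\<^sup>2) = (\<lambda>x. (x - m)\<^sup>2 + 2 * (v + m - c) * (x - m) + (v + m - c)\<^sup>2)"
    by (auto simp: power2_eq_square algebra_simps)
  show "integrable R (\<lambda>x. (v + x - c)\<^sup>2)"
    unfolding eq using i R_int by simp
  have j: "integrable R (\<lambda>x. 2 * (v + m - c) * (x - m))" using R_int by simp
  have k: "(\<integral>x. 2 * (v + m - c) * (x - m) \<partial>R) = 0"
    using R_int by (subst integral_mult_right_zero, subst Bochner_Integration.integral_diff) (simp_all add: R_mean)
  show "(\<integral>x. (v + x - c)\<^sup>2 \<partial>R) = (v + m - c)\<^sup>2 + sigma2"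
    unfolding eq using i j k by (simp add: sigma2_def)
qed

lemma sigma2_nonneg: "0 \<le> sigma2"
  unfolding sigma2_def by (intro integral_nonneg_AE) auto

lemma propagates_square: "propagates L (\<lambda>v. (v - c)\<^sup>2) (\<lambda>v. (v + m - c)\<^sup>2 + sigma2)"
proof -
  have "(\<integral>\<^sup>+x. ennreal ((v + x - c)\<^sup>2) * indicator {- L..} x \<partial>R) \<le> ennreal ((v + m - c)\<^sup>2 + sigma2)" for v
  proof -
    have "(\<integral>\<^sup>+x. ennreal ((v + x - c)\<^sup>2) * indicator {- L..} x \<partial>R) \<le> (\<integral>\<^sup>+x. ennreal ((v + x - c)\<^sup>2) \<partial>R)"
      by (intro nn_integral_mono) (auto split: split_indicator)
    also have "\<dots> = ennreal ((v + m - c)\<^sup>2 + sigma2)"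
      using square_step[of v c] by (subst nn_integral_eq_integral) auto
    finally show ?thesis .
  qed
  then show ?thesis unfolding propagates_def using sigma2_nonneg by auto
qed

lemma propagates_add:
  assumes "propagates L g g'" "propagates L h h'" shows "propagates L (\<lambda>v. g v + h v) (\<lambda>v. g' v + h' v)"
proof -
  have [measurable]: "g \<in> borel_measurable borel" "h \<in> borel_measurable borel"
    using assms by (auto simp: propagates_def)
  have "(\<integral>\<^sup>+x. ennreal (g (v + x) + h (v + x)) * indicator {- L..} x \<partial>R)
    = (\<integral>\<^sup>+x. ennreal (g (v + x)) * indicator {- L..} x \<partial>R) + (\<integral>\<^sup>+x. ennreal (h (v + x)) * indicator {- L..} x \<partial>R)" for v
    using assms by (subst nn_integral_add[symmetric]) (auto simp: propagates_def distrib_right)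
  then show ?thesis
    using assms by (auto simp: propagates_def intro!: add_mono)
qed

lemma propagates_cmult:
  assumes "propagates L g g'" "0 \<le> c" shows "propagates L (\<lambda>v. c * g v) (\<lambda>v. c * g' v)"
proof -
  have [measurable]: "g \<in> borel_measurable borel"
    using assms by (auto simp: propagates_def)
  have "(\<integral>\<^sup>+x. ennreal (c * g (v + x)) * indicator {- L..} x \<partial>R)
    = ennreal c * (\<integral>\<^sup>+x. ennreal (g (v + x)) * indicator {- L..} x \<partial>R)" for v
    using assms by (subst nn_integral_cmult[symmetric]) (auto simp: propagates_def ennreal_mult' mult.assoc)
  then show ?thesis
    using assms by (auto simp: propagates_def ennreal_mult' intro!: mult_left_mono)
qed

lemma propagates_mono:
  assumes "propagates L g g'" "\<And>v. g' v \<le> h v" shows "propagates L g h"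
  unfolding propagates_def
proof (intro conjI allI)
  show "0 \<le> h v" for v using assms by (auto simp: propagates_def intro: order_trans)
  show "(\<integral>\<^sup>+x. ennreal (g (v + x)) * indicator {- L..} x \<partial>R) \<le> ennreal (h v)" for v
    using assms(1) ennreal_leI[OF assms(2)] by (auto simp: propagates_def intro: order_trans)
qed (use assms in \<open>auto simp: propagates_def\<close>)

text \<open>Steps at least \<open>- L\<close> are charged to the dominating function
  \<open>g\<close>. Below \<open>- L\<close> the subtracted target is dropped, and the whole
  remaining hitting probability of \<open>q\<close> is charged to \<open>B\<close>.\<close>

lemma one_step:
  assumes q: "target q" and r: "target r" and rq: "\<And>x. r x \<le> q x"
    and g: "propagates L g g'" and qr: "\<And>x. exp x * (q x - r x) \<le> g x"
    and B: "(\<integral>\<^sup>+x. ennreal (exp (v + x) * q (v + x)) * indicator {..< - L} x \<partial>R) \<le> ennreal B" and B0: "0 \<le> B"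
  shows "exp v * (gam (\<integral>y. q (v + y) \<partial>mu) - gam (\<integral>y. r (v + y) \<partial>mu)) \<le> g' v + B"
proof -
  note [measurable] = targetD(1)[OF q] targetD(1)[OF r]
  have [measurable]: "g \<in> borel_measurable borel" using g by (simp add: propagates_def)
  have g0: "0 \<le> g x" "0 \<le> g' x" for x using g by (auto simp: propagates_def)
  have "ennreal (exp v * (gam (\<integral>y. q (v + y) \<partial>mu) - gam (\<integral>y. r (v + y) \<partial>mu)))
    \<le> (\<integral>\<^sup>+x. ennreal (g (v + x)) * indicator {- L..} x + ennreal (exp (v + x) * q (v + x)) * indicator {..< - L} x \<partial>R)"
  proof (rule step_le[OF q r rq])
    fix x
    show "ennreal (exp (v + x) * (q (v + x) - r (v + x)))
      \<le> ennreal (g (v + x)) * indicator {- L..} x + ennreal (exp (v + x) * q (v + x)) * indicator {..< - L} x"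
      using qr[of "v + x"] targetD(2)[OF r, of "v + x"]
      by (auto split: split_indicator intro!: ennreal_leI)
  qed
  also have "\<dots> = (\<integral>\<^sup>+x. ennreal (g (v + x)) * indicator {- L..} x \<partial>R) + (\<integral>\<^sup>+x. ennreal (exp (v + x) * q (v + x)) * indicator {..< - L} x \<partial>R)"
    by (rule nn_integral_add) measurable
  also have "\<dots> \<le> ennreal (g' v) + ennreal B"
    using g by (intro add_mono B) (auto simp: propagates_def)
  also have "\<dots> = ennreal (g' v + B)" using g0 B0 by simp
  finally show ?thesis using g0 B0 by (subst (asm) ennreal_le_iff) auto
qed

text \<open>Total price of displacements followed by \<open>J\<close>, ..., \<open>J + i - 1\<close>
  generations.\<close>

definition jump_sum :: "real \<Rightarrow> nat \<Rightarrow> nat \<Rightarrow> real" where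
  "jump_sum CJ J i = (\<Sum>k<i. CJ / (1 + m * real (J + k))\<^sup>2)"

lemma target_shift:
  assumes "target \<theta>" shows "target (\<lambda>x. \<theta> (x + c))"
proof -
  note [measurable] = targetD(1)[OF assms]
  have "(\<lambda>x. \<theta> (x + c)) \<in> borel_measurable borel" by measurable
  then show ?thesis using targetD(2,3)[OF assms] by (simp add: target_def)
qed

text \<open>At the first displacement below \<open>-mn/2\<close> the bound switches from the linear
  recursion to the probability that the remaining subtree reaches the level. This is what removes
  the factor \<open>n\<close> of a plain first moment bound.\<close>

lemma supersolution:
  assumes CJ: "0 < CJ" and n: "1 \<le> n"
    and jump: "jump_bound CJ xx n"
    and tup: "tup = hit (\<lambda>x. chi0 (x + - level xx n)) J" and tlo: "target tlo" "\<And>v. tlo v \<le> tup v"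
    and G: "\<And>i. propagates (m * real n / 2) (G i) (G (Suc i))" and G0: "\<And>v. exp v * (tup v - tlo v) \<le> G 0 v"
  shows "exp v * (hit tup i v - hit tlo i v) \<le>
    exp (Kq * (slope_lo n)\<^sup>2 * real i) * jump_sum CJ J i * (1 + exp (slope_lo n * ((m * (real n - real J - real i + 1) + level xx n) - v))) + G i v"
proof (induction i arbitrary: v)
  case 0
  then show ?case using G0 by (simp add: jump_sum_def)
next
  case (Suc i)
  let ?y = "level xx n" and ?L = "m * real n / 2" and ?d = "slope_lo n"
  have tc: "target (\<lambda>x. chi0 (x + - ?y))"
    by (rule target_shift[OF target_chi0])
  have Tup: "target tup" unfolding tup by (rule target_hit[OF tc])
  have L: "0 \<le> ?L" "0 < ?L" using m_pos n by auto
  \<comment> \<open>At the truncation \<open>m * n / 2\<close> the slope \<open>slope_lo n\<close>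
    corresponds exactly to the rate \<open>lam * b\<close>, below 9/10.\<close>
  have dL: "?d * ?L powr (1 - b) \<le> 9 / 10 * lam"
  proof -
    have "?d * ?L powr (1 - b) = lam * b * (?L powr ((b - 1) + (1 - b)))" by (simp only: slope_lo_def powr_add mult.assoc)
    also have "(b - 1) + (1 - b) = 0" by simp
    also have "lam * b * ?L powr 0 = lam * b" using m_pos n by simp
    also have "\<dots> \<le> lam * (9 / 10)" using lam_pos b_less by (intro mult_left_mono) auto
    finally show ?thesis by simp
  qed
  define S where "S = jump_sum CJ J i"
  have S: "0 \<le> S" unfolding S_def jump_sum_def using CJ by (intro sum_nonneg) auto
  define D where "D t v = 1 + exp (?d * ((m * t + ?y) - v))" for t v
  have D1: "1 \<le> D t v" for t v by (simp add: D_def)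
  define t where "t = real n - real J - real i"
  \<comment> \<open>The drift of one moderate step accounts for the passage from
    \<open>t + 1\<close> to \<open>t\<close>. What remains is the second-order error, accumulated in
    the factor \<open>exp (Kq * ?d\<^sup>2 * real i)\<close>.\<close>
  have pd: "propagates ?L (D (t + 1)) (\<lambda>v. exp (Kq * ?d\<^sup>2) * D t v)"
  proof (rule propagates_mono)
    show "propagates ?L (D (t + 1)) (\<lambda>v. 1 + exp (?d * ((m * (t + 1) + ?y) - v)) * exp (- (?d * m) + Kq * ?d\<^sup>2))"
      unfolding D_def[abs_def] by (intro propagates_add propagates_const propagates_exp slope_lo_nonneg L dL) auto
    fix v
    have "exp (?d * ((m * (t + 1) + ?y) - v)) * exp (- (?d * m) + Kq * ?d\<^sup>2) = exp (Kq * ?d\<^sup>2) * exp (?d * ((m * t + ?y) - v))"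
      by (simp add: exp_add[symmetric] algebra_simps)
    moreover have "1 \<le> exp (Kq * ?d\<^sup>2)" using Kq_nonneg by simp
    ultimately show "1 + exp (?d * ((m * (t + 1) + ?y) - v)) * exp (- (?d * m) + Kq * ?d\<^sup>2) \<le> exp (Kq * ?d\<^sup>2) * D t v"
      by (simp add: D_def distrib_left)
  qed
  have P: "propagates ?L (\<lambda>v. exp (Kq * ?d\<^sup>2 * real i) * S * D (t + 1) v + G i v)
      (\<lambda>v. exp (Kq * ?d\<^sup>2 * real i) * S * (exp (Kq * ?d\<^sup>2) * D t v) + G (Suc i) v)"
    using S by (intro propagates_add propagates_cmult pd G) auto
  define B where "B = CJ / (1 + m * real (J + i))\<^sup>2 * D t v"
  have B0: "0 \<le> B" unfolding B_def using CJ D1[of t v] by (intro mult_nonneg_nonneg) auto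
  have hit1: "hit tup i x = hit chi0 (J + i) (x - ?y)" for x
    unfolding tup hit_add hit_shift add.commute[of i J] by simp
  have le1: "exp v * (gam (\<integral>y. hit tup i (v + y) \<partial>mu) - gam (\<integral>y. hit tlo i (v + y) \<partial>mu))
    \<le> (exp (Kq * ?d\<^sup>2 * real i) * S * (exp (Kq * ?d\<^sup>2) * D t v) + G (Suc i) v) + B"
  proof (rule one_step[OF target_hit[OF Tup] target_hit[OF tlo(1)] _ P])
    show "hit tlo i x \<le> hit tup i x" for x by (rule hit_mono[OF tlo(1) Tup tlo(2)])
    show "exp x * (hit tup i x - hit tlo i x) \<le> exp (Kq * ?d\<^sup>2 * real i) * S * D (t + 1) x + G i x" for x
      using Suc[of x] by (simp add: S_def D_def t_def)
    have eq: "(\<integral>\<^sup>+x. ennreal (exp (v + x) * hit tup i (v + x)) * indicator {..< - ?L} x \<partial>R)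
      = (\<integral>\<^sup>+x. ennreal (exp ?y * tilt (J + i) (v - ?y + x)) * indicator {..< - ?L} x \<partial>R)"
    proof (rule nn_integral_cong)
      fix x
      have "v + x - ?y = v - ?y + x" by simp
      moreover have "exp ?y * exp (v - ?y + x) = exp (v + x)" by (simp add: mult_exp_exp)
      ultimately show "ennreal (exp (v + x) * hit tup i (v + x)) * indicator {..< - ?L} x
          = ennreal (exp ?y * tilt (J + i) (v - ?y + x)) * indicator {..< - ?L} x"
        unfolding hit1 tilt_def by (simp only: mult.assoc[symmetric])
    qed
    show "(\<integral>\<^sup>+x. ennreal (exp (v + x) * hit tup i (v + x)) * indicator {..< - ?L} x \<partial>R) \<le> ennreal B"
      unfolding eq using jump[unfolded jump_bound_def, rule_format, of "J + i" v] by (simp add: B_def D_def t_def algebra_simps)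
  qed (rule B0)
  have e: "exp (Kq * ?d\<^sup>2 * real i) * exp (Kq * ?d\<^sup>2) = exp (Kq * ?d\<^sup>2 * real (Suc i))"
    by (simp add: exp_add[symmetric] algebra_simps)
  have "1 * B \<le> exp (Kq * ?d\<^sup>2 * real (Suc i)) * B"
    using Kq_nonneg by (intro mult_right_mono B0) auto
  moreover have "exp (Kq * ?d\<^sup>2 * real i) * S * (exp (Kq * ?d\<^sup>2) * D t v) = exp (Kq * ?d\<^sup>2 * real (Suc i)) * S * D t v"
    unfolding e[symmetric] by simp
  moreover have "exp (Kq * ?d\<^sup>2 * real (Suc i)) * S * D t v + exp (Kq * ?d\<^sup>2 * real (Suc i)) * B
      = exp (Kq * ?d\<^sup>2 * real (Suc i)) * jump_sum CJ J (Suc i) * D t v"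
    by (simp add: S_def B_def jump_sum_def distrib_left distrib_right)
  ultimately have le2: "exp v * (gam (\<integral>y. hit tup i (v + y) \<partial>mu) - gam (\<integral>y. hit tlo i (v + y) \<partial>mu))
    \<le> exp (Kq * ?d\<^sup>2 * real (Suc i)) * jump_sum CJ J (Suc i) * D t v + G (Suc i) v"
    using le1 by linarith
  have tt: "real n - real J - real (Suc i) + 1 = t" by (simp add: t_def)
  show ?case unfolding tt hit.simps using le2 by (simp only: D_def)
qed

section \<open>Losses from early jumps, atypical positions and missing jumps\<close>

definition hit_level :: "real \<Rightarrow> nat \<Rightarrow> nat \<Rightarrow> real \<Rightarrow> real" where
  "hit_level xx n J = hit (\<lambda>x. chi0 (x + - level xx n)) J"

text \<open>The exponent lies strictly between \<open>1/2\<close>, so that the window covers the fluctuations of the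
  walk, and \<open>1 - b\<close>, so that it does not affect \<open>lam * (m * n) powr b\<close>.\<close>

definition window :: "nat \<Rightarrow> real" where
  "window n = real n powr ((3 / 2 - b) / 2)"

definition typical :: "nat \<Rightarrow> nat \<Rightarrow> real \<Rightarrow> bool" where
  "typical n J v \<longleftrightarrow> \<bar>v - m * (real n - real J)\<bar> < window n"

definition hit_typ :: "real \<Rightarrow> nat \<Rightarrow> nat \<Rightarrow> real \<Rightarrow> real" where
  "hit_typ xx n J v = (if typical n J v then hit_level xx n J v else 0)"

text \<open>The factor \<open>5/4\<close> exceeds \<open>1\<close>, which beats \<open>exp (level xx n)\<close>, and is small enough for
  the truncation at \<open>m * n / 2\<close> because \<open>5/4 * 2 powr (b - 1) < 9/10\<close> for \<open>b < 1/2\<close>.\<close>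

definition slope_hi :: "nat \<Rightarrow> real" where
  "slope_hi n = 5 / 4 * lam * (m * real n) powr (b - 1)"

lemma hit_level_eq: "hit_level xx n J v = hit chi0 J (v - level xx n)"
  unfolding hit_level_def hit_shift by simp

lemma target_hit_level: "target (hit_level xx n J)"
  unfolding hit_level_def by (intro target_hit target_shift target_chi0)

lemma target_hit_typ: "target (hit_typ xx n J)"
proof -
  note [measurable] = targetD(1)[OF target_hit_level[of xx n J]]
  have "hit_typ xx n J \<in> borel_measurable borel"
    unfolding hit_typ_def[abs_def] typical_def by measurable
  then show ?thesis
    using targetD(2,3)[OF target_hit_level[of xx n J]] by (simp add: target_def hit_typ_def)
qed

lemma hit_zero: "hit (\<lambda>_. 0) i v = 0"
  by (induction i arbitrary: v) simp_all

lemma half_powr: "0 < n \<Longrightarrow> (m * real n / 2) powr (1 - b) = (m * real n) powr (1 - b) * 2 powr (b - 1)"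
  using m_pos by (simp add: powr_divide powr_minus_divide powr_diff field_simps)

lemma slope_hi_le: "1 \<le> n \<Longrightarrow> slope_hi n * (m * real n / 2) powr (1 - b) \<le> 9 / 10 * lam"
proof -
  assume n: "1 \<le> n"
  \<comment> \<open>The bound 72/100 for the reciprocal of \<open>sqrt 2\<close> is chosen because
    \<open>5 / 4 * (72 / 100)\<close> is exactly 9/10.\<close>
  have "(2::real) powr (b - 1) \<le> 2 powr (- (1 / 2))" using b_less by (intro powr_mono) auto
  also have "\<dots> = 1 / sqrt 2" by (simp add: powr_minus_divide powr_half_sqrt)
  also have "\<dots> \<le> 72 / 100"
  proof -
    have "14 / 10 \<le> sqrt 2" by (rule real_le_rsqrt) (simp add: power2_eq_square)
    then have "1 \<le> 72 / 100 * sqrt 2" by simp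
    then show ?thesis by (simp add: divide_le_eq)
  qed
  finally have h: "2 powr (b - 1) \<le> 72 / 100" .
  have "slope_hi n * (m * real n / 2) powr (1 - b) = 5 / 4 * lam * ((m * real n) powr (b - 1) * (m * real n) powr (1 - b)) * 2 powr (b - 1)"
    using n by (simp add: half_powr slope_hi_def)
  also have "(m * real n) powr (b - 1) * (m * real n) powr (1 - b) = 1"
    using n m_pos by (simp add: powr_add[symmetric])
  also have "5 / 4 * lam * 1 * 2 powr (b - 1) \<le> 5 / 4 * lam * 1 * (72 / 100)"
    using h lam_pos by (intro mult_left_mono) auto
  finally show ?thesis by simp
qed

lemma slope_hi_nonneg: "0 \<le> slope_hi n"
  using lam_pos by (simp add: slope_hi_def)

text \<open>A slope larger than \<open>slope_lo n\<close> by half still fits the truncation, since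
  \<open>3 / 2 * b\<close> is below 3/4. It supplies the higher exponential moment that makes large
  lags negligible in \<open>bad_bound\<close>.\<close>

lemma slope_lo_le: "1 \<le> n \<Longrightarrow> (3 / 2 * slope_lo n) * (m * real n / 2) powr (1 - b) \<le> 9 / 10 * lam"
proof -
  assume n: "1 \<le> n"
  have "(m * real n / 2) powr (b - 1) * (m * real n / 2) powr (1 - b) = 1"
    using n m_pos by (simp add: powr_add[symmetric])
  then have "(3 / 2 * slope_lo n) * (m * real n / 2) powr (1 - b) = 3 / 2 * lam * b"
    by (simp add: slope_lo_def mult.assoc)
  also have "\<dots> = lam * (3 / 2 * b)" by simp
  also have "\<dots> \<le> lam * (9 / 10)" using b_less lam_pos by (intro mult_left_mono) auto
  finally show ?thesis by simp
qed

abbreviation tau :: "real \<Rightarrow> real" where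
  "tau s \<equiv> exp (- (s * m) + Kq * s\<^sup>2)"

text \<open>The three summands are the three ways of losing a hit: a displacement made before the
  last \<open>J\<close> generations, a displacement within them from an atypical position, and no
  big displacement at all. The parameter \<open>k\<close> is free and separates small lags, handled
  by Chebyshev's inequality, from large ones.\<close>

lemma bad_bound:
  assumes CJ: "0 < CJ" and n: "1 \<le> n"
    and jump: "jump_bound CJ xx n"
    and J: "J \<le> n" and k: "1 \<le> k"
  shows "hit_level xx n n 0 - hit (hit_typ xx n J) (n - J) 0 \<le>
    exp (Kq * (slope_lo n)\<^sup>2 * real n) * jump_sum CJ J (n - J) * (1 + exp (slope_lo n * (m + level xx n)))
    + exp (Kq * (slope_lo n)\<^sup>2 * real n) * jump_sum CJ 0 J *
      ((1 + k\<^sup>2) / (window n)\<^sup>2 * (real n * sigma2)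
       + 1 / k * (exp (3 / 2 * slope_lo n * (m + level xx n)) * exp (Kq * (3 / 2 * slope_lo n)\<^sup>2 * real n)))
    + exp (level xx n) * tau (slope_hi n) ^ n * exp (slope_hi n * level xx n)"
proof -
  let ?y = "level xx n" and ?L = "m * real n / 2"
  have L: "0 \<le> ?L" using m_pos by simp
  define t1 where "t1 = hit_level xx n J"
  define t0 where "t0 = hit_typ xx n J"
  have js: "0 \<le> jump_sum CJ i j" for i j unfolding jump_sum_def using CJ by (intro sum_nonneg) auto
  define G1 where "G1 i v = exp ?y * tau (slope_hi n) ^ i * exp (slope_hi n * (?y - v))" for i v
  have G1: "propagates ?L (G1 i) (G1 (Suc i))" for i
  proof -
    have "propagates ?L (\<lambda>v. (exp ?y * tau (slope_hi n) ^ i) * exp (slope_hi n * (?y - v)))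
      (\<lambda>v. (exp ?y * tau (slope_hi n) ^ i) * (exp (slope_hi n * (?y - v)) * tau (slope_hi n)))"
      by (intro propagates_cmult propagates_exp slope_hi_nonneg L slope_hi_le n) auto
    then show ?thesis
      unfolding G1_def[abs_def] by (rule propagates_mono) (simp add: mult_ac)
  qed
  \<comment> \<open>Over the last \<open>J\<close> generations nothing is subtracted, so the
    supersolution bounds the hitting probability itself; its initial value is the indicator of the
    level, bounded by the exponential with slope \<open>slope_hi n\<close>.\<close>
  have "exp v * (hit (hit (\<lambda>x. chi0 (x + - ?y)) 0) J v - hit (\<lambda>_. 0) J v) \<le>
    exp (Kq * (slope_lo n)\<^sup>2 * real J) * jump_sum CJ 0 J * (1 + exp (slope_lo n * ((m * (real n - real 0 - real J + 1) + ?y) - v))) + G1 J v" for v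
  proof (rule supersolution[where tlo="\<lambda>_. 0" and G=G1, OF CJ n jump refl target_zero _ G1])
    show "0 \<le> hit (\<lambda>x. chi0 (x + - ?y)) 0 v" for v by (simp add: chi0_def)
    fix v
    have "v \<le> ?y \<Longrightarrow> 0 \<le> slope_hi n * (?y - v)" using slope_hi_nonneg by simp
    then show "exp v * (hit (\<lambda>x. chi0 (x + - ?y)) 0 v - 0) \<le> G1 0 v"
      by (auto simp: chi0_def G1_def mult_exp_exp split: split_indicator)
  qed
  then have init: "exp v * t1 v \<le> exp (Kq * (slope_lo n)\<^sup>2 * real J) * jump_sum CJ 0 J * (1 + exp (slope_lo n * ((m * (real n - real J + 1) + ?y) - v))) + G1 J v" for v
    by (simp add: hit_zero t1_def hit_level_def)
  define A1 where "A1 = exp (Kq * (slope_lo n)\<^sup>2 * real J) * jump_sum CJ 0 J"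
  have A1: "0 \<le> A1" unfolding A1_def using js by simp
  define Q where "Q = (1 + k\<^sup>2) / (window n)\<^sup>2"
  have Q: "0 \<le> Q" by (simp add: Q_def)
  have wn: "0 < window n" using n by (simp add: window_def)
  define s where "s = 3 / 2 * slope_lo n"
  have s: "0 \<le> s" using slope_lo_nonneg by (simp add: s_def)
  \<comment> \<open>The continuation over the first \<open>n - J\<close> generations. The square
    follows the drift and gains one variance per step, the exponential gains the second-order
    Chernoff error per step, and \<open>G1\<close> goes on unchanged.\<close>
  define G where "G i v = A1 * (Q * ((v - m * (real n - real J - real i))\<^sup>2 + real i * sigma2)
     + 1 / k * (exp (Kq * s\<^sup>2) ^ i * exp (s * ((m * (real n - real J - real i + 1) + ?y) - v)))) + G1 (J + i) v" for i v
  have G: "propagates ?L (G i) (G (Suc i))" for i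
  proof -
    have p1: "propagates ?L (\<lambda>v. (v - m * (real n - real J - real i))\<^sup>2 + real i * sigma2)
      (\<lambda>v. ((v + m - m * (real n - real J - real i))\<^sup>2 + sigma2) + real i * sigma2)"
      using sigma2_nonneg by (intro propagates_add propagates_square propagates_const) auto
    have p2: "propagates ?L (\<lambda>v. exp (s * ((m * (real n - real J - real i + 1) + ?y) - v)))
      (\<lambda>v. exp (s * ((m * (real n - real J - real i + 1) + ?y) - v)) * tau s)"
      unfolding s_def by (intro propagates_exp L slope_lo_le n mult_nonneg_nonneg slope_lo_nonneg) auto
    have "propagates ?L (G i) (\<lambda>v. A1 * (Q * (((v + m - m * (real n - real J - real i))\<^sup>2 + sigma2) + real i * sigma2)
     + 1 / k * (exp (Kq * s\<^sup>2) ^ i * (exp (s * ((m * (real n - real J - real i + 1) + ?y) - v)) * tau s))) + G1 (Suc (J + i)) v)"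
      unfolding G_def[abs_def] using k by (intro propagates_add propagates_cmult p1 p2 G1 A1 Q) auto
    then show ?thesis
    proof (rule propagates_mono)
      fix v
      have "(v + m - m * (real n - real J - real i))\<^sup>2 = (v - m * (real n - real J - real (Suc i)))\<^sup>2"
        by (simp add: algebra_simps)
      moreover have "exp (Kq * s\<^sup>2) ^ i * (exp (s * ((m * (real n - real J - real i + 1) + ?y) - v)) * tau s)
          = exp (Kq * s\<^sup>2) ^ Suc i * exp (s * ((m * (real n - real J - real (Suc i) + 1) + ?y) - v))"
      proof -
        have "exp (s * ((m * (real n - real J - real i + 1) + ?y) - v)) * tau s
          = exp (Kq * s\<^sup>2) * exp (s * ((m * (real n - real J - real (Suc i) + 1) + ?y) - v))"
          by (simp add: exp_add[symmetric] algebra_simps)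
        then show ?thesis by simp
      qed
      moreover have "(z + sigma2) + real i * sigma2 = z + real (Suc i) * sigma2" for z
        by (simp add: algebra_simps)
      ultimately show "A1 * (Q * (((v + m - m * (real n - real J - real i))\<^sup>2 + sigma2) + real i * sigma2)
     + 1 / k * (exp (Kq * s\<^sup>2) ^ i * (exp (s * ((m * (real n - real J - real i + 1) + ?y) - v)) * tau s))) + G1 (Suc (J + i)) v \<le> G (Suc i) v"
        unfolding G_def by (simp only: add_Suc_right order_refl)
    qed
  qed
  have G0: "exp v * (t1 v - t0 v) \<le> G 0 v" for v
  proof (cases "typical n J v")
    case True
    then have "t1 v - t0 v = 0" by (simp add: t1_def t0_def hit_typ_def)
    moreover have "0 \<le> G 0 v" using G[of 0] by (simp add: propagates_def)
    ultimately show ?thesis by simp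
  next
    case False
    define u where "u = v - m * (real n - real J)"
    have "window n \<le> \<bar>u\<bar>" using False by (simp add: typical_def u_def)
    then have "(window n)\<^sup>2 \<le> u\<^sup>2" using wn by (metis abs_le_square_iff abs_of_pos)
    then have one: "1 \<le> u\<^sup>2 / (window n)\<^sup>2" using wn by (simp add: le_divide_eq)
    define B where "B = slope_lo n * ((m * (real n - real J + 1) + ?y) - v)"
    define z where "z = (1 + k\<^sup>2) * (u\<^sup>2 / (window n)\<^sup>2)"
    define z' where "z' = 1 / k * exp (3 / 2 * B)"
    have z: "1 + k\<^sup>2 \<le> z" "1 \<le> z" "0 \<le> z'"
    proof -
      have "(1 + k\<^sup>2) * 1 \<le> z" unfolding z_def by (intro mult_left_mono one) auto
      then show "1 + k\<^sup>2 \<le> z" by simp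
      then show "1 \<le> z" using zero_le_power2[of k] by linarith
      show "0 \<le> z'" using k by (simp add: z'_def)
    qed
    \<comment> \<open>A lag factor of at most \<open>k\<^sup>2\<close> is multiplied by the
      Chebyshev quotient. A larger one has square root at least \<open>k\<close>, so it is dominated
      by \<open>1 / k\<close> times its power with exponent 3/2.\<close>
    have "1 + exp B \<le> z + z'"
    proof (cases "exp B \<le> k\<^sup>2")
      case True
      then show ?thesis using z by linarith
    next
      case False
      have "(exp (B / 2))\<^sup>2 = exp B" by (simp add: power2_eq_square mult_exp_exp)
      then have "k \<le> exp (B / 2)" using False k by (metis exp_ge_zero linorder_le_cases power2_le_imp_le)
      then have "exp B * k \<le> exp B * exp (B / 2)" by (intro mult_left_mono) auto
      also have "\<dots> = exp (3 / 2 * B)" by (simp add: mult_exp_exp)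
      finally have "exp B \<le> z'" using k by (simp add: z'_def field_simps)
      then show ?thesis using z by linarith
    qed
    then have "1 + exp B \<le> (1 + k\<^sup>2) * (u\<^sup>2 / (window n)\<^sup>2) + 1 / k * exp (3 / 2 * B)"
      unfolding z_def z'_def .
    from mult_left_mono[OF this A1]
    have "A1 * (1 + exp B) + G1 J v \<le> G 0 v"
      by (simp add: G_def Q_def u_def B_def s_def mult.assoc)
    moreover have "exp v * (t1 v - t0 v) \<le> A1 * (1 + exp B) + G1 J v"
      using init[of v] False by (simp add: t0_def hit_typ_def A1_def B_def)
    ultimately show ?thesis by linarith
  qed
  define i where "i = n - J"
  have i: "real n - real J - real i = 0" "J + i = n" "real i \<le> real n" using J by (auto simp: i_def)
  have t01: "t0 v \<le> t1 v" for v
    using targetD(2)[OF target_hit_level[of xx n J]] by (simp add: t0_def t1_def hit_typ_def)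
  have "exp 0 * (hit t1 i 0 - hit t0 i 0) \<le>
    exp (Kq * (slope_lo n)\<^sup>2 * real i) * jump_sum CJ J i * (1 + exp (slope_lo n * ((m * (real n - real J - real i + 1) + ?y) - 0))) + G i 0"
    by (rule supersolution[where tup=t1 and tlo=t0 and G=G, OF CJ n jump _ _ t01 G G0])
      (use target_hit_typ in \<open>simp_all add: t1_def t0_def hit_level_def\<close>)
  then have main: "hit t1 i 0 - hit t0 i 0 \<le> exp (Kq * (slope_lo n)\<^sup>2 * real i) * jump_sum CJ J i * (1 + exp (slope_lo n * (m + ?y))) + G i 0"
    unfolding i(1) by simp
  have h1: "hit t1 i 0 = hit_level xx n n 0"
    unfolding t1_def hit_level_def hit_add using i(2) by (simp add: add.commute)
  have e1: "exp (Kq * (slope_lo n)\<^sup>2 * real j) \<le> exp (Kq * (slope_lo n)\<^sup>2 * real n)" if "j \<le> n" for j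
    using Kq_nonneg that by (simp add: mult_left_mono)
  have a1: "exp (Kq * (slope_lo n)\<^sup>2 * real i) * jump_sum CJ J i * (1 + exp (slope_lo n * (m + ?y)))
    \<le> exp (Kq * (slope_lo n)\<^sup>2 * real n) * jump_sum CJ J i * (1 + exp (slope_lo n * (m + ?y)))"
    using js e1[of i] i(2) by (intro mult_right_mono) (auto simp: add_nonneg_nonneg)
  have a2: "G i 0 \<le> exp (Kq * (slope_lo n)\<^sup>2 * real n) * jump_sum CJ 0 J *
      ((1 + k\<^sup>2) / (window n)\<^sup>2 * (real n * sigma2)
       + 1 / k * (exp (3 / 2 * slope_lo n * (m + ?y)) * exp (Kq * (3 / 2 * slope_lo n)\<^sup>2 * real n)))
    + exp ?y * tau (slope_hi n) ^ n * exp (slope_hi n * ?y)"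
  proof -
    have "G i 0 = A1 * (Q * (real i * sigma2) + 1 / k * (exp (Kq * s\<^sup>2) ^ i * exp (s * (m + ?y)))) + G1 n 0"
      unfolding G_def i(1) i(2) by simp
    also have "\<dots> \<le> (exp (Kq * (slope_lo n)\<^sup>2 * real n) * jump_sum CJ 0 J) * (Q * (real n * sigma2) + 1 / k * (exp (s * (m + ?y)) * exp (Kq * s\<^sup>2 * real n))) + G1 n 0"
    proof (rule add_right_mono, rule mult_mono)
      show "A1 \<le> exp (Kq * (slope_lo n)\<^sup>2 * real n) * jump_sum CJ 0 J"
        unfolding A1_def using js e1[OF J] by (intro mult_right_mono) auto
      have "exp (Kq * s\<^sup>2) ^ i = exp (Kq * s\<^sup>2 * real i)" by (simp add: exp_of_nat_mult[symmetric] mult.commute)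
      also have "\<dots> \<le> exp (Kq * s\<^sup>2 * real n)" using Kq_nonneg i by (simp add: mult_left_mono)
      finally have "exp (Kq * s\<^sup>2) ^ i * exp (s * (m + ?y)) \<le> exp (s * (m + ?y)) * exp (Kq * s\<^sup>2 * real n)"
        by (simp add: mult.commute)
      then have "1 / k * (exp (Kq * s\<^sup>2) ^ i * exp (s * (m + ?y))) \<le> 1 / k * (exp (s * (m + ?y)) * exp (Kq * s\<^sup>2 * real n))"
        using k by (intro mult_left_mono) auto
      moreover have "Q * (real i * sigma2) \<le> Q * (real n * sigma2)"
        using Q i sigma2_nonneg by (intro mult_left_mono mult_right_mono) auto
      ultimately show "Q * (real i * sigma2) + 1 / k * (exp (Kq * s\<^sup>2) ^ i * exp (s * (m + ?y)))
        \<le> Q * (real n * sigma2) + 1 / k * (exp (s * (m + ?y)) * exp (Kq * s\<^sup>2 * real n))"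
        by (rule add_mono[rotated])
      show "0 \<le> exp (Kq * (slope_lo n)\<^sup>2 * real n) * jump_sum CJ 0 J" using js by simp
      show "0 \<le> Q * (real i * sigma2) + 1 / k * (exp (Kq * s\<^sup>2) ^ i * exp (s * (m + ?y)))"
        using Q k sigma2_nonneg by (intro add_nonneg_nonneg mult_nonneg_nonneg) auto
    qed
    finally show ?thesis by (simp add: Q_def s_def G1_def)
  qed
  from order_trans[OF main add_mono[OF a1 a2]] show ?thesis
    unfolding h1 add.assoc[symmetric] by (simp only: t0_def i_def)
qed

section \<open>Asymptotics of the slopes, the level and the window\<close>

lemma powr_nat_tendsto_0:
  assumes "e < 0" shows "(\<lambda>n. real n powr e) \<longlonglongrightarrow> 0"
  using assms by (intro tendsto_neg_powr filterlim_real_sequentially)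

lemma slope_lo_eq: "slope_lo n = lam * b * (m / 2) powr (b - 1) * real n powr (b - 1)"
  using m_pos powr_mult[of "m / 2" "real n" "b - 1"] by (simp add: slope_lo_def)

lemma slope_hi_eq: "slope_hi n = 5 / 4 * lam * m powr (b - 1) * real n powr (b - 1)"
  using m_pos powr_mult[of m "real n" "b - 1"] by (simp add: slope_hi_def)

text \<open>This is the accumulated second-order error of n Chernoff steps with slopes of order
  \<open>n powr (b - 1)\<close>; its exponent \<open>2 * b - 1\<close> is negative exactly for
  \<open>b\<close> below 1/2.\<close>

lemma powr_square_tendsto: "(\<lambda>n. (real n powr (b - 1))\<^sup>2 * real n) \<longlonglongrightarrow> 0"
proof -
  have "(\<lambda>n. real n powr (2 * b - 1)) \<longlonglongrightarrow> 0" using b_less by (intro powr_nat_tendsto_0) auto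
  moreover have "\<forall>\<^sub>F n in sequentially. real n powr (2 * b - 1) = (real n powr (b - 1))\<^sup>2 * real n"
    using eventually_gt_at_top[of 0]
  proof eventually_elim
    case (elim n)
    have "real n powr (b - 1) * real n powr (b - 1) * real n powr 1 = real n powr (2 * b - 1)"
      by (simp only: powr_add[symmetric]) (rule arg_cong2[where f="(powr)"], auto)
    then show ?case using elim by (simp add: power2_eq_square)
  qed
  ultimately show ?thesis by (rule Lim_transform_eventually)
qed

text \<open>The level has order \<open>n powr b\<close>, hence again the exponent
  \<open>2 * b - 1\<close>: shifting a position by the level does not affect the tail at distance
  \<open>m * n\<close>.\<close>

lemma level_tendsto: "(\<lambda>n. real n powr (b - 1) * level xx n) \<longlonglongrightarrow> 0"
proof -
  have 1: "(\<lambda>n. real n powr (2 * b - 1)) \<longlonglongrightarrow> 0" using b_less by (intro powr_nat_tendsto_0) auto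
  have 2: "(\<lambda>n. ln (real n) / real n powr (1 - b)) \<longlonglongrightarrow> 0"
    using lim_ln_over_power[of "1 - b"] b_less by simp
  have 3: "(\<lambda>n. real n powr (b - 1)) \<longlonglongrightarrow> 0" using b_less by (intro powr_nat_tendsto_0) auto
  have "(\<lambda>n. lam * m powr b * real n powr (2 * b - 1) - a * (ln (real n) / real n powr (1 - b)) + xx * real n powr (b - 1))
    \<longlonglongrightarrow> lam * m powr b * 0 - a * 0 + xx * 0"
    by (intro tendsto_intros 1 2 3)
  then have "(\<lambda>n. lam * m powr b * real n powr (2 * b - 1) - a * (ln (real n) / real n powr (1 - b)) + xx * real n powr (b - 1)) \<longlonglongrightarrow> 0"
    by simp
  moreover have "\<forall>\<^sub>F n in sequentially. lam * m powr b * real n powr (2 * b - 1) - a * (ln (real n) / real n powr (1 - b)) + xx * real n powr (b - 1)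
    = real n powr (b - 1) * level xx n"
    using eventually_gt_at_top[of 0]
  proof eventually_elim
    case (elim n)
    have e1: "real n powr (2 * b - 1) = real n powr (b - 1) * real n powr b"
      by (simp only: powr_add[symmetric]) (rule arg_cong2[where f="(powr)"], auto)
    have e2: "1 / real n powr (1 - b) = real n powr (b - 1)"
      by (simp only: powr_minus_divide[symmetric]) (rule arg_cong2[where f="(powr)"], auto)
    have e3: "(m * real n) powr b = m powr b * real n powr b" using m_pos by (simp add: powr_mult)
    have e4: "ln (real n) / real n powr (1 - b) = ln (real n) * real n powr (b - 1)"
      unfolding e2[symmetric] by simp
    show ?case unfolding level_def e1 e3 e4 by (simp add: algebra_simps)
  qed
  ultimately show ?thesis by (rule Lim_transform_eventually)
qed

lemma slope_lo_square_tendsto: "(\<lambda>n. (slope_lo n)\<^sup>2 * real n) \<longlonglongrightarrow> 0"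
  using tendsto_mult_right_zero[OF powr_square_tendsto, of "(lam * b * (m / 2) powr (b - 1))\<^sup>2"]
  by (simp add: slope_lo_eq power_mult_distrib mult_ac)

lemma slope_hi_square_tendsto: "(\<lambda>n. (slope_hi n)\<^sup>2 * real n) \<longlonglongrightarrow> 0"
proof -
  define c where "c = 5 / 4 * lam * m powr (b - 1)"
  show ?thesis
    using tendsto_mult_right_zero[OF powr_square_tendsto, of "c\<^sup>2"]
    unfolding slope_hi_eq c_def[symmetric] by (simp add: power_mult_distrib mult_ac)
qed

lemma slope_hi_level_tendsto: "(\<lambda>n. slope_hi n * level xx n) \<longlonglongrightarrow> 0"
  using tendsto_mult_right_zero[OF level_tendsto, of "5 / 4 * lam * m powr (b - 1)"]
  by (simp add: slope_hi_eq mult_ac)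

lemma slope_lo_level_tendsto: "(\<lambda>n. slope_lo n * (m + level xx n)) \<longlonglongrightarrow> 0"
proof -
  have "(\<lambda>n. real n powr (b - 1)) \<longlonglongrightarrow> 0" using b_less by (intro powr_nat_tendsto_0) auto
  then have "(\<lambda>n. lam * b * (m / 2) powr (b - 1) * (m * real n powr (b - 1) + real n powr (b - 1) * level xx n)) \<longlonglongrightarrow> lam * b * (m / 2) powr (b - 1) * (m * 0 + 0)"
    by (intro tendsto_intros level_tendsto)
  then show ?thesis by (simp add: slope_lo_eq algebra_simps)
qed

text \<open>The quotient is \<open>n powr (b - 1 / 2)\<close>: the window is wide compared with the
  standard deviation of the walk.\<close>

lemma window_tendsto: "(\<lambda>n. real n / (window n)\<^sup>2) \<longlonglongrightarrow> 0"
proof -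
  have "(\<lambda>n. real n powr (b - 1 / 2)) \<longlonglongrightarrow> 0" using b_less by (intro powr_nat_tendsto_0) auto
  moreover have "\<forall>\<^sub>F n in sequentially. real n powr (b - 1 / 2) = real n / (window n)\<^sup>2"
    using eventually_gt_at_top[of 0]
  proof eventually_elim
    case (elim n)
    have "real n powr 1 / real n powr (3 / 2 - b) = real n powr (1 - (3 / 2 - b))" by (simp only: powr_diff)
    moreover have "(window n)\<^sup>2 = real n powr (3 / 2 - b)"
      by (simp add: window_def power2_eq_square powr_add[symmetric])
    ultimately show ?case using elim by (simp add: algebra_simps)
  qed
  ultimately show ?thesis by (rule Lim_transform_eventually)
qed

text \<open>The truncated walk contributes \<open>exp (- 5 / 4 * lam * (m * n) powr b)\<close> up to
  bounded factors, while the level costs \<open>lam * (m * n) powr b\<close> in the exponent and a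
  power of n. The remaining quarter, called \<open>e\<close> apart from the power of n, beats that
  power.\<close>

lemma no_jump_tendsto: "(\<lambda>n. exp (level xx n) * tau (slope_hi n) ^ n * exp (slope_hi n * level xx n)) \<longlonglongrightarrow> 0"
proof -
  define e where "e = lam / 4 * m powr b"
  have e: "0 < e" using lam_pos m_pos by (simp add: e_def)
  obtain C where C: "0 < C" "\<And>r. 1 \<le> r \<Longrightarrow> r powr (1 - a) * exp (- e * r powr b) \<le> C"
    using powr_exp_bound[OF e b_pos, of "1 - a"] by blast
  have 0: "(\<lambda>n. real n powr (- a) * exp (- e * real n powr b)) \<longlonglongrightarrow> 0"
  proof (rule Lim_null_comparison)
    show "\<forall>\<^sub>F n in sequentially. norm (real n powr (- a) * exp (- e * real n powr b)) \<le> C / real n"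
      using eventually_gt_at_top[of 0]
    proof eventually_elim
      case (elim n)
      have "real n powr (1 - a) = real n powr (- a) * real n"
        using elim by (simp add: powr_diff powr_minus_divide)
      then have "real n powr (- a) * exp (- e * real n powr b) * real n \<le> C"
        using C(2)[of "real n"] elim by (simp add: mult_ac)
      then show ?case using elim by (simp add: pos_le_divide_eq)
    qed
    show "(\<lambda>n. C / real n) \<longlonglongrightarrow> 0"
      by (intro tendsto_divide_0[OF tendsto_const] filterlim_at_top_imp_at_infinity filterlim_real_sequentially)
  qed
  have "(\<lambda>n. (real n powr (- a) * exp (- e * real n powr b)) * exp (xx + slope_hi n * level xx n + Kq * ((slope_hi n)\<^sup>2 * real n))) \<longlonglongrightarrow> 0 * exp (xx + 0 + Kq * 0)"
    by (intro tendsto_intros 0 slope_hi_level_tendsto slope_hi_square_tendsto)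
  then have "(\<lambda>n. (real n powr (- a) * exp (- e * real n powr b)) * exp (xx + slope_hi n * level xx n + Kq * ((slope_hi n)\<^sup>2 * real n))) \<longlonglongrightarrow> 0"
    by simp
  moreover have "\<forall>\<^sub>F n in sequentially. (real n powr (- a) * exp (- e * real n powr b)) * exp (xx + slope_hi n * level xx n + Kq * ((slope_hi n)\<^sup>2 * real n))
    = exp (level xx n) * tau (slope_hi n) ^ n * exp (slope_hi n * level xx n)"
    using eventually_gt_at_top[of 0]
  proof eventually_elim
    case (elim n)
    have la: "real n powr (- a) = exp (- (a * ln (real n)))" using elim by (simp add: powr_def)
    have "m powr (b - 1) * m = m powr b" using m_pos by (simp add: powr_diff)
    moreover have "real n powr (b - 1) * real n = real n powr b" using elim by (simp add: powr_diff)
    ultimately have sm: "slope_hi n * m * real n = 5 / 4 * lam * (m powr b * real n powr b)"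
      by (simp add: slope_hi_eq mult_ac) (metis mult.assoc mult.commute)
    have tn: "tau (slope_hi n) ^ n = exp (- (slope_hi n * m * real n) + Kq * ((slope_hi n)\<^sup>2 * real n))"
      by (simp add: exp_of_nat_mult[symmetric] algebra_simps)
    have e3: "(m * real n) powr b = m powr b * real n powr b" using m_pos by (simp add: powr_mult)
    show ?case
      unfolding la tn sm level_def e3 e_def mult_exp_exp
      by (rule arg_cong[where f=exp]) (simp add: algebra_simps)
  qed
  ultimately show ?thesis by (rule Lim_transform_eventually)
qed

lemma summable_jump: "summable (\<lambda>k. CJ / (1 + m * real k)\<^sup>2)"
proof (rule summable_comparison_test)
  \<comment> \<open>The minimum with 1 gives \<open>mm * Suc k\<close> at most
    \<open>1 + m * k\<close>, so that the comparison with inverse squares holds for every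
    index.\<close>
  define mm where "mm = min 1 m"
  have mm: "0 < mm" "mm \<le> 1" "mm \<le> m" using m_pos by (auto simp: mm_def)
  show "summable (\<lambda>k. (\<bar>CJ\<bar> / mm\<^sup>2) * inverse (real (Suc k) ^ 2))"
    using inverse_power_summable[of 2, where 'a=real] by (intro summable_mult) (subst summable_Suc_iff, simp)
  show "\<exists>N. \<forall>k\<ge>N. norm (CJ / (1 + m * real k)\<^sup>2) \<le> (\<bar>CJ\<bar> / mm\<^sup>2) * inverse (real (Suc k) ^ 2)"
  proof (intro exI[of _ 0] allI impI)
    fix k :: nat
    have "mm * real (Suc k) \<le> 1 + m * real k"
      using mm mult_right_mono[of mm m "real k"] by (simp add: algebra_simps)
    then have "(mm * real (Suc k))\<^sup>2 \<le> (1 + m * real k)\<^sup>2" using mm by (intro power_mono) auto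
    then have "\<bar>CJ\<bar> / (1 + m * real k)\<^sup>2 \<le> \<bar>CJ\<bar> / (mm * real (Suc k))\<^sup>2"
    proof -
      have "0 < (mm * real (Suc k))\<^sup>2" using mm by (intro zero_less_power mult_pos_pos) auto
      moreover have "0 < (1 + m * real k)\<^sup>2" using m_pos by (intro zero_less_power add_pos_nonneg) auto
      ultimately show ?thesis
        using \<open>(mm * real (Suc k))\<^sup>2 \<le> _\<close> by (intro divide_left_mono mult_pos_pos) auto
    qed
    also have "\<dots> = (\<bar>CJ\<bar> / mm\<^sup>2) * inverse (real (Suc k) ^ 2)"
      by (simp only: power_mult_distrib divide_inverse inverse_mult_distrib mult.assoc)
    finally show "norm (CJ / (1 + m * real k)\<^sup>2) \<le> (\<bar>CJ\<bar> / mm\<^sup>2) * inverse (real (Suc k) ^ 2)" by simp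
  qed
qed

lemma jump_sum_small:
  assumes "0 < CJ" "0 < e"
  obtains J0 where "\<And>J i. J0 \<le> J \<Longrightarrow> jump_sum CJ J i < e"
proof -
  from summable_Cauchy[THEN iffD1, OF summable_jump[of CJ], rule_format, OF assms(2)]
  obtain J0 where J0: "\<And>J n. J0 \<le> J \<Longrightarrow> norm (\<Sum>k=J..<n. CJ / (1 + m * real k)\<^sup>2) < e" by blast
  have "jump_sum CJ J i < e" if "J0 \<le> J" for J i
  proof -
    have "jump_sum CJ J i = (\<Sum>k=J..<J + i. CJ / (1 + m * real k)\<^sup>2)"
      unfolding jump_sum_def
      using sum.shift_bounds_nat_ivl[of "\<lambda>k. CJ / (1 + m * real k)\<^sup>2" 0 J i]
      by (simp add: add.commute atLeast0LessThan)
    then show ?thesis using J0[OF that, of "J + i"] by (simp add: abs_less_iff)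
  qed
  then show ?thesis by (rule that)
qed

text \<open>The order of choices matters: the tail of the jump series fixes \<open>J0\<close>, then
  \<open>k\<close> may depend on \<open>J\<close>, and n tends to infinity last. The first
  coefficient tends to 2, hence is eventually below 3, and the three errors add up to at most
  \<open>7 / 8 * e\<close>.\<close>

lemma atypical_small:
  assumes e: "0 < e"
  obtains J0 where "\<And>J. J0 \<le> J \<Longrightarrow>
    \<forall>\<^sub>F n in sequentially. hit_level xx n n 0 - hit (hit_typ xx n J) (n - J) 0 < e"
proof -
  obtain CJ n0 where CJ: "0 < CJ" "1 \<le> n0" "\<And>n. n0 \<le> n \<Longrightarrow> jump_bound CJ xx n"
    using big_jump by blast
  obtain J0 where J0: "\<And>J i. J0 \<le> J \<Longrightarrow> jump_sum CJ J i < e / 8"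
    using jump_sum_small[OF CJ(1), of "e / 8"] e by auto
  have "\<forall>\<^sub>F n in sequentially. hit_level xx n n 0 - hit (hit_typ xx n J) (n - J) 0 < e" if J: "J0 \<le> J" for J
  proof -
    define S where "S = jump_sum CJ 0 J"
    have js: "0 \<le> jump_sum CJ i j" for i j unfolding jump_sum_def using CJ by (intro sum_nonneg) auto
    have S: "0 \<le> S" by (simp add: S_def js)
    \<comment> \<open>Large enough that the contribution of large lags, which tends to
      \<open>S / k\<close>, falls below \<open>e / 4\<close>.\<close>
    define k where "k = 1 + 4 * S / e"
    have k: "1 \<le> k" using S e by (simp add: k_def)
    have Sk: "S * (1 / k) < e / 4"
    proof -
      have "e * k = e + 4 * S" using e by (simp add: k_def field_simps)
      then show ?thesis using k e by (simp add: field_simps)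
    qed
    let ?A = "\<lambda>n. exp (Kq * (slope_lo n)\<^sup>2 * real n)"
    have A: "?A \<longlonglongrightarrow> 1"
      using tendsto_exp[OF tendsto_mult_right_zero[OF slope_lo_square_tendsto, of Kq]] by (simp add: mult.assoc)
    let ?r1 = "\<lambda>n. ?A n * (1 + exp (slope_lo n * (m + level xx n)))"
    have r1: "?r1 \<longlonglongrightarrow> 1 * (1 + exp 0)"
      by (intro tendsto_intros A slope_lo_level_tendsto)
    let ?r2 = "\<lambda>n. ?A n * S *
      ((1 + k\<^sup>2) / (window n)\<^sup>2 * (real n * sigma2)
       + 1 / k * (exp (3 / 2 * slope_lo n * (m + level xx n)) * exp (Kq * (3 / 2 * slope_lo n)\<^sup>2 * real n)))"
    have "(\<lambda>n. ?A n * S * ((1 + k\<^sup>2) * sigma2 * (real n / (window n)\<^sup>2)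
       + 1 / k * (exp (3 / 2 * (slope_lo n * (m + level xx n))) * exp (Kq * (9 / 4) * ((slope_lo n)\<^sup>2 * real n)))))
       \<longlonglongrightarrow> 1 * S * ((1 + k\<^sup>2) * sigma2 * 0 + 1 / k * (exp (3 / 2 * 0) * exp (Kq * (9 / 4) * 0)))"
      by (intro tendsto_intros A slope_lo_level_tendsto slope_lo_square_tendsto window_tendsto)
    moreover have "(\<lambda>n. ?A n * S * ((1 + k\<^sup>2) * sigma2 * (real n / (window n)\<^sup>2)
       + 1 / k * (exp (3 / 2 * (slope_lo n * (m + level xx n))) * exp (Kq * (9 / 4) * ((slope_lo n)\<^sup>2 * real n))))) = ?r2"
      by (intro ext) (simp add: power2_eq_square mult_ac)
    ultimately have r2: "?r2 \<longlonglongrightarrow> S * (1 / k)" by simp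
    have ev1: "\<forall>\<^sub>F n in sequentially. ?r1 n < 3"
      using order_tendstoD(2)[OF r1, of 3] by simp
    have ev2: "\<forall>\<^sub>F n in sequentially. ?r2 n < e / 4"
      by (rule order_tendstoD(2)[OF r2 Sk])
    have ev3: "\<forall>\<^sub>F n in sequentially. exp (level xx n) * tau (slope_hi n) ^ n * exp (slope_hi n * level xx n) < e / 4"
      using order_tendstoD(2)[OF no_jump_tendsto, of "e / 4"] e by simp
    show ?thesis
      using ev1 ev2 ev3 eventually_ge_at_top[of n0] eventually_ge_at_top[of J]
    proof eventually_elim
      case (elim n)
      have n: "1 \<le> n" using elim CJ by simp
      have b1: "?A n * jump_sum CJ J (n - J) * (1 + exp (slope_lo n * (m + level xx n))) \<le> e / 8 * 3"
      proof -
        have "jump_sum CJ J (n - J) * ?r1 n \<le> e / 8 * 3"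
          using J0[OF J, of "n - J"] elim(1) e js by (intro mult_mono) (auto simp: add_nonneg_nonneg)
        then show ?thesis by (simp add: mult_ac)
      qed
      have "hit_level xx n n 0 - hit (hit_typ xx n J) (n - J) 0 \<le>
        ?A n * jump_sum CJ J (n - J) * (1 + exp (slope_lo n * (m + level xx n))) + ?r2 n
        + exp (level xx n) * tau (slope_hi n) ^ n * exp (slope_hi n * level xx n)"
        unfolding S_def by (rule bad_bound[OF CJ(1) n CJ(3)[OF elim(4)] elim(5) k])
      also have "\<dots> < e / 8 * 3 + e / 4 + e / 4"
        by (rule add_le_less_mono[OF less_imp_le[OF add_le_less_mono[OF b1 elim(2)]] elim(3)])
      also have "\<dots> < e" using e by simp
      finally show ?case .
    qed
  qed
  then show ?thesis by (rule that)
qed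

section \<open>Particles of generation n - J in the window\<close>

text \<open>The exponent is \<open>b / 2 - 1 / 4\<close>: the window is narrow on the scale
  \<open>n powr (1 - b)\<close> on which the tail changes.\<close>

lemma window_powr: "(\<lambda>n. real n powr (b - 1) * window n) \<longlonglongrightarrow> 0"
proof -
  have "(\<lambda>n. real n powr ((b - 1) + (3 / 2 - b) / 2)) \<longlonglongrightarrow> 0"
    using b_less by (intro powr_nat_tendsto_0) (auto simp: field_simps)
  then show ?thesis by (simp add: window_def powr_add)
qed

text \<open>At distance exactly \<open>m * n\<close> the centering cancels the tail: the
  exponentials compensate, and \<open>n powr (- a)\<close> leaves \<open>m powr a\<close> of
  \<open>(m * n) powr a\<close>. \<open>F_ratio_tendsto\<close> then allows perturbations of smaller
  order than \<open>n powr (1 - b)\<close>.\<close>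

lemma F_level_tendsto:
  assumes d: "(\<lambda>n. real n powr (b - 1) * d n) \<longlonglongrightarrow> 0"
  shows "(\<lambda>n. exp (level xx n) * F (m * real n + d n)) \<longlonglongrightarrow> m powr a * exp xx"
    and "filterlim (\<lambda>n. m * real n + d n) at_top sequentially"
proof -
  have z: "filterlim (\<lambda>n. m * real n) at_top sequentially"
    using m_pos by (intro filterlim_tendsto_pos_mult_at_top[OF tendsto_const] filterlim_real_sequentially)
  have eq: "(m * real n) powr (b - 1) * d n = m powr (b - 1) * (real n powr (b - 1) * d n)" for n
    using m_pos by (simp add: powr_mult)
  have dz: "(\<lambda>n. (m * real n) powr (b - 1) * d n) \<longlonglongrightarrow> 0"
    unfolding eq by (rule tendsto_mult_right_zero[OF d])
  from F_ratio_tendsto[OF z dz]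
  have "(\<lambda>n. m powr a * exp xx * (F (m * real n + d n) / F (m * real n))) \<longlonglongrightarrow> m powr a * exp xx * 1"
    by (intro tendsto_intros)
  then have "(\<lambda>n. m powr a * exp xx * (F (m * real n + d n) / F (m * real n))) \<longlonglongrightarrow> m powr a * exp xx"
    by simp
  moreover have "\<forall>\<^sub>F n in sequentially. m powr a * exp xx * (F (m * real n + d n) / F (m * real n)) = exp (level xx n) * F (m * real n + d n)"
    using eventually_gt_at_top[of 0]
  proof eventually_elim
    case (elim n)
    have la: "exp (- (a * ln (real n))) = real n powr (- a)" using elim by (simp add: powr_def)
    have "exp (level xx n) = exp (lam * (m * real n) powr b) * exp (- (a * ln (real n))) * exp xx"
      by (simp add: level_def exp_add[symmetric])
    then have "exp (level xx n) * F (m * real n) = exp xx * (real n powr (- a) * (m * real n) powr a)"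
      unfolding la F_def by (simp add: mult_exp_exp mult_ac)
    also have "real n powr (- a) * (m * real n) powr a = m powr a"
      using elim m_pos by (simp add: powr_mult powr_minus)
    finally have "exp (level xx n) * F (m * real n) = m powr a * exp xx" by simp
    moreover have "F (m * real n) \<noteq> 0" using F_pos[of "m * real n"] elim m_pos by simp
    ultimately show ?case by (simp add: field_simps)
  qed
  ultimately show "(\<lambda>n. exp (level xx n) * F (m * real n + d n)) \<longlonglongrightarrow> m powr a * exp xx"
    by (rule Lim_transform_eventually)
  have "(\<lambda>n. (real n powr (b - 1) * d n) * real n powr (- b)) \<longlonglongrightarrow> 0 * 0"
    using b_pos by (intro tendsto_mult d powr_nat_tendsto_0) auto
  then have "(\<lambda>n. m + (real n powr (b - 1) * d n) * real n powr (- b)) \<longlonglongrightarrow> m + 0"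
    by (intro tendsto_intros) simp
  then have "filterlim (\<lambda>n. (m + (real n powr (b - 1) * d n) * real n powr (- b)) * real n) at_top sequentially"
    using m_pos by (intro filterlim_tendsto_pos_mult_at_top[OF _ _ filterlim_real_sequentially]) auto
  moreover have "\<forall>\<^sub>F n in sequentially. (m + (real n powr (b - 1) * d n) * real n powr (- b)) * real n = m * real n + d n"
    using eventually_gt_at_top[of 0]
  proof eventually_elim
    case (elim n)
    have "real n powr (b - 1) * real n powr (- b) * real n powr 1 = real n powr ((b - 1) + (- b) + 1)"
      by (simp only: powr_add)
    then have "real n powr (b - 1) * real n powr (- b) * real n = 1" using elim by simp
    then have "d n * (real n powr (b - 1) * real n powr (- b) * real n) = d n" by simp
    then show ?case by (simp add: algebra_simps)
  qed
  ultimately show "filterlim (\<lambda>n. m * real n + d n) at_top sequentially"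
    by (simp cong: filterlim_cong)
qed

lemma hit_level_exp: "exp v * hit_level xx n J v = exp (level xx n) * tilt J (v - level xx n)"
  by (simp add: hit_level_eq tilt_def mult_exp_exp mult.assoc[symmetric])

text \<open>The ends of the window, lowered by the level, differ from \<open>m * n\<close> by a
  negligible amount. Since \<open>F\<close> is eventually monotone, the values at these two ends
  control all typical positions at once.\<close>

lemma window_bounds:
  fixes xx :: real and J :: nat
  defines "zl \<equiv> \<lambda>n. m * real n + (- (m * real J) - window n - level xx n)"
    and "zu \<equiv> \<lambda>n. m * real n + (- (m * real J) + window n - level xx n)"
  shows "(\<lambda>n. exp (level xx n) * F (zl n)) \<longlonglongrightarrow> m powr a * exp xx"
    and "(\<lambda>n. exp (level xx n) * F (zu n)) \<longlonglongrightarrow> m powr a * exp xx"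
    and "filterlim zl at_top sequentially"
    and "typical n J v \<Longrightarrow> zl n \<le> v - level xx n \<and> v - level xx n \<le> zu n"
proof -
  have 0: "(\<lambda>n. real n powr (b - 1)) \<longlonglongrightarrow> 0" using b_less by (intro powr_nat_tendsto_0) auto
  have "(\<lambda>n. - (m * real J) * real n powr (b - 1) - real n powr (b - 1) * window n - real n powr (b - 1) * level xx n) \<longlonglongrightarrow> - (m * real J) * 0 - 0 - 0"
    by (intro tendsto_intros 0 window_powr level_tendsto)
  then have l: "(\<lambda>n. real n powr (b - 1) * (- (m * real J) - window n - level xx n)) \<longlonglongrightarrow> 0"
    by (simp add: algebra_simps)
  have "(\<lambda>n. - (m * real J) * real n powr (b - 1) + real n powr (b - 1) * window n - real n powr (b - 1) * level xx n) \<longlonglongrightarrow> - (m * real J) * 0 + 0 - 0"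
    by (intro tendsto_intros 0 window_powr level_tendsto)
  then have u: "(\<lambda>n. real n powr (b - 1) * (- (m * real J) + window n - level xx n)) \<longlonglongrightarrow> 0"
    by (simp add: algebra_simps)
  show "(\<lambda>n. exp (level xx n) * F (zl n)) \<longlonglongrightarrow> m powr a * exp xx"
    and "(\<lambda>n. exp (level xx n) * F (zu n)) \<longlonglongrightarrow> m powr a * exp xx"
    and "filterlim zl at_top sequentially"
    unfolding zl_def zu_def by (intro F_level_tendsto l u)+
  show "typical n J v \<Longrightarrow> zl n \<le> v - level xx n \<and> v - level xx n \<le> zu n"
    by (auto simp: typical_def zl_def zu_def algebra_simps abs_less_iff)
qed

text \<open>The limit of \<open>exp v * hit_level xx n J v\<close>, uniformly over typical
  \<open>v\<close>.\<close>

definition limit_rate :: "real \<Rightarrow> nat \<Rightarrow> real" where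
  "limit_rate xx J = l_inf * Cpart J * (m powr a * exp xx)"

text \<open>The tail asymptotics at the far end of the window bounds the hitting probability from
  below, and \<open>1 - q\<close> is at most \<open>exp (- q)\<close>.\<close>

lemma typical_lower:
  assumes c: "0 \<le> c" "c < limit_rate xx J"
  shows "\<forall>\<^sub>F n in sequentially. \<forall>v. typical n J v \<longrightarrow> 1 - hit_level xx n J v \<le> exp (- (c * exp (- v)))"
proof -
  define M where "M = m powr a * exp xx"
  have M: "0 < M" using m_pos by (simp add: M_def)
  have "c / M < l_inf * Cpart J" using c M by (simp add: limit_rate_def M_def pos_divide_less_eq)
  then obtain L where L: "c / M < L" "L < l_inf * Cpart J" using dense by blast
  have "0 \<le> c / M" using c M by simp
  then have L0: "0 < L" using L by linarith
  have "\<forall>\<^sub>F w in at_top. L < tilt J w / F w" by (rule order_tendstoD(1)[OF tilt_tail L(2)])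
  then obtain W where W: "\<And>w. W \<le> w \<Longrightarrow> L < tilt J w / F w" by (auto simp: eventually_at_top_linorder)
  obtain r0 where r0: "1 \<le> r0" "\<And>r s. r0 \<le> r \<Longrightarrow> r \<le> s \<Longrightarrow> F s \<le> F r"
    using F_decreasing by blast
  note wb = window_bounds[where xx=xx and J=J]
  have "c < L * M" using L M by (simp add: pos_divide_less_eq)
  then have "\<forall>\<^sub>F n in sequentially. c < L * (exp (level xx n) * F (m * real n + (- (m * real J) + window n - level xx n)))"
    using tendsto_mult[OF tendsto_const wb(2), of L] unfolding M_def[symmetric] by (intro order_tendstoD(1))
  moreover have "\<forall>\<^sub>F n in sequentially. max W r0 \<le> m * real n + (- (m * real J) - window n - level xx n)"
    using wb(3)[unfolded filterlim_at_top, rule_format, of "max W r0"] .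
  ultimately show ?thesis
  proof eventually_elim
    case (elim n)
    show ?case
    proof (intro allI impI)
      fix v assume v: "typical n J v"
      let ?w = "v - level xx n"
      have w: "W \<le> ?w" "r0 \<le> ?w" using wb(4)[OF v] elim(2) by auto
      have "F (m * real n + (- (m * real J) + window n - level xx n)) \<le> F ?w"
        using wb(4)[OF v] w by (intro r0) auto
      then have "L * (exp (level xx n) * F (m * real n + (- (m * real J) + window n - level xx n))) \<le> L * (exp (level xx n) * F ?w)"
        using L0 by (intro mult_left_mono) auto
      moreover have "L * F ?w \<le> tilt J ?w"
        using W[OF w(1)] F_pos[of ?w] w r0(1) by (simp add: pos_less_divide_eq)
      then have "exp (level xx n) * (L * F ?w) \<le> exp (level xx n) * tilt J ?w" by (intro mult_left_mono) auto
      ultimately have "c \<le> exp v * hit_level xx n J v"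
        using elim(1) unfolding hit_level_exp mult.left_commute[of L "exp (level xx n)"] by linarith
      then have "c * exp (- v) \<le> hit_level xx n J v" by (simp add: exp_minus field_simps)
      then show "1 - hit_level xx n J v \<le> exp (- (c * exp (- v)))"
        using exp_ge_add_one_self[of "- (c * exp (- v))"] by simp
    qed
  qed
qed

lemma Cpart_nonneg: "0 \<le> Cpart J"
  unfolding Cpart_def by (intro sum_nonneg integral_nonneg_AE) (simp add: tilt_nonneg)

lemma l_inf_nonneg: "0 \<le> l_inf"
  by (rule tendsto_lowerbound[OF l_lim]) (auto simp: l_nonneg)

text \<open>The reverse comparison of \<open>1 - q\<close> with an exponential loses a quadratic
  term. It is absorbed in the gap between \<open>limit_rate xx J\<close> and \<open>c\<close>,
  because typical positions tend to infinity and make \<open>q\<close> small.\<close>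

lemma typical_upper:
  assumes c: "limit_rate xx J < c"
  shows "\<forall>\<^sub>F n in sequentially. \<forall>v. typical n J v \<longrightarrow> exp (- (c * exp (- v))) \<le> 1 - hit_level xx n J v"
proof -
  define M where "M = m powr a * exp xx"
  have M: "0 < M" using m_pos by (simp add: M_def)
  have "0 \<le> limit_rate xx J" using l_inf_nonneg Cpart_nonneg M by (simp add: limit_rate_def M_def)
  then obtain c1 where c1: "limit_rate xx J < c1" "c1 < c" "0 < c1" using dense[OF c] by (metis le_less_trans)
  have "l_inf * Cpart J < c1 / M" using c1 M by (simp add: limit_rate_def M_def pos_less_divide_eq)
  then obtain L where L: "l_inf * Cpart J < L" "L < c1 / M" using dense by blast
  have "0 \<le> l_inf * Cpart J" using l_inf_nonneg Cpart_nonneg by simp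
  then have L0: "0 < L" using L by linarith
  have "\<forall>\<^sub>F w in at_top. tilt J w / F w < L" by (rule order_tendstoD(2)[OF tilt_tail L(1)])
  then obtain W where W: "\<And>w. W \<le> w \<Longrightarrow> tilt J w / F w < L" by (auto simp: eventually_at_top_linorder)
  obtain r0 where r0: "1 \<le> r0" "\<And>r s. r0 \<le> r \<Longrightarrow> r \<le> s \<Longrightarrow> F s \<le> F r"
    using F_decreasing by blast
  \<comment> \<open>The second entry makes \<open>c1 * (1 + 2 * \<delta>)\<close> at most
    \<open>c\<close>; the first keeps \<open>q\<close> in the range of the quadratic lower bound for
    the logarithm.\<close>
  define \<delta> where "\<delta> = min (1 / 2) ((c - c1) / (2 * c1))"
  have \<delta>: "0 < \<delta>" "\<delta> \<le> 1 / 2" "c1 * (1 + 2 * \<delta>) \<le> c"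
  proof -
    show "0 < \<delta>" "\<delta> \<le> 1 / 2" using c1 by (auto simp: \<delta>_def)
    have "\<delta> \<le> (c - c1) / (2 * c1)" by (simp add: \<delta>_def)
    then show "c1 * (1 + 2 * \<delta>) \<le> c" using c1 by (simp add: field_simps)
  qed
  note wb = window_bounds[where xx=xx and J=J]
  have "L * M < c1" using L M by (simp add: pos_less_divide_eq)
  then have 1: "\<forall>\<^sub>F n in sequentially. L * (exp (level xx n) * F (m * real n + (- (m * real J) - window n - level xx n))) < c1"
    using tendsto_mult[OF tendsto_const wb(1), of L] unfolding M_def[symmetric] by (intro order_tendstoD(2))
  have 2: "\<forall>\<^sub>F n in sequentially. max W r0 \<le> m * real n + (- (m * real J) - window n - level xx n)"
    using wb(3)[unfolded filterlim_at_top, rule_format, of "max W r0"] .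
  have 3: "\<forall>\<^sub>F n in sequentially. ln (c1 / \<delta>) \<le> m * real n + (- (m * real J) - window n)"
  proof -
    have 0: "(\<lambda>n. real n powr (b - 1)) \<longlonglongrightarrow> 0" using b_less by (intro powr_nat_tendsto_0) auto
    have "(\<lambda>n. - (m * real J) * real n powr (b - 1) - real n powr (b - 1) * window n) \<longlonglongrightarrow> - (m * real J) * 0 - 0"
      by (intro tendsto_intros 0 window_powr)
    then have l: "(\<lambda>n. real n powr (b - 1) * (- (m * real J) - window n)) \<longlonglongrightarrow> 0"
      by (simp add: algebra_simps)
    from F_level_tendsto(2)[OF l] show ?thesis by (auto simp: filterlim_at_top)
  qed
  from 1 2 3 show ?thesis
  proof eventually_elim
    case (elim n)
    show ?case
    proof (intro allI impI)
      fix v assume v: "typical n J v"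
      let ?w = "v - level xx n"
      have w: "W \<le> ?w" "r0 \<le> ?w" using wb(4)[OF v] elim(2) by auto
      have "F ?w \<le> F (m * real n + (- (m * real J) - window n - level xx n))"
        using wb(4)[OF v] elim(2) by (intro r0) auto
      then have "L * (exp (level xx n) * F ?w) \<le> L * (exp (level xx n) * F (m * real n + (- (m * real J) - window n - level xx n)))"
        using L0 by (intro mult_left_mono) auto
      moreover have "tilt J ?w \<le> L * F ?w"
        using W[OF w(1)] F_pos[of ?w] w r0(1) by (simp add: pos_divide_less_eq)
      then have "exp (level xx n) * tilt J ?w \<le> exp (level xx n) * (L * F ?w)" by (intro mult_left_mono) auto
      ultimately have "exp v * hit_level xx n J v \<le> c1"
        using elim(1) unfolding hit_level_exp mult.left_commute[of L "exp (level xx n)"] by linarith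
      then have q: "hit_level xx n J v \<le> c1 * exp (- v)" by (simp add: exp_minus field_simps)
      have "ln (c1 / \<delta>) \<le> v"
        using v elim(3) by (auto simp: typical_def abs_less_iff algebra_simps)
      then have "exp (ln (c1 / \<delta>)) \<le> exp v" by simp
      then have "c1 / \<delta> \<le> exp v" using c1 \<delta> by simp
      then have small: "c1 * exp (- v) \<le> \<delta>" using \<delta> by (simp add: exp_minus field_simps)
      define q where "q = hit_level xx n J v"
      have q0: "0 \<le> q" unfolding q_def by (rule targetD(2)[OF target_hit_level])
      have qd: "q \<le> \<delta>" using q small by (simp add: q_def)
      have "- q - 2 * q\<^sup>2 \<le> ln (1 - q)"
        using q0 qd \<delta> by (intro ln_one_minus_pos_lower_bound) auto
      moreover have "2 * q\<^sup>2 \<le> 2 * \<delta> * q"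
        using q0 qd by (simp add: power2_eq_square mult_right_mono)
      moreover have "q * (1 + 2 * \<delta>) \<le> c1 * exp (- v) * (1 + 2 * \<delta>)"
        using q \<delta> by (intro mult_right_mono) (auto simp: q_def)
      moreover have "(c1 * (1 + 2 * \<delta>)) * exp (- v) \<le> c * exp (- v)"
        using \<delta> by (intro mult_right_mono) auto
      ultimately have "- (c * exp (- v)) \<le> ln (1 - q)" by (simp add: algebra_simps)
      then have "exp (- (c * exp (- v))) \<le> exp (ln (1 - q))" by simp
      also have "\<dots> = 1 - q" using qd \<delta> by simp
      finally show "exp (- (c * exp (- v))) \<le> 1 - hit_level xx n J v" by (simp add: q_def)
    qed
  qed
qed

section \<open>First moments under the tilted walk\<close>

lemma nn_kap: "(\<integral>\<^sup>+n. of_nat n \<partial>measure_pmf nu) = ennreal kappa"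
  using nn_integral_eq_integral[OF nu_int] by (simp add: ennreal_of_nat_eq_real_of_nat)

lemma tree_sum_step:
  assumes [measurable]: "g \<in> borel_measurable borel"
  shows "(\<integral>\<^sup>+n. of_nat n \<partial>measure_pmf nu) * (\<integral>\<^sup>+y. ennreal (exp (- (v + y))) * g (v + y) \<partial>mu)
    = ennreal (exp (- v)) * (\<integral>\<^sup>+x. g (v + x) \<partial>R)"
proof -
  have "ennreal kappa * (\<integral>\<^sup>+y. ennreal (exp (- (v + y))) * g (v + y) \<partial>mu)
    = (\<integral>\<^sup>+x. ennreal (exp x) * (ennreal (exp (- (v + x))) * g (v + x)) \<partial>R)"
    by (rule change_law) measurable
  also have "\<dots> = (\<integral>\<^sup>+x. ennreal (exp (- v)) * g (v + x) \<partial>R)"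
    by (intro nn_integral_cong) (simp add: mult.assoc[symmetric] ennreal_mult'[symmetric] mult_exp_exp)
  also have "\<dots> = ennreal (exp (- v)) * (\<integral>\<^sup>+x. g (v + x) \<partial>R)"
    by (rule nn_integral_cmult) measurable
  finally show ?thesis unfolding nn_kap .
qed

text \<open>The many-to-one formula reduces the weighted sum to the second moment of the tilted walk
  after \<open>k\<close> steps: squared bias plus \<open>k\<close> variances.\<close>

lemma nn_integral_tree_sum_square:
  "(\<integral>\<^sup>+t. tree_sum (\<lambda>v. ennreal (exp (- v)) * ennreal ((v - c)\<^sup>2)) k v t \<partial>tree_law)
    = ennreal (exp (- v)) * ennreal ((v + m * real k - c)\<^sup>2 + real k * sigma2)"
proof (induction k arbitrary: v)
  case 0
  then show ?case by (simp add: tree.emeasure_space_1 flip: space_tree_law)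
next
  case (Suc k)
  have "(\<integral>\<^sup>+t. tree_sum (\<lambda>v. ennreal (exp (- v)) * ennreal ((v - c)\<^sup>2)) (Suc k) v t \<partial>tree_law)
    = (\<integral>\<^sup>+n. of_nat n \<partial>measure_pmf nu) * (\<integral>\<^sup>+y. ennreal (exp (- (v + y))) * ennreal ((v + y + m * real k - c)\<^sup>2 + real k * sigma2) \<partial>mu)"
    by (subst nn_integral_tree_sum_Suc) (simp_all add: Suc)
  also have "\<dots> = ennreal (exp (- v)) * (\<integral>\<^sup>+x. ennreal ((v + x + m * real k - c)\<^sup>2 + real k * sigma2) \<partial>R)"
    by (rule tree_sum_step[where g="\<lambda>z. ennreal ((z + m * real k - c)\<^sup>2 + real k * sigma2)"]) measurable
  also have "(\<integral>\<^sup>+x. ennreal ((v + x + m * real k - c)\<^sup>2 + real k * sigma2) \<partial>R)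
    = ennreal (\<integral>x. (v + x - (c - m * real k))\<^sup>2 + real k * sigma2 \<partial>R)"
    using square_step(1)[of v "c - m * real k"] sigma2_nonneg
    by (subst nn_integral_eq_integral[symmetric]) (auto simp: algebra_simps)
  also have "(\<integral>x. (v + x - (c - m * real k))\<^sup>2 + real k * sigma2 \<partial>R) = (v + m * real (Suc k) - c)\<^sup>2 + real (Suc k) * sigma2"
    using square_step[of v "c - m * real k"] by (simp add: algebra_simps)
  finally show ?case .
qed

text \<open>The weight in \<open>tilt_weighted\<close> is at least 1, and its bound is integrable in
  \<open>w\<close> with integrals summable in \<open>j\<close>. This is the finiteness of
  \<open>C_star\<close>.\<close>

lemma tilt_integral_summable: "summable (\<lambda>j. \<integral>w. tilt j w \<partial>lborel)"
proof -
  obtain CB where CB: "0 < CB"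
    "\<And>j w. tilt j w * exp (lam * b * (max 0 (m * real j + w)) powr b) \<le> CB / (1 + m * real j)\<^sup>2 * (1 / (1 + w\<^sup>2))"
    using tilt_weighted by blast
  define I where "I = (\<integral>w. 1 / (1 + w\<^sup>2) \<partial>lborel :: real)"
  have "(\<integral>w. tilt j w \<partial>lborel) \<le> (CB * I) / (1 + m * real j)\<^sup>2" for j
  proof -
    have "(\<integral>w. tilt j w \<partial>lborel) \<le> (\<integral>w. CB / (1 + m * real j)\<^sup>2 * (1 / (1 + w\<^sup>2)) \<partial>lborel)"
    proof (rule integral_mono[OF tilt_lborel_integrable])
      show "integrable lborel (\<lambda>w. CB / (1 + m * real j)\<^sup>2 * (1 / (1 + w\<^sup>2)))"
        by (intro integrable_mult_right integrable_cauchy)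
      fix w
      have "tilt j w * 1 \<le> tilt j w * exp (lam * b * (max 0 (m * real j + w)) powr b)"
        using lam_pos b_pos tilt_nonneg by (intro mult_left_mono) auto
      then show "tilt j w \<le> CB / (1 + m * real j)\<^sup>2 * (1 / (1 + w\<^sup>2))" using CB(2)[of j w] by simp
    qed
    also have "\<dots> = CB / (1 + m * real j)\<^sup>2 * I" unfolding I_def by (rule Bochner_Integration.integral_mult_right_zero)
    finally show ?thesis by simp
  qed
  moreover have "0 \<le> (\<integral>w. tilt j w \<partial>lborel)" for j by (intro integral_nonneg_AE) (simp add: tilt_nonneg)
  ultimately show ?thesis
    by (intro summable_comparison_test[OF _ summable_jump[of "CB * I"]]) auto
qed

end

section \<open>The limit of the minimal position\<close>

locale brw_tail = branching_random_walk P nu mu N Y + stretched_step nu mu a lam b R l l_inf l_bd x0 s1 m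
  for P :: "'a measure" and nu mu N Y a lam b R l l_inf l_bd x0 s1 m +
  fixes W_inf :: "'a \<Rightarrow> real"
  assumes W_inf_rv [measurable]: "W_inf \<in> borel_measurable P"
    and W_inf_lim: "AE \<omega> in P. (\<lambda>n. additive_martingale N Y n \<omega>) \<longlonglongrightarrow> W_inf \<omega>"
begin

text \<open>The conditional probability, given the first \<open>k\<close> generations, that no
  particle of generation \<open>k\<close> is marked.\<close>

definition survival :: "(real \<Rightarrow> real) \<Rightarrow> nat \<Rightarrow> 'a \<Rightarrow> real" where
  "survival \<theta> k \<omega> = (\<Prod>u\<in>generation N k \<omega>. 1 - \<theta> (position Y u \<omega>))"

lemma survival_bounds: "target \<theta> \<Longrightarrow> 0 \<le> survival \<theta> k \<omega>" "target \<theta> \<Longrightarrow> survival \<theta> k \<omega> \<le> 1"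
  unfolding survival_def using targetD(2,3) by (auto intro!: prod_nonneg prod_le_1)

lemma survival_integral:
  assumes \<theta>: "target \<theta>"
  shows "survival \<theta> k \<in> borel_measurable P" "integrable P (survival \<theta> k)" "expectation (survival \<theta> k) = 1 - hit \<theta> k 0"
proof -
  note [measurable] = targetD(1)[OF \<theta>]
  have m1: "(\<lambda>v. ennreal (1 - \<theta> v)) \<in> borel_measurable borel" by measurable
  have eq: "ennreal (survival \<theta> k \<omega>) = (\<Prod>u\<in>generation N k \<omega>. ennreal (1 - \<theta> (0 + position Y u \<omega>)))" for \<omega>
    unfolding survival_def using targetD(3)[OF \<theta>] by (subst prod_ennreal) auto
  have ms: "(\<lambda>\<omega>. ennreal (survival \<theta> k \<omega>)) \<in> borel_measurable P"
    unfolding eq by (rule borel_measurable_prod_generation[OF m1])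
  have "(\<lambda>\<omega>. enn2real (ennreal (survival \<theta> k \<omega>))) \<in> borel_measurable P"
    by (rule borel_measurable_enn2real[OF ms])
  then show ms2: "survival \<theta> k \<in> borel_measurable P"
    using survival_bounds(1)[OF \<theta>] by simp
  show i: "integrable P (survival \<theta> k)"
    by (rule integrable_const_bound[where B=1]) (use survival_bounds[OF \<theta>] ms2 in auto)
  have "ennreal (expectation (survival \<theta> k)) = (\<integral>\<^sup>+\<omega>. ennreal (survival \<theta> k \<omega>) \<partial>P)"
    by (rule nn_integral_eq_integral[symmetric, OF i]) (simp add: survival_bounds[OF \<theta>])
  also have "\<dots> = (\<integral>\<^sup>+t. tree_prod (\<lambda>v. ennreal (1 - \<theta> v)) k 0 t \<partial>law.tree_law)"
    unfolding eq by (rule nn_integral_prod_generation[OF m1])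
  also have "\<dots> = ennreal (1 - hit \<theta> k 0)"
    by (rule nn_integral_tree_prod_hit[OF \<theta>])
  finally show "expectation (survival \<theta> k) = 1 - hit \<theta> k 0"
    using targetD(3)[OF target_hit[OF \<theta>], of k 0]
    by (subst (asm) ennreal_inj) (auto intro!: integral_nonneg_AE simp: survival_bounds[OF \<theta>])
qed

lemma min_position_gt:
  "ereal c < min_position N Y n \<omega> \<longleftrightarrow> (\<forall>u\<in>generation N n \<omega>. c < position Y u \<omega>)"
proof (cases "generation N n \<omega> = {}")
  case True
  then show ?thesis by (simp add: min_position_def top_ereal_def)
next
  case False
  then show ?thesis
    unfolding min_position_def by (subst finite_less_Inf_iff) (simp_all add: finite_generation)
qed

lemma survival_chi0:
  "survival (\<lambda>x. chi0 (x + - c)) n \<omega> = indicator {\<omega>. ereal c < min_position N Y n \<omega>} \<omega>"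
proof (cases "\<forall>u\<in>generation N n \<omega>. c < position Y u \<omega>")
  case True
  then show ?thesis by (auto simp: survival_def chi0_def min_position_gt intro!: prod.neutral)
next
  case False
  then obtain u where "u \<in> generation N n \<omega>" "position Y u \<omega> \<le> c" by auto
  then have "survival (\<lambda>x. chi0 (x + - c)) n \<omega> = 0"
    unfolding survival_def by (intro prod_zero finite_generation bexI[of _ u]) (auto simp: chi0_def)
  then show ?thesis using False by (simp add: min_position_gt)
qed

lemma min_position_event: "{\<omega> \<in> space P. ereal c < min_position N Y n \<omega>} \<in> sets P"
proof -
  have "{\<omega> \<in> space P. survival (\<lambda>x. chi0 (x + - c)) n \<omega> = 1} \<in> sets P"
    using survival_integral(1)[OF target_shift[OF target_chi0, of "- c"], of n] by measurable
  moreover have "{\<omega> \<in> space P. survival (\<lambda>x. chi0 (x + - c)) n \<omega> = 1} = {\<omega> \<in> space P. ereal c < min_position N Y n \<omega>}"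
    unfolding survival_chi0 by (auto split: split_indicator_asm)
  ultimately show ?thesis by simp
qed

lemma prob_min_position_gt:
  "prob {\<omega> \<in> space P. ereal c < min_position N Y n \<omega>} = 1 - hit (\<lambda>x. chi0 (x + - c)) n 0"
proof -
  have "prob {\<omega> \<in> space P. ereal c < min_position N Y n \<omega>} = expectation (indicator {\<omega> \<in> space P. ereal c < min_position N Y n \<omega>})"
    using min_position_event by simp
  also have "\<dots> = expectation (survival (\<lambda>x. chi0 (x + - c)) n)"
    by (intro Bochner_Integration.integral_cong) (auto simp: survival_chi0 simp del: add_uminus_conv_diff split: split_indicator)
  also have "\<dots> = 1 - hit (\<lambda>x. chi0 (x + - c)) n 0"
    by (rule survival_integral(3)[OF target_shift[OF target_chi0]])
  finally show ?thesis .
qed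

abbreviation W :: "nat \<Rightarrow> 'a \<Rightarrow> real" where "W \<equiv> additive_martingale N Y"

text \<open>The part of the additive martingale at time \<open>n - J\<close> carried by particles in
  the window; its exponential is the product to which the survival probability is compared.\<close>

definition W_typ :: "nat \<Rightarrow> nat \<Rightarrow> 'a \<Rightarrow> real" where
  "W_typ n J \<omega> = (\<Sum>u\<in>generation N (n - J) \<omega>. if typical n J (position Y u \<omega>) then exp (- position Y u \<omega>) else 0)"

lemma W_typ_bounds: "0 \<le> W_typ n J \<omega>" "W_typ n J \<omega> \<le> W (n - J) \<omega>"
  unfolding W_typ_def additive_martingale_def by (auto intro!: sum_nonneg sum_mono)

lemma W_nonneg: "0 \<le> W n \<omega>"
  unfolding additive_martingale_def by (intro sum_nonneg) simp

lemma W_measurable [measurable]: "W n \<in> borel_measurable P"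
proof -
  have m1: "(\<lambda>v. ennreal (exp (- v))) \<in> borel_measurable borel" by measurable
  have eq: "ennreal (W n \<omega>) = (\<Sum>u\<in>generation N n \<omega>. ennreal (exp (- (0 + position Y u \<omega>))))" for \<omega>
    by (simp add: additive_martingale_def)
  have ms: "(\<lambda>\<omega>. ennreal (W n \<omega>)) \<in> borel_measurable P"
    unfolding eq by (rule borel_measurable_sum_generation[OF m1])
  have "(\<lambda>\<omega>. enn2real (ennreal (W n \<omega>))) \<in> borel_measurable P"
    by (rule borel_measurable_enn2real[OF ms])
  then show ?thesis by (simp add: W_nonneg)
qed

lemma W_typ_measurable [measurable]: "W_typ n J \<in> borel_measurable P"
proof -
  have m1: "(\<lambda>v. ennreal (if typical n J v then exp (- v) else 0)) \<in> borel_measurable borel"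
    unfolding typical_def by measurable
  have eq: "ennreal (W_typ n J \<omega>) = (\<Sum>u\<in>generation N (n - J) \<omega>. ennreal (if typical n J (0 + position Y u \<omega>) then exp (- (0 + position Y u \<omega>)) else 0))" for \<omega>
    by (subst sum_ennreal) (simp_all add: W_typ_def cong: if_cong)
  have ms: "(\<lambda>\<omega>. ennreal (W_typ n J \<omega>)) \<in> borel_measurable P"
    unfolding eq by (rule borel_measurable_sum_generation[OF m1])
  have "(\<lambda>\<omega>. enn2real (ennreal (W_typ n J \<omega>))) \<in> borel_measurable P"
    by (rule borel_measurable_enn2real[OF ms])
  then show ?thesis by (simp add: W_typ_bounds)
qed

text \<open>Chebyshev's inequality for the tilted walk: outside the window the square of the
  deviation exceeds that of the window, and the second moment is known from
  \<open>nn_integral_tree_sum_square\<close>.\<close>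

lemma atypical_mass:
  assumes n: "1 \<le> n" "J \<le> n"
  shows "integrable P (\<lambda>\<omega>. W (n - J) \<omega> - W_typ n J \<omega>)"
    and "expectation (\<lambda>\<omega>. W (n - J) \<omega> - W_typ n J \<omega>) \<le> sigma2 * (real n / (window n)\<^sup>2)"
proof -
  define k where "k = n - J"
  define c where "c = m * real k"
  have kc: "c = m * (real n - real J)" using n by (simp add: c_def k_def of_nat_diff)
  have wn: "0 < window n" using n by (simp add: window_def)
  have m1: "(\<lambda>v. ennreal (exp (- v)) * ennreal ((v - c)\<^sup>2)) \<in> borel_measurable borel" by measurable
  have pt: "ennreal (W k \<omega> - W_typ n J \<omega>) \<le> ennreal (1 / (window n)\<^sup>2) * (\<Sum>u\<in>generation N k \<omega>. ennreal (exp (- (0 + position Y u \<omega>))) * ennreal ((0 + position Y u \<omega> - c)\<^sup>2))" for \<omega>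
  proof -
    have one: "exp (- v) - (if typical n J v then exp (- v) else 0) \<le> 1 / (window n)\<^sup>2 * (exp (- v) * (v - c)\<^sup>2)" for v
    proof (cases "typical n J v")
      case False
      then have "window n \<le> \<bar>v - c\<bar>" by (simp add: typical_def kc)
      then have "(window n)\<^sup>2 \<le> (v - c)\<^sup>2" using wn by (metis abs_le_square_iff abs_of_pos)
      then have "exp (- v) * (window n)\<^sup>2 \<le> exp (- v) * (v - c)\<^sup>2" by (intro mult_left_mono) auto
      then show ?thesis using False wn by (simp add: field_simps)
    qed simp
    have "W k \<omega> - W_typ n J \<omega> = (\<Sum>u\<in>generation N k \<omega>. exp (- position Y u \<omega>) - (if typical n J (position Y u \<omega>) then exp (- position Y u \<omega>) else 0))"
      unfolding W_typ_def additive_martingale_def k_def by (rule sum_subtractf[symmetric])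
    also have "\<dots> \<le> (\<Sum>u\<in>generation N k \<omega>. 1 / (window n)\<^sup>2 * (exp (- position Y u \<omega>) * (position Y u \<omega> - c)\<^sup>2))"
      by (intro sum_mono one)
    also have "\<dots> = 1 / (window n)\<^sup>2 * (\<Sum>u\<in>generation N k \<omega>. exp (- position Y u \<omega>) * (position Y u \<omega> - c)\<^sup>2)"
      by (rule sum_distrib_left[symmetric])
    finally have "ennreal (W k \<omega> - W_typ n J \<omega>) \<le> ennreal (1 / (window n)\<^sup>2 * (\<Sum>u\<in>generation N k \<omega>. exp (- position Y u \<omega>) * (position Y u \<omega> - c)\<^sup>2))"
      by (rule ennreal_leI)
    also have "\<dots> = ennreal (1 / (window n)\<^sup>2) * (\<Sum>u\<in>generation N k \<omega>. ennreal (exp (- position Y u \<omega>) * (position Y u \<omega> - c)\<^sup>2))"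
    proof -
      have "ennreal (1 / (window n)\<^sup>2 * (\<Sum>u\<in>generation N k \<omega>. exp (- position Y u \<omega>) * (position Y u \<omega> - c)\<^sup>2))
        = ennreal (1 / (window n)\<^sup>2) * ennreal (\<Sum>u\<in>generation N k \<omega>. exp (- position Y u \<omega>) * (position Y u \<omega> - c)\<^sup>2)"
        by (rule ennreal_mult) (auto intro!: sum_nonneg)
      moreover have "ennreal (\<Sum>u\<in>generation N k \<omega>. exp (- position Y u \<omega>) * (position Y u \<omega> - c)\<^sup>2)
        = (\<Sum>u\<in>generation N k \<omega>. ennreal (exp (- position Y u \<omega>) * (position Y u \<omega> - c)\<^sup>2))"
        by (rule sum_ennreal[symmetric]) auto
      ultimately show ?thesis by (simp only:)
    qed
    finally show ?thesis by (simp add: ennreal_mult')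
  qed
  have "(\<integral>\<^sup>+\<omega>. ennreal (W k \<omega> - W_typ n J \<omega>) \<partial>P)
    \<le> (\<integral>\<^sup>+\<omega>. ennreal (1 / (window n)\<^sup>2) * (\<Sum>u\<in>generation N k \<omega>. ennreal (exp (- (0 + position Y u \<omega>))) * ennreal ((0 + position Y u \<omega> - c)\<^sup>2)) \<partial>P)"
    by (intro nn_integral_mono pt)
  also have "\<dots> = ennreal (1 / (window n)\<^sup>2) * (\<integral>\<^sup>+\<omega>. (\<Sum>u\<in>generation N k \<omega>. ennreal (exp (- (0 + position Y u \<omega>))) * ennreal ((0 + position Y u \<omega> - c)\<^sup>2)) \<partial>P)"
    by (rule nn_integral_cmult[OF borel_measurable_sum_generation[OF m1]])
  also have "(\<integral>\<^sup>+\<omega>. (\<Sum>u\<in>generation N k \<omega>. ennreal (exp (- (0 + position Y u \<omega>))) * ennreal ((0 + position Y u \<omega> - c)\<^sup>2)) \<partial>P)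
    = (\<integral>\<^sup>+t. tree_sum (\<lambda>v. ennreal (exp (- v)) * ennreal ((v - c)\<^sup>2)) k 0 t \<partial>law.tree_law)"
    by (rule nn_integral_sum_generation[OF m1])
  also have "\<dots> = ennreal (real k * sigma2)"
    by (simp add: nn_integral_tree_sum_square c_def)
  also have "ennreal (1 / (window n)\<^sup>2) * ennreal (real k * sigma2) \<le> ennreal (sigma2 * (real n / (window n)\<^sup>2))"
  proof -
    have "real k * sigma2 \<le> real n * sigma2" using sigma2_nonneg by (intro mult_right_mono) (auto simp: k_def)
    then have "1 / (window n)\<^sup>2 * (real k * sigma2) \<le> 1 / (window n)\<^sup>2 * (real n * sigma2)" by (intro mult_left_mono) auto
    then have "ennreal (1 / (window n)\<^sup>2 * (real k * sigma2)) \<le> ennreal (sigma2 * (real n / (window n)\<^sup>2))"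
      by (intro ennreal_leI) (simp add: mult.commute)
    moreover have "ennreal (1 / (window n)\<^sup>2 * (real k * sigma2)) = ennreal (1 / (window n)\<^sup>2) * ennreal (real k * sigma2)"
      by (rule ennreal_mult) (auto simp: sigma2_nonneg)
    ultimately show ?thesis by simp
  qed
  finally have fin: "(\<integral>\<^sup>+\<omega>. ennreal (W k \<omega> - W_typ n J \<omega>) \<partial>P) \<le> ennreal (sigma2 * (real n / (window n)\<^sup>2))" .
  have pos: "0 \<le> W k \<omega> - W_typ n J \<omega>" for \<omega> using W_typ_bounds(2) by (simp add: k_def)
  have i: "integrable P (\<lambda>\<omega>. W k \<omega> - W_typ n J \<omega>)"
    by (rule integrableI_nonneg, measurable, rule AE_I2, rule pos, rule le_less_trans[OF fin], simp)
  then show "integrable P (\<lambda>\<omega>. W (n - J) \<omega> - W_typ n J \<omega>)" by (simp add: k_def)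
  have "ennreal (expectation (\<lambda>\<omega>. W k \<omega> - W_typ n J \<omega>)) \<le> ennreal (sigma2 * (real n / (window n)\<^sup>2))"
    using fin unfolding nn_integral_eq_integral[OF i AE_I2[OF pos]] .
  then show "expectation (\<lambda>\<omega>. W (n - J) \<omega> - W_typ n J \<omega>) \<le> sigma2 * (real n / (window n)\<^sup>2)"
    using sigma2_nonneg by (subst (asm) ennreal_le_iff) (auto simp: k_def)
qed

lemma W_inf_nonneg: "AE \<omega> in P. 0 \<le> W_inf \<omega>"
  using W_inf_lim
proof eventually_elim
  case (elim \<omega>)
  then show ?case by (rule LIMSEQ_le_const) (auto simp: W_nonneg)
qed

definition laplace :: "real \<Rightarrow> real" where
  "laplace c = expectation (\<lambda>\<omega>. exp (- (c * W_inf \<omega>)))"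

lemma laplace_tendsto:
  assumes "X \<longlonglongrightarrow> c" "\<And>k. 0 \<le> X k"
  shows "(\<lambda>k. laplace (X k)) \<longlonglongrightarrow> laplace c"
  unfolding laplace_def
proof (rule integral_dominated_convergence[where w="\<lambda>_. 1"])
  show "AE \<omega> in P. (\<lambda>k. exp (- (X k * W_inf \<omega>))) \<longlonglongrightarrow> exp (- (c * W_inf \<omega>))"
    by (intro AE_I2 tendsto_intros assms)
  show "AE \<omega> in P. norm (exp (- (X k * W_inf \<omega>))) \<le> 1" for k
    using W_inf_nonneg by eventually_elim (use assms(2)[of k] in simp)
qed auto

lemma exp_diff_le: "0 \<le> x \<Longrightarrow> x \<le> y \<Longrightarrow> \<bar>exp (- x) - exp (- y)\<bar> \<le> y - x" for x y :: real
proof -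
  assume xy: "0 \<le> x" "x \<le> y"
  have "1 - exp (x - y) \<le> y - x" using exp_ge_add_one_self[of "x - y"] by linarith
  then have "exp (- x) * (1 - exp (x - y)) \<le> 1 * (y - x)" using xy by (intro mult_mono) auto
  then show ?thesis using xy by (simp add: right_diff_distrib mult_exp_exp)
qed

text \<open>The full martingale converges almost surely and the exponentials are bounded by 1; the
  atypical mass vanishes in mean, and the exponential of a nonpositive argument is Lipschitz with
  constant 1.\<close>

lemma W_typ_laplace:
  assumes c: "0 \<le> c"
  shows "(\<lambda>n. expectation (\<lambda>\<omega>. exp (- (c * W_typ n J \<omega>)))) \<longlonglongrightarrow> laplace c"
proof -
  have i1: "integrable P (\<lambda>\<omega>. exp (- (c * W n \<omega>)))" for n
    using c by (intro integrable_const_bound[where B=1]) (auto simp: W_nonneg)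
  have i2: "integrable P (\<lambda>\<omega>. exp (- (c * W_typ n J \<omega>)))" for n
    using c by (intro integrable_const_bound[where B=1]) (auto simp: W_typ_bounds)
  have 1: "(\<lambda>n. expectation (\<lambda>\<omega>. exp (- (c * W n \<omega>)))) \<longlonglongrightarrow> laplace c"
    unfolding laplace_def
  proof (rule integral_dominated_convergence[where w="\<lambda>_. 1"])
    show "AE \<omega> in P. (\<lambda>n. exp (- (c * W n \<omega>))) \<longlonglongrightarrow> exp (- (c * W_inf \<omega>))"
      using W_inf_lim by eventually_elim (intro tendsto_intros)
  qed (use c in \<open>auto simp: W_nonneg\<close>)
  have 2: "(\<lambda>n. expectation (\<lambda>\<omega>. exp (- (c * W (n - J) \<omega>)))) \<longlonglongrightarrow> laplace c"
    by (rule filterlim_compose[OF 1 filterlim_minus_const_nat_at_top])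
  have "(\<lambda>n. expectation (\<lambda>\<omega>. exp (- (c * W_typ n J \<omega>))) - expectation (\<lambda>\<omega>. exp (- (c * W (n - J) \<omega>)))) \<longlonglongrightarrow> 0"
  proof (rule Lim_null_comparison)
    show "(\<lambda>n. c * (sigma2 * (real n / (window n)\<^sup>2))) \<longlonglongrightarrow> 0"
      using tendsto_mult_right_zero[OF tendsto_mult_right_zero[OF window_tendsto, of sigma2], of c] .
    show "\<forall>\<^sub>F n in sequentially. norm (expectation (\<lambda>\<omega>. exp (- (c * W_typ n J \<omega>))) - expectation (\<lambda>\<omega>. exp (- (c * W (n - J) \<omega>))))
      \<le> c * (sigma2 * (real n / (window n)\<^sup>2))"
      using eventually_ge_at_top[of 1] eventually_ge_at_top[of J]
    proof eventually_elim
      case (elim n)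
      note am = atypical_mass[OF elim]
      have "expectation (\<lambda>\<omega>. exp (- (c * W_typ n J \<omega>))) - expectation (\<lambda>\<omega>. exp (- (c * W (n - J) \<omega>)))
        = expectation (\<lambda>\<omega>. exp (- (c * W_typ n J \<omega>)) - exp (- (c * W (n - J) \<omega>)))"
        by (rule Bochner_Integration.integral_diff[symmetric, OF i2 i1])
      also have "norm \<dots> \<le> expectation (\<lambda>\<omega>. norm (exp (- (c * W_typ n J \<omega>)) - exp (- (c * W (n - J) \<omega>))))"
        by (rule integral_norm_bound)
      also have "\<dots> \<le> expectation (\<lambda>\<omega>. c * (W (n - J) \<omega> - W_typ n J \<omega>))"
      proof (rule integral_mono)
        show "integrable P (\<lambda>\<omega>. norm (exp (- (c * W_typ n J \<omega>)) - exp (- (c * W (n - J) \<omega>))))"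
          by (intro integrable_norm Bochner_Integration.integrable_diff i1 i2)
        show "integrable P (\<lambda>\<omega>. c * (W (n - J) \<omega> - W_typ n J \<omega>))"
          by (intro integrable_mult_right am)
        fix \<omega>
        show "norm (exp (- (c * W_typ n J \<omega>)) - exp (- (c * W (n - J) \<omega>))) \<le> c * (W (n - J) \<omega> - W_typ n J \<omega>)"
          using exp_diff_le[of "c * W_typ n J \<omega>" "c * W (n - J) \<omega>"] W_typ_bounds c
          by (simp add: mult_left_mono right_diff_distrib)
      qed
      also have "\<dots> = c * expectation (\<lambda>\<omega>. W (n - J) \<omega> - W_typ n J \<omega>)"
        by (rule Bochner_Integration.integral_mult_right_zero)
      also have "\<dots> \<le> c * (sigma2 * (real n / (window n)\<^sup>2))"
        by (intro mult_left_mono am c)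
      finally show ?case .
    qed
  qed
  from tendsto_add[OF this 2] show ?thesis by simp
qed

definition Ctot :: real where "Ctot = (\<Sum>j. \<integral>w. tilt j w \<partial>lborel)"

lemma Cpart_le: "Cpart J \<le> Ctot"
  unfolding Cpart_def Ctot_def
  by (intro sum_le_suminf tilt_integral_summable) (auto intro!: integral_nonneg_AE simp: tilt_nonneg)

lemma Cpart_tendsto: "Cpart \<longlonglongrightarrow> Ctot"
  unfolding Cpart_def[abs_def] Ctot_def by (rule summable_LIMSEQ[OF tilt_integral_summable])

definition full_rate :: "real \<Rightarrow> real" where
  "full_rate xx = l_inf * Ctot * (m powr a * exp xx)"

lemma full_rate_tendsto: "limit_rate xx \<longlonglongrightarrow> full_rate xx"
  unfolding limit_rate_def[abs_def] full_rate_def by (intro tendsto_intros Cpart_tendsto)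

lemma limit_rate_le: "limit_rate xx J \<le> full_rate xx"
  unfolding limit_rate_def full_rate_def
  by (intro mult_right_mono mult_left_mono Cpart_le l_inf_nonneg) auto

lemma Ctot_nonneg: "0 \<le> Ctot"
  using Cpart_nonneg Cpart_le order_trans by blast

lemma exp_WT: "exp (- (c * W_typ n J \<omega>)) = (\<Prod>u\<in>generation N (n - J) \<omega>. if typical n J (position Y u \<omega>) then exp (- (c * exp (- position Y u \<omega>))) else 1)"
proof -
  have "- (c * W_typ n J \<omega>) = (\<Sum>u\<in>generation N (n - J) \<omega>. if typical n J (position Y u \<omega>) then - (c * exp (- position Y u \<omega>)) else 0)"
    unfolding W_typ_def sum_distrib_left sum_negf[symmetric] by (intro sum.cong) auto
  then have "exp (- (c * W_typ n J \<omega>)) = (\<Prod>u\<in>generation N (n - J) \<omega>. exp (if typical n J (position Y u \<omega>) then - (c * exp (- position Y u \<omega>)) else 0))"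
    by (simp only: exp_sum[OF finite_generation])
  then show ?thesis by (simp add: if_distrib cong: if_cong)
qed

text \<open>A \<open>c\<close> below the full rate is already below the rate of some fixed
  \<open>J\<close>. Atypical particles contribute factors of at most 1, and on the other side their
  factor is 1, so only typical ones have to be compared.\<close>

lemma prob_upper:
  assumes c: "0 \<le> c" "c < full_rate xx" and e: "0 < e"
  shows "\<forall>\<^sub>F n in sequentially. prob {\<omega> \<in> space P. ereal (level xx n) < min_position N Y n \<omega>} < laplace c + e"
proof -
  obtain J where J: "c < limit_rate xx J"
    using order_tendstoD(1)[OF full_rate_tendsto c(2)] by (auto simp: eventually_sequentially)
  have "\<forall>\<^sub>F n in sequentially. expectation (\<lambda>\<omega>. exp (- (c * W_typ n J \<omega>))) < laplace c + e"
    using e by (intro order_tendstoD(2)[OF W_typ_laplace[OF c(1)]]) auto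
  then show ?thesis
    using typical_lower[OF c(1) J] eventually_ge_at_top[of J]
  proof eventually_elim
    case (elim n)
    have "prob {\<omega> \<in> space P. ereal (level xx n) < min_position N Y n \<omega>} = 1 - hit (hit_level xx n J) (n - J) 0"
      unfolding prob_min_position_gt hit_level_def hit_add using elim(3) by simp
    also have "\<dots> = expectation (survival (hit_level xx n J) (n - J))"
      by (rule survival_integral(3)[OF target_hit_level, symmetric])
    also have "\<dots> \<le> expectation (\<lambda>\<omega>. exp (- (c * W_typ n J \<omega>)))"
    proof (rule integral_mono)
      show "integrable P (survival (hit_level xx n J) (n - J))" by (rule survival_integral(2)[OF target_hit_level])
      show "integrable P (\<lambda>\<omega>. exp (- (c * W_typ n J \<omega>)))"
        using c by (intro integrable_const_bound[where B=1]) (auto simp: W_typ_bounds)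
      fix \<omega>
      show "survival (hit_level xx n J) (n - J) \<omega> \<le> exp (- (c * W_typ n J \<omega>))"
        unfolding survival_def exp_WT
        by (intro prod_mono) (use elim(2) targetD(2,3)[OF target_hit_level[of xx n J]] in auto)
    qed
    finally show ?case using elim(1) by simp
  qed
qed

text \<open>Every \<open>limit_rate xx J\<close> is below \<open>c\<close>, so \<open>J\<close> is
  dictated by \<open>atypical_small\<close> alone. Passing to \<open>hit_typ\<close> replaces the
  factors of atypical particles by 1, which could not be afforded pointwise but costs little in
  expectation.\<close>

lemma prob_lower:
  assumes c: "full_rate xx < c" and e: "0 < e"
  shows "\<forall>\<^sub>F n in sequentially. laplace c - e < prob {\<omega> \<in> space P. ereal (level xx n) < min_position N Y n \<omega>}"
proof -
  obtain J where J: "\<forall>\<^sub>F n in sequentially. hit_level xx n n 0 - hit (hit_typ xx n J) (n - J) 0 < e / 2"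
    using atypical_small[of "e / 2" xx] e by (metis half_gt_zero order_refl)
  have cJ: "limit_rate xx J < c" using limit_rate_le[of xx J] c by simp
  have "0 \<le> full_rate xx" unfolding full_rate_def using l_inf_nonneg Ctot_nonneg by simp
  then have c0: "0 \<le> c" using c by simp
  have "\<forall>\<^sub>F n in sequentially. laplace c - e / 2 < expectation (\<lambda>\<omega>. exp (- (c * W_typ n J \<omega>)))"
    using e by (intro order_tendstoD(1)[OF W_typ_laplace[OF c0]]) auto
  then show ?thesis
    using typical_upper[OF cJ] J
  proof eventually_elim
    case (elim n)
    have p: "prob {\<omega> \<in> space P. ereal (level xx n) < min_position N Y n \<omega>} = 1 - hit_level xx n n 0"
      unfolding prob_min_position_gt hit_level_def by simp
    have "expectation (\<lambda>\<omega>. exp (- (c * W_typ n J \<omega>))) \<le> expectation (survival (hit_typ xx n J) (n - J))"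
    proof (rule integral_mono)
      show "integrable P (survival (hit_typ xx n J) (n - J))" by (rule survival_integral(2)[OF target_hit_typ])
      show "integrable P (\<lambda>\<omega>. exp (- (c * W_typ n J \<omega>)))"
        using c0 by (intro integrable_const_bound[where B=1]) (auto simp: W_typ_bounds)
      fix \<omega>
      show "exp (- (c * W_typ n J \<omega>)) \<le> survival (hit_typ xx n J) (n - J) \<omega>"
        unfolding survival_def exp_WT
        by (intro prod_mono) (use elim(2) in \<open>auto simp: hit_typ_def\<close>)
    qed
    also have "\<dots> = 1 - hit (hit_typ xx n J) (n - J) 0"
      by (rule survival_integral(3)[OF target_hit_typ])
    finally show ?case using elim(1,3) unfolding p by linarith
  qed
qed

text \<open>The zeroth term is already positive, because \<open>tilt 0\<close> is positive on the
  negative half-line. Positivity of the full rate lets it be approached from below by nonnegative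
  rates.\<close>

lemma Ctot_pos: "0 < Ctot"
proof -
  have "0 < Cpart 1"
  proof -
    have "(\<integral>w. tilt 0 w \<partial>lborel) \<noteq> 0"
    proof
      assume "(\<integral>w. tilt 0 w \<partial>lborel) = 0"
      then have "AE w in lborel. tilt 0 w = 0"
        using integral_nonneg_eq_0_iff_AE[OF tilt_lborel_integrable[of 0]] by (simp add: tilt_nonneg)
      then have "AE w in lborel. \<not> w \<in> {-1..0::real}"
        by eventually_elim (auto simp: tilt_def chi0_def split: split_indicator_asm)
      then have "emeasure lborel {-1..0::real} = 0"
        by (subst (asm) AE_iff_measurable[of "{-1..0::real}"]) auto
      then show False by simp
    qed
    moreover have "0 \<le> (\<integral>w. tilt 0 w \<partial>lborel)" by (intro integral_nonneg_AE) (simp add: tilt_nonneg)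
    ultimately show ?thesis by (simp add: Cpart_def)
  qed
  then show ?thesis using Cpart_le[of 1] by linarith
qed

lemma prob_tendsto:
  assumes l_inf: "0 < l_inf"
  shows "(\<lambda>n. prob {\<omega> \<in> space P. ereal (level xx n) < min_position N Y n \<omega>}) \<longlonglongrightarrow> laplace (full_rate xx)"
proof (rule order_tendstoI)
  have fr: "0 < full_rate xx" using l_inf Ctot_pos m_pos by (simp add: full_rate_def)
  fix y assume y: "y < laplace (full_rate xx)"
  have "(\<lambda>k. laplace (full_rate xx + 1 / real (Suc k))) \<longlonglongrightarrow> laplace (full_rate xx)"
  proof (rule laplace_tendsto)
    show "(\<lambda>k. full_rate xx + 1 / real (Suc k)) \<longlonglongrightarrow> full_rate xx"
      using tendsto_add[OF tendsto_const LIMSEQ_Suc[OF lim_1_over_n], of "full_rate xx"] by simp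
  qed (use fr in simp)
  from order_tendstoD(1)[OF this y] obtain k where k: "y < laplace (full_rate xx + 1 / real (Suc k))"
    by (auto simp: eventually_sequentially)
  define c where "c = full_rate xx + 1 / real (Suc k)"
  have "\<forall>\<^sub>F n in sequentially. laplace c - (laplace c - y) < prob {\<omega> \<in> space P. ereal (level xx n) < min_position N Y n \<omega>}"
    using k by (intro prob_lower) (auto simp: c_def)
  then show "\<forall>\<^sub>F n in sequentially. y < prob {\<omega> \<in> space P. ereal (level xx n) < min_position N Y n \<omega>}" by simp
next
  have fr: "0 < full_rate xx" using l_inf Ctot_pos m_pos by (simp add: full_rate_def)
  fix y assume y: "laplace (full_rate xx) < y"
  \<comment> \<open>A multiplicative perturbation keeps the rates nonnegative, which the domination
    in \<open>laplace_tendsto\<close> requires.\<close>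
  have "(\<lambda>k. laplace (full_rate xx * (1 - 1 / real (Suc k)))) \<longlonglongrightarrow> laplace (full_rate xx)"
  proof (rule laplace_tendsto)
    have "(\<lambda>k. full_rate xx * (1 - 1 / real (Suc k))) \<longlonglongrightarrow> full_rate xx * (1 - 0)"
      by (intro tendsto_intros LIMSEQ_Suc[OF lim_1_over_n])
    then show "(\<lambda>k. full_rate xx * (1 - 1 / real (Suc k))) \<longlonglongrightarrow> full_rate xx" by simp
  qed (use fr in simp)
  from order_tendstoD(2)[OF this y] obtain k where k: "laplace (full_rate xx * (1 - 1 / real (Suc k))) < y"
    by (auto simp: eventually_sequentially)
  define c where "c = full_rate xx * (1 - 1 / real (Suc k))"
  have "c < full_rate xx * 1" unfolding c_def using fr by (intro mult_strict_left_mono) auto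
  moreover have "0 \<le> c" unfolding c_def using fr by simp
  ultimately have "\<forall>\<^sub>F n in sequentially. prob {\<omega> \<in> space P. ereal (level xx n) < min_position N Y n \<omega>} < laplace c + (y - laplace c)"
    using k by (intro prob_upper) (auto simp: c_def)
  then show "\<forall>\<^sub>F n in sequentially. prob {\<omega> \<in> space P. ereal (level xx n) < min_position N Y n \<omega>} < y" by simp
qed

end

section \<open>Identification of C_star\<close>

lemma nn_integral_exp_atMost: "(\<integral>\<^sup>+w. ennreal (exp w) * indicator {..c} w \<partial>lborel) = ennreal (exp c)" for c :: real
proof -
  have "(\<integral>\<^sup>+w. ennreal (exp w) * indicator {..c} w \<partial>lborel)
    = (\<integral>\<^sup>+w. ennreal (exp (0 + (- 1) * w)) * indicator {..c} (0 + (- 1) * w) \<partial>lborel)"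
    by (subst nn_integral_real_affine[where c="- 1" and t=0]) auto
  also have "\<dots> = (\<integral>\<^sup>+w. ennreal (exp (- w)) * indicator {- c..} w \<partial>lborel)"
    by (intro nn_integral_cong) (auto split: split_indicator)
  also have "\<dots> = ennreal (0 - (- exp (- (- c))))"
  proof (rule nn_integral_FTC_atLeast)
    show "((\<lambda>x. - exp (- x)) has_real_derivative exp (- x)) (at x)" if "- c \<le> x" for x :: real
      by (auto intro!: derivative_eq_intros)
    have "((\<lambda>x::real. - exp (- x)) \<longlongrightarrow> - 0) at_top"
      by (intro tendsto_minus filterlim_compose[OF exp_at_bot filterlim_uminus_at_bot_at_top])
    then show "((\<lambda>x::real. - exp (- x)) \<longlongrightarrow> 0) at_top" by simp
  qed auto
  finally show ?thesis by simp
qed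

context brw_tail
begin

lemma min_position_MInf: "min_position N Y n \<omega> \<noteq> - \<infinity>"
proof (cases "generation N n \<omega> = {}")
  case True
  then show ?thesis by (simp add: min_position_def top_ereal_def)
next
  case False
  then have "- \<infinity> < min_position N Y n \<omega>"
    unfolding min_position_def by (subst finite_less_Inf_iff) (simp_all add: finite_generation)
  then show ?thesis by simp
qed

lemma min_position_measurable: "min_position N Y n \<in> borel_measurable P"
proof (rule borel_measurableI_greater)
  fix y :: ereal
  show "{\<omega> \<in> space P. y < min_position N Y n \<omega>} \<in> sets P"
  proof (cases y)
    case (real r)
    then show ?thesis using min_position_event[of r n] by simp
  next
    case PInf
    then show ?thesis by simp
  next
    case MInf
    then show ?thesis using min_position_MInf by simp
  qed
qed

text \<open>Layer-cake representation with respect to the exponential; for an infinite minimum both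
  sides vanish.\<close>

lemma exp_neg_layer:
  assumes "z \<noteq> - \<infinity>"
  shows "ennreal (exp_neg z) = (\<integral>\<^sup>+w. ennreal (exp w) * indicator {w. z \<le> ereal (- w)} w \<partial>lborel)"
proof (cases z)
  case (real r)
  have "{w. z \<le> ereal (- w)} = {..- r}" using real by auto
  then show ?thesis using real nn_integral_exp_atMost[of "- r"] by (simp add: exp_neg_def)
next
  case PInf
  then show ?thesis by (simp add: exp_neg_def)
qed (use assms in simp)

text \<open>Exchanging the layer-cake integral with the expectation leaves \<open>exp w\<close>
  times the probability that the minimum is at most \<open>- w\<close>.\<close>

lemma nn_integral_exp_neg:
  "(\<integral>\<^sup>+\<omega>. ennreal (exp_neg (min_position N Y j \<omega>)) \<partial>P) = ennreal (\<integral>w. tilt j w \<partial>lborel)"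
proof -
  interpret pair_sigma_finite P lborel ..
  note [measurable] = min_position_measurable
  have meas: "case_prod (\<lambda>\<omega> w. ennreal (exp w) * indicator {\<omega> \<in> space P. min_position N Y j \<omega> \<le> ereal (- w)} \<omega>) \<in> borel_measurable (P \<Otimes>\<^sub>M lborel)"
    by measurable
  have "(\<integral>\<^sup>+\<omega>. ennreal (exp_neg (min_position N Y j \<omega>)) \<partial>P)
    = (\<integral>\<^sup>+\<omega>. \<integral>\<^sup>+w. ennreal (exp w) * indicator {\<omega> \<in> space P. min_position N Y j \<omega> \<le> ereal (- w)} \<omega> \<partial>lborel \<partial>P)"
    by (intro nn_integral_cong) (auto simp: exp_neg_layer[OF min_position_MInf] intro!: nn_integral_cong split: split_indicator)
  also have "\<dots> = (\<integral>\<^sup>+w. \<integral>\<^sup>+\<omega>. ennreal (exp w) * indicator {\<omega> \<in> space P. min_position N Y j \<omega> \<le> ereal (- w)} \<omega> \<partial>P \<partial>lborel)"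
    by (rule Fubini'[OF meas, symmetric])
  also have "\<dots> = (\<integral>\<^sup>+w. ennreal (tilt j w) \<partial>lborel)"
  proof (rule nn_integral_cong)
    fix w :: real
    have e: "{\<omega> \<in> space P. min_position N Y j \<omega> \<le> ereal (- w)} = space P - {\<omega> \<in> space P. ereal (- w) < min_position N Y j \<omega>}"
      by auto
    have "prob {\<omega> \<in> space P. min_position N Y j \<omega> \<le> ereal (- w)} = hit chi0 j w"
      unfolding e using prob_compl[OF min_position_event[of "- w" j]] hit_shift[of chi0 w j 0]
      by (simp add: prob_min_position_gt)
    moreover have "(\<integral>\<^sup>+\<omega>. ennreal (exp w) * indicator {\<omega> \<in> space P. min_position N Y j \<omega> \<le> ereal (- w)} \<omega> \<partial>P)
      = ennreal (exp w) * emeasure P {\<omega> \<in> space P. min_position N Y j \<omega> \<le> ereal (- w)}"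
      by (rule nn_integral_cmult_indicator) measurable
    ultimately show "(\<integral>\<^sup>+\<omega>. ennreal (exp w) * indicator {\<omega> \<in> space P. min_position N Y j \<omega> \<le> ereal (- w)} \<omega> \<partial>P) = ennreal (tilt j w)"
      by (simp add: emeasure_eq_measure tilt_def ennreal_mult')
  qed
  also have "\<dots> = ennreal (\<integral>w. tilt j w \<partial>lborel)"
    by (rule nn_integral_eq_integral[OF tilt_lborel_integrable]) (simp add: tilt_nonneg)
  finally show ?thesis .
qed

lemma C_star_eq: "C_star P N Y = ennreal Ctot"
  unfolding C_star_def nn_integral_exp_neg Ctot_def
  by (rule suminf_ennreal2[OF _ tilt_integral_summable]) (auto intro!: integral_nonneg_AE simp: tilt_nonneg)

end

section \<open>The moment assumptions\<close>

lemma (in branching_random_walk) nn_integral_first_generation: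
  assumes g: "g \<in> borel_measurable borel"
  shows "(\<integral>\<^sup>+\<omega>. (\<Sum>u\<in>generation N 1 \<omega>. g (position Y u \<omega>)) \<partial>P)
    = (\<integral>\<^sup>+n. of_nat n \<partial>measure_pmf nu) * (\<integral>\<^sup>+y. g y \<partial>mu)"
proof -
  have e: "(\<integral>\<^sup>+t. g (0 + y) \<partial>law.tree_law) = g y" for y
    by (simp add: law.tree.emeasure_space_1 flip: law.space_tree_law)
  have "(\<integral>\<^sup>+\<omega>. (\<Sum>u\<in>generation N (Suc 0) \<omega>. g (0 + position Y u \<omega>)) \<partial>P) = (\<integral>\<^sup>+t. tree_sum g (Suc 0) 0 t \<partial>law.tree_law)"
    by (rule nn_integral_sum_generation[OF g])
  also have "\<dots> = (\<integral>\<^sup>+n. of_nat n \<partial>measure_pmf nu) * (\<integral>\<^sup>+y. \<integral>\<^sup>+t. tree_sum g 0 (0 + y) t \<partial>law.tree_law \<partial>mu)"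
    by (rule law.nn_integral_tree_sum_Suc[OF g])
  finally show ?thesis by (simp only: tree_sum.simps e) (simp add: One_nat_def)
qed

lemma elog_eq_0: "elog z = 0 \<Longrightarrow> z = 1"
proof -
  assume e: "elog z = 0"
  then have z: "z \<noteq> 0" "z \<noteq> \<infinity>" "ln (enn2real z) = 0" by (auto simp: elog_def zero_ereal_def split: if_splits)
  then have "0 < enn2real z" by (simp add: enn2real_positive_iff top.not_eq_extremum zero_less_iff_neq_zero)
  with z have "enn2real z = 1" by simp
  then show "z = 1" using z by (metis ennreal_1 ennreal_enn2real_if infinity_ennreal_def)
qed

text \<open>\<open>real_of_ereal\<close> sends infinite values to 0, so a nonzero real value
  certifies that the Laplace transform is finite.\<close>

lemma real_of_elog: "real_of_ereal (elog z) \<noteq> 0 \<Longrightarrow> z \<noteq> \<infinity>"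
  by (auto simp: elog_def)

lemma real_of_elog_ennreal: "0 < r \<Longrightarrow> real_of_ereal (elog (ennreal r)) = ln r"
  by (simp add: elog_def)

text \<open>The right derivative at 0 of the log-Laplace transform is the mean. Dominated
  convergence treats the difference quotient of the transform, and the bounds
  \<open>1 - 1 / I\<close> and \<open>I - 1\<close> on the logarithm transfer the limit.\<close>

lemma exp_mean_slope:
  fixes R :: "real measure"
  assumes prob: "prob_space R" and sets [measurable_cong, simp]: "sets R = sets borel"
    and s1: "0 < s1" "integrable R (\<lambda>x. exp (s1 * x))" and int: "integrable R (\<lambda>x. x)"
    and s: "\<And>k. 0 < s k" "s \<longlonglongrightarrow> 0"
  shows "(\<lambda>k. ln (\<integral>x. exp (s k * x) \<partial>R) / s k) \<longlonglongrightarrow> (\<integral>x. x \<partial>R)"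
proof -
  interpret prob_space R by (rule prob)
  have sp: "space R = UNIV" using sets_eq_imp_space_eq[OF sets] by simp
  have R1: "measure R UNIV = 1" using prob_space sp by simp
  have "\<forall>\<^sub>F k in sequentially. s k < s1 / 2" using s s1 by (intro order_tendstoD(2)[OF s(2)]) auto
  then obtain K where K: "\<And>k. K \<le> k \<Longrightarrow> s k < s1 / 2" by (auto simp: eventually_sequentially)
  define I where "I k = (\<integral>x. exp (s k * x) \<partial>R)" for k
  \<comment> \<open>For positive \<open>x\<close> the quotient is at most
    \<open>x * exp (t * x)\<close>; restricting \<open>t\<close> to half of \<open>s1\<close> leaves
    the other half to absorb the factor \<open>x\<close>.\<close>
  have bound: "\<bar>(exp (t * x) - 1) / t\<bar> \<le> \<bar>x\<bar> + 2 / s1 * exp (s1 * x)" if t: "0 < t" "t \<le> s1 / 2" for t x :: real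
  proof (cases "0 \<le> x")
    case True
    have "1 - t * x \<le> exp (- (t * x))" using exp_ge_add_one_self[of "- (t * x)"] by simp
    then have "(1 - t * x) * exp (t * x) \<le> exp (- (t * x)) * exp (t * x)" by (intro mult_right_mono) auto
    then have "exp (t * x) - 1 \<le> t * (x * exp (t * x))" by (simp add: mult_exp_exp algebra_simps)
    then have "(exp (t * x) - 1) / t \<le> x * exp (t * x)" using t by (simp add: divide_le_eq mult.commute)
    also have "\<dots> \<le> x * exp (s1 / 2 * x)"
      using mult_right_mono[OF t(2) True] by (intro mult_left_mono True) (simp only: exp_le_cancel_iff)
    also have "\<dots> \<le> 2 / s1 * exp (s1 / 2 * x) * exp (s1 / 2 * x)"
    proof (rule mult_right_mono)
      show "x \<le> 2 / s1 * exp (s1 / 2 * x)"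
        using exp_ge_add_one_self[of "s1 / 2 * x"] s1 by (simp add: field_simps)
    qed simp
    also have "\<dots> = 2 / s1 * exp (s1 * x)" by (simp add: mult_exp_exp mult.assoc)
    finally have "(exp (t * x) - 1) / t \<le> 2 / s1 * exp (s1 * x)" .
    moreover have "0 \<le> (exp (t * x) - 1) / t" using True t by simp
    ultimately show ?thesis by simp
  next
    case False
    have "exp (t * x) \<le> 1" using False t by (simp add: mult_nonneg_nonpos)
    then have "\<bar>(exp (t * x) - 1) / t\<bar> = (1 - exp (t * x)) / t" using t by (simp add: abs_div_pos)
    also have "\<dots> \<le> - x" using exp_ge_add_one_self[of "t * x"] t by (simp add: divide_le_eq algebra_simps)
    also have "\<dots> \<le> \<bar>x\<bar> + 2 / s1 * exp (s1 * x)" using False s1 by simp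
    finally show ?thesis .
  qed
  have i: "integrable R (\<lambda>x. exp (s (k + K) * x))" for k
  proof (rule Bochner_Integration.integrable_bound)
    show "integrable R (\<lambda>x. 1 + exp (s1 * x))" using s1 by simp
    have "exp (s (k + K) * x) \<le> 1 + exp (s1 * x)" for x
    proof (cases "0 \<le> x")
      case True
      then have "s (k + K) * x \<le> s1 * x" using K[of "k + K"] s1 by (intro mult_right_mono) auto
      then have "exp (s (k + K) * x) \<le> exp (s1 * x)" by simp
      then show ?thesis by (simp add: add_increasing)
    next
      case False
      then have "s (k + K) * x \<le> 0" using s(1)[of "k + K"] by (simp add: mult_nonneg_nonpos)
      then show ?thesis by (simp add: add_increasing2)
    qed
    then show "AE x in R. norm (exp (s (k + K) * x)) \<le> norm (1 + exp (s1 * x))" by (intro AE_I2) simp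
  qed simp
  have slope: "(\<lambda>k. (I (k + K) - 1) / s (k + K)) \<longlonglongrightarrow> (\<integral>x. x \<partial>R)"
  proof -
    have "(\<lambda>k. \<integral>x. (exp (s (k + K) * x) - 1) / s (k + K) \<partial>R) \<longlonglongrightarrow> (\<integral>x. x \<partial>R)"
    proof (rule integral_dominated_convergence[where w="\<lambda>x. \<bar>x\<bar> + 2 / s1 * exp (s1 * x)"])
      show "integrable R (\<lambda>x. \<bar>x\<bar> + 2 / s1 * exp (s1 * x))" using s1 int by simp
      show "AE x in R. norm ((exp (s (k + K) * x) - 1) / s (k + K)) \<le> \<bar>x\<bar> + 2 / s1 * exp (s1 * x)" for k
        using bound[of "s (k + K)"] K[of "k + K"] s(1) by (intro AE_I2) (simp add: less_imp_le)
      show "AE x in R. (\<lambda>k. (exp (s (k + K) * x) - 1) / s (k + K)) \<longlonglongrightarrow> x"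
      proof (rule AE_I2)
        fix x
        have "((\<lambda>t. exp (t * x)) has_real_derivative x) (at 0)"
          by (auto intro!: derivative_eq_intros)
        then have "((\<lambda>t. (exp (t * x) - exp (0 * x)) / (t - 0)) \<longlongrightarrow> x) (at 0)"
          by (simp only: has_field_derivative_iff)
        moreover have "filterlim (\<lambda>k. s (k + K)) (at 0) sequentially"
          using LIMSEQ_ignore_initial_segment[OF s(2), of K] s(1) by (auto simp: filterlim_at less_imp_neq[symmetric] intro!: always_eventually)
        ultimately have "(\<lambda>k. (exp (s (k + K) * x) - exp (0 * x)) / (s (k + K) - 0)) \<longlonglongrightarrow> x"
          by (rule filterlim_compose)
        then show "(\<lambda>k. (exp (s (k + K) * x) - 1) / s (k + K)) \<longlonglongrightarrow> x" by simp
      qed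
    qed auto
    moreover have "(\<integral>x. (exp (s (k + K) * x) - 1) / s (k + K) \<partial>R) = (I (k + K) - 1) / s (k + K)" for k
      using i[of k] by (simp add: I_def R1 sp)
    ultimately show ?thesis by (simp only:)
  qed
  have Ipos: "0 < I (k + K)" for k
  proof -
    have "0 \<le> I (k + K)" unfolding I_def by (intro integral_nonneg_AE) auto
    moreover have "I (k + K) \<noteq> 0"
    proof
      assume "I (k + K) = 0"
      then have "AE x in R. exp (s (k + K) * x) = 0"
        unfolding I_def using integral_nonneg_eq_0_iff_AE[OF i[of k]] by simp
      then show False using AE_False by simp
    qed
    ultimately show ?thesis by simp
  qed
  have "(\<lambda>k. s (k + K) * ((I (k + K) - 1) / s (k + K))) \<longlonglongrightarrow> 0 * (\<integral>x. x \<partial>R)"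
    by (intro tendsto_mult LIMSEQ_ignore_initial_segment s slope)
  then have "(\<lambda>k. 1 + s (k + K) * ((I (k + K) - 1) / s (k + K))) \<longlonglongrightarrow> 1 + 0"
    by (intro tendsto_add tendsto_const) simp
  moreover have "1 + s (k + K) * ((I (k + K) - 1) / s (k + K)) = I (k + K)" for k using s(1)[of "k + K"] by simp
  ultimately have I1: "(\<lambda>k. I (k + K)) \<longlonglongrightarrow> 1" by simp
  have lower: "(\<lambda>k. ((I (k + K) - 1) / s (k + K)) / I (k + K)) \<longlonglongrightarrow> (\<integral>x. x \<partial>R) / 1"
    by (intro tendsto_divide slope I1) simp
  have "(\<lambda>k. ln (I (k + K)) / s (k + K)) \<longlonglongrightarrow> (\<integral>x. x \<partial>R)"
  proof (rule tendsto_sandwich[OF _ _ _ slope])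
    show "(\<lambda>k. ((I (k + K) - 1) / s (k + K)) / I (k + K)) \<longlonglongrightarrow> (\<integral>x. x \<partial>R)" using lower by simp
    show "\<forall>\<^sub>F k in sequentially. ln (I (k + K)) / s (k + K) \<le> (I (k + K) - 1) / s (k + K)"
      using ln_le_minus_one Ipos s(1) by (intro always_eventually allI divide_right_mono) (auto simp: less_imp_le)
    show "\<forall>\<^sub>F k in sequentially. ((I (k + K) - 1) / s (k + K)) / I (k + K) \<le> ln (I (k + K)) / s (k + K)"
    proof (intro always_eventually allI)
      fix k
      have "ln (inverse (I (k + K))) \<le> inverse (I (k + K)) - 1" using Ipos by (intro ln_le_minus_one) simp
      moreover have "ln (inverse (I (k + K))) = - ln (I (k + K))" using Ipos[of k] by (simp only: ln_inverse)
      moreover have "(I (k + K) - 1) / I (k + K) = 1 - inverse (I (k + K))" using Ipos[of k] by (simp add: field_simps)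
      ultimately have "(I (k + K) - 1) / I (k + K) \<le> ln (I (k + K))" by linarith
      then have "((I (k + K) - 1) / I (k + K)) / s (k + K) \<le> ln (I (k + K)) / s (k + K)"
        using s(1)[of "k + K"] by (intro divide_right_mono) (auto simp: less_imp_le)
      then show "((I (k + K) - 1) / s (k + K)) / I (k + K) \<le> ln (I (k + K)) / s (k + K)" by (simp add: mult.commute)
    qed
  qed
  then show ?thesis unfolding I_def by (rule LIMSEQ_offset)
qed

text \<open>Uniqueness of measures on the generator of closed left half-lines. Both measures are
  first restricted to the half-line ending in \<open>c\<close>, because the tail formula is known
  only there.\<close>

lemma emeasure_eq_atMost_density:
  fixes R :: "real measure"
  assumes fin: "finite_measure R" and sets: "sets R = sets borel" and f [measurable]: "f \<in> borel_measurable borel"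
    and tail: "\<And>z. z \<le> c \<Longrightarrow> emeasure R {..z} = (\<integral>\<^sup>+y\<in>{..z}. f y \<partial>lborel)"
    and A: "A \<in> sets borel" "A \<subseteq> {..c}"
  shows "emeasure R A = (\<integral>\<^sup>+y\<in>A. f y \<partial>lborel)"
proof -
  interpret finite_measure R by (rule fin)
  define m1 where "m1 = density R (indicator {..c})"
  define m2 where "m2 = density lborel (\<lambda>y. f y * indicator {..c} y)"
  have e1: "emeasure m1 B = emeasure R (B \<inter> {..c})" if "B \<in> sets borel" for B
  proof -
    have "emeasure m1 B = (\<integral>\<^sup>+x. indicator {..c} x * indicator B x \<partial>R)"
      unfolding m1_def using that sets by (subst emeasure_density) (auto simp: measurable_cong_sets[OF sets refl])
    also have "\<dots> = (\<integral>\<^sup>+x. indicator (B \<inter> {..c}) x \<partial>R)"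
      by (intro nn_integral_cong) (auto split: split_indicator)
    also have "\<dots> = emeasure R (B \<inter> {..c})" by (rule nn_integral_indicator) (use that sets in auto)
    finally show ?thesis .
  qed
  have e2: "emeasure m2 B = (\<integral>\<^sup>+y\<in>B \<inter> {..c}. f y \<partial>lborel)" if "B \<in> sets borel" for B
    unfolding m2_def using that by (subst emeasure_density) (auto intro!: nn_integral_cong split: split_indicator)
  have "m1 = m2"
  proof (rule measure_eqI_generator_eq[where \<Omega>=UNIV and E="range atMost" and A="\<lambda>i. {..real i}"])
    show "Int_stable (range atMost :: real set set)"
      by (auto simp: Int_stable_def)
    have sg: "sets (borel :: real measure) = sigma_sets UNIV (range atMost)"
      by (subst borel_eq_atMost) (rule sets_measure_of, simp)
    show "sets m1 = sigma_sets UNIV (range atMost)" "sets m2 = sigma_sets UNIV (range atMost)"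
      using sets sg by (simp_all add: m1_def m2_def)
    show "emeasure m1 X = emeasure m2 X" if X: "X \<in> range atMost" for X
    proof -
      obtain z where z: "X = {..z}" using X by auto
      have "X \<inter> {..c} = {..min z c}" using z by auto
      then show ?thesis using tail[of "min z c"] z by (simp add: e1 e2)
    qed
    show "emeasure m1 {..real i} \<noteq> \<infinity>" for i by (simp add: e1)
    show "(\<Union>i. {..real i}) = UNIV" by (auto simp: real_arch_simple)
  qed auto
  then have "emeasure m1 A = emeasure m2 A" by simp
  moreover have "A \<inter> {..c} = A" using A by auto
  ultimately show ?thesis using A by (simp add: e1 e2)
qed

theorem corollary1p3:
  fixes P :: "'a measure"
    and nu :: "nat pmf"
    and mu :: "real measure"
    and N :: "nat list \<Rightarrow> 'a \<Rightarrow> nat"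
    and Y :: "nat list \<Rightarrow> nat \<Rightarrow> 'a \<Rightarrow> real"
    and PX :: "'b measure"
    and X :: "'b \<Rightarrow> real"
    and W_inf :: "'a \<Rightarrow> real"
    and l :: "real \<Rightarrow> real"
    and m a lam b x\<^sub>0 l_inf x :: real
  assumes brw: "branching_random_walk P nu mu N Y"
    and mean_integrable: "integrable (measure_pmf nu) real"
    and mean_gt_1: "1 < measure_pmf.expectation nu real"
    and nonlattice: "\<not> (\<exists>h>0. AE \<omega> in P. \<forall>u\<in>generation N 1 \<omega>. \<exists>k::int. position Y u \<omega> = h * of_int k)"
    and phi_1: "log_laplace P N Y 1 = 0"
    and phi_left_deriv:
      "((\<lambda>\<beta>. real_of_ereal (log_laplace P N Y \<beta>)) has_real_derivative (- m)) (at_left 1)"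
    and m_pos: "0 < m"
    and phi_inf: "\<And>\<beta>. 1 < \<beta> \<Longrightarrow> log_laplace P N Y \<beta> = \<infinity>"
    and PX_prob: "prob_space PX"
    and X_rv: "X \<in> borel_measurable PX"
    and X_law: "\<And>g :: real \<Rightarrow> real. g \<in> borel_measurable borel \<Longrightarrow> bounded (range g) \<Longrightarrow>
      integral\<^sup>L PX (\<lambda>\<xi>. g (X \<xi>)) =
      integral\<^sup>L P (\<lambda>\<omega>. \<Sum>u\<in>generation N 1 \<omega>. g (position Y u \<omega>) * exp (- position Y u \<omega>))"
    and lam_pos: "0 < lam"
    and b_range: "0 < b" "b < 1 / 2"
    and x0_neg: "x\<^sub>0 < 0"
    and l_measurable: "l \<in> borel_measurable borel"
    and l_nonneg: "\<And>y. 0 \<le> l y"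
    and l_lim: "(l \<longlongrightarrow> l_inf) at_bot"
    and l_inf_pos: "0 < l_inf"
    and X_tail: "\<And>z. z \<le> x\<^sub>0 \<Longrightarrow>
      emeasure PX {\<xi> \<in> space PX. X \<xi> \<le> z} =
      (\<integral>\<^sup>+ y\<in>{..z}. ennreal (l y * \<bar>y\<bar> powr a * exp (- lam * \<bar>y\<bar> powr b)) \<partial>lborel)"
    and W1_log_W1: "integrable P
      (\<lambda>\<omega>. additive_martingale N Y 1 \<omega> * max (ln (additive_martingale N Y 1 \<omega>)) 0)"
    and W_inf_rv: "W_inf \<in> borel_measurable P"
    and W_inf_lim: "AE \<omega> in P. (\<lambda>n. additive_martingale N Y n \<omega>) \<longlonglongrightarrow> W_inf \<omega>"
  shows "C_star P N Y < \<infinity> \<and>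
    (\<lambda>n. measure P {\<omega> \<in> space P.
        ereal (lam * (m * real n) powr b - a * ln (real n) + x) < min_position N Y n \<omega>})
    \<longlonglongrightarrow> integral\<^sup>L P (\<lambda>\<omega>.
        exp (- (l_inf * m powr a * enn2real (C_star P N Y) * exp x * W_inf \<omega>)))"
proof -
  interpret B: branching_random_walk P nu mu N Y by (rule brw)
  interpret PX: prob_space PX by (rule PX_prob)
  define kappa where "kappa = measure_pmf.expectation nu real"
  have kappa: "1 < kappa" "(\<integral>\<^sup>+n. of_nat n \<partial>measure_pmf nu) = ennreal kappa"
    using mean_gt_1 nn_integral_eq_integral[OF mean_integrable] by (simp_all add: kappa_def ennreal_of_nat_eq_real_of_nat)
  have mu_meas: "borel_measurable mu = borel_measurable borel"
    by (rule measurable_cong_sets[OF B.mu_sets refl])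
  have first: "(\<integral>\<^sup>+\<omega>. (\<Sum>u\<in>generation N 1 \<omega>. g (position Y u \<omega>)) \<partial>P) = ennreal kappa * (\<integral>\<^sup>+y. g y \<partial>mu)"
    if "g \<in> borel_measurable borel" for g
    unfolding kappa(2)[symmetric] by (rule B.nn_integral_first_generation[OF that])
  have total: "(\<integral>\<^sup>+\<omega>. (\<Sum>u\<in>generation N 1 \<omega>. ennreal (exp (- position Y u \<omega>))) \<partial>P) = 1"
    using phi_1 by (intro elog_eq_0) (simp add: log_laplace_def)
  define R where "R = distr PX borel X"
  have R_sets: "sets R = sets borel" by (simp add: R_def)
  have R_prob: "prob_space R" unfolding R_def by (rule PX.prob_space_distr[OF X_rv])
  interpret RR: prob_space R by (rule R_prob)
  \<comment> \<open>Indicators are bounded test functions, so the defining property of X identifies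
    its law on every Borel set as \<open>mu\<close> tilted by
    \<open>kappa * exp (- y)\<close>.\<close>
  have R_density: "R = density mu (\<lambda>y. ennreal (kappa * exp (- y)))"
  proof (rule measure_eqI)
    show "sets R = sets (density mu (\<lambda>y. ennreal (kappa * exp (- y))))" using R_sets B.mu_sets by simp
    fix A assume "A \<in> sets R"
    then have A [measurable]: "A \<in> sets borel" using R_sets by simp
    let ?S = "\<lambda>\<omega>. \<Sum>u\<in>generation N 1 \<omega>. indicator A (position Y u \<omega>) * exp (- position Y u \<omega>) :: real"
    have S0: "0 \<le> ?S \<omega>" for \<omega> by (intro sum_nonneg) simp
    have Se: "ennreal (?S \<omega>) = (\<Sum>u\<in>generation N 1 \<omega>. ennreal (indicator A (position Y u \<omega>) * exp (- position Y u \<omega>)))" for \<omega>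
      by (rule sum_ennreal[symmetric]) simp
    have gm: "(\<lambda>v. ennreal (indicator A v * exp (- v))) \<in> borel_measurable borel" by measurable
    have Sm: "(\<lambda>\<omega>. ennreal (?S \<omega>)) \<in> borel_measurable P"
      unfolding Se using B.borel_measurable_sum_generation[OF gm, where n=1 and v=0] by simp
    have Sm2: "?S \<in> borel_measurable P"
      using borel_measurable_enn2real[OF Sm] S0 by simp
    \<comment> \<open>The law of X is given through Bochner integrals, which default to 0 off
      integrability. The total mass 1, which is the condition on the log-Laplace transform at 1,
      supplies the integrability needed to pass to nonnegative integrals.\<close>
    have Si: "(\<integral>\<^sup>+\<omega>. ennreal (?S \<omega>) \<partial>P) \<le> 1"
      unfolding total[symmetric] Se by (intro nn_integral_mono sum_mono) (auto split: split_indicator)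
    have Sint: "integrable P ?S"
      by (rule integrableI_nonneg[OF Sm2 AE_I2[OF S0]]) (rule le_less_trans[OF Si], simp)
    have "emeasure R A = ennreal (measure R A)" by (rule RR.emeasure_eq_measure)
    also have "measure R A = integral\<^sup>L PX (\<lambda>\<xi>. indicator A (X \<xi>))"
    proof -
      have "measure R A = (\<integral>x. indicator A x \<partial>R)" using A R_sets by simp
      also have "\<dots> = (\<integral>\<xi>. indicator A (X \<xi>) \<partial>PX)" unfolding R_def by (rule integral_distr[OF X_rv]) simp
      finally show ?thesis .
    qed
    also have "\<dots> = integral\<^sup>L P ?S"
      by (rule X_law) (auto intro!: boundedI[where B=1] split: split_indicator)
    also have "ennreal \<dots> = (\<integral>\<^sup>+\<omega>. ennreal (?S \<omega>) \<partial>P)"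
      by (rule nn_integral_eq_integral[OF Sint AE_I2[OF S0], symmetric])
    also have "\<dots> = ennreal kappa * (\<integral>\<^sup>+y. ennreal (indicator A y * exp (- y)) \<partial>mu)"
      unfolding Se by (rule first[OF gm])
    also have "\<dots> = (\<integral>\<^sup>+y. ennreal kappa * ennreal (indicator A y * exp (- y)) \<partial>mu)"
      by (rule nn_integral_cmult[symmetric]) (simp add: mu_meas)
    also have "\<dots> = (\<integral>\<^sup>+y. ennreal (kappa * exp (- y)) * indicator A y \<partial>mu)"
      using kappa(1) by (intro nn_integral_cong) (auto simp: ennreal_mult'[symmetric] split: split_indicator)
    also have "\<dots> = emeasure (density mu (\<lambda>y. ennreal (kappa * exp (- y)))) A"
      using A B.mu_sets by (intro emeasure_density[symmetric]) (simp_all add: mu_meas)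
    finally show "emeasure R A = emeasure (density mu (\<lambda>y. ennreal (kappa * exp (- y)))) A" .
  qed
  have change: "ennreal kappa * (\<integral>\<^sup>+y. g y \<partial>mu) = (\<integral>\<^sup>+x. ennreal (exp x) * g x \<partial>R)"
    if g [measurable]: "g \<in> borel_measurable borel" for g
  proof -
    have m1: "(\<lambda>x. ennreal (exp x) * g x) \<in> borel_measurable borel" by measurable
    have "(\<integral>\<^sup>+x. ennreal (exp x) * g x \<partial>R) = (\<integral>\<^sup>+x. ennreal (kappa * exp (- x)) * (ennreal (exp x) * g x) \<partial>mu)"
      unfolding R_density using m1 by (intro nn_integral_density) (simp_all add: mu_meas)
    also have "\<dots> = (\<integral>\<^sup>+x. ennreal kappa * g x \<partial>mu)"
    proof (rule nn_integral_cong)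
      fix x
      have "ennreal (kappa * exp (- x)) * ennreal (exp x) = ennreal (kappa * exp (- x) * exp x)"
        using kappa(1) by (intro ennreal_mult[symmetric]) auto
      also have "kappa * exp (- x) * exp x = kappa" by (simp add: exp_minus)
      finally show "ennreal (kappa * exp (- x)) * (ennreal (exp x) * g x) = ennreal kappa * g x"
        by (simp only: mult.assoc[symmetric])
    qed
    also have "\<dots> = ennreal kappa * (\<integral>\<^sup>+y. g y \<partial>mu)"
      using g by (intro nn_integral_cmult) (simp add: mu_meas)
    finally show ?thesis by simp
  qed
  have "\<forall>\<^sub>F y in at_bot. l y < l_inf + 1" by (rule order_tendstoD(2)[OF l_lim]) simp
  then obtain x1 where x1: "\<And>y. y \<le> x1 \<Longrightarrow> l y < l_inf + 1" by (auto simp: eventually_at_bot_linorder)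
  \<comment> \<open>To the left of this point the density formula holds, \<open>l\<close> is
    bounded, and absolute values are at least 1, as \<open>powr_exp_bound\<close> requires.\<close>
  define z0 where "z0 = min (min x\<^sub>0 x1) (- 1)"
  have z0: "z0 \<le> x\<^sub>0" "z0 \<le> x1" "z0 \<le> - 1" by (auto simp: z0_def)
  interpret shape: tail_shape a lam b
    by unfold_locales (use lam_pos b_range in auto)
  have left: "emeasure R A = (\<integral>\<^sup>+y\<in>A. ennreal (l y * shape.F (- y)) \<partial>lborel)"
    if A: "A \<in> sets borel" "A \<subseteq> {..z0}" for A
  proof (rule emeasure_eq_atMost_density[OF _ R_sets _ _ A])
    show "finite_measure R" by unfold_locales
    show "(\<lambda>y. ennreal (l y * shape.F (- y))) \<in> borel_measurable borel"
      using l_measurable by measurable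
    fix z assume z: "z \<le> z0"
    have "emeasure R {..z} = emeasure PX {\<xi> \<in> space PX. X \<xi> \<le> z}"
      unfolding R_def using X_rv by (subst emeasure_distr) (auto intro!: arg_cong[where f="emeasure PX"])
    also have "\<dots> = (\<integral>\<^sup>+ y\<in>{..z}. ennreal (l y * \<bar>y\<bar> powr a * exp (- lam * \<bar>y\<bar> powr b)) \<partial>lborel)"
      by (rule X_tail) (use z z0 in simp)
    also have "\<dots> = (\<integral>\<^sup>+y\<in>{..z}. ennreal (l y * shape.F (- y)) \<partial>lborel)"
      using z z0 by (intro nn_integral_cong) (auto simp: shape.F_def mult.assoc split: split_indicator)
    finally show "emeasure R {..z} = (\<integral>\<^sup>+y\<in>{..z}. ennreal (l y * shape.F (- y)) \<partial>lborel)" .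
  qed
  \<comment> \<open>At \<open>\<beta> = 1 - s\<close> this is the exponential moment of X with
    parameter \<open>s\<close>, so differentiability from the left at 1 speaks about the right tail
    of X.\<close>
  have laplace: "log_laplace P N Y \<beta> = elog (\<integral>\<^sup>+x. ennreal (exp ((1 - \<beta>) * x)) \<partial>R)" for \<beta>
  proof -
    have gm: "(\<lambda>v. ennreal (exp (- \<beta> * v))) \<in> borel_measurable borel" by measurable
    have "(\<integral>\<^sup>+\<omega>. (\<Sum>u\<in>generation N 1 \<omega>. ennreal (exp (- \<beta> * position Y u \<omega>))) \<partial>P)
      = (\<integral>\<^sup>+x. ennreal (exp x) * ennreal (exp (- \<beta> * x)) \<partial>R)"
      unfolding change[OF gm, symmetric] by (rule first[OF gm])
    also have "\<dots> = (\<integral>\<^sup>+x. ennreal (exp ((1 - \<beta>) * x)) \<partial>R)"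
      by (intro nn_integral_cong) (simp add: ennreal_mult'[symmetric] mult_exp_exp algebra_simps)
    finally show ?thesis by (simp only: log_laplace_def)
  qed
  define s where "s k = 1 / real (Suc k)" for k
  have s: "0 < s k" "s \<longlonglongrightarrow> 0" for k
    using LIMSEQ_Suc[OF lim_1_over_n] by (simp_all add: s_def[abs_def])
  define L where "L k = real_of_ereal (elog (\<integral>\<^sup>+x. ennreal (exp (s k * x)) \<partial>R))" for k
  have Ls: "(\<lambda>k. L k / s k) \<longlonglongrightarrow> m"
  proof -
    have "((\<lambda>\<beta>. (real_of_ereal (log_laplace P N Y \<beta>) - real_of_ereal (log_laplace P N Y 1)) / (\<beta> - 1)) \<longlongrightarrow> - m) (at_left 1)"
      using phi_left_deriv by (simp only: has_field_derivative_iff)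
    then have "(\<lambda>k. (real_of_ereal (log_laplace P N Y (1 - s k)) - real_of_ereal (log_laplace P N Y 1)) / ((1 - s k) - 1)) \<longlonglongrightarrow> - m"
    proof (rule filterlim_compose)
      have "(\<lambda>k. 1 - s k) \<longlonglongrightarrow> 1 - 0" by (intro tendsto_intros s)
      then show "filterlim (\<lambda>k. 1 - s k) (at_left 1) sequentially"
        using s(1) by (auto simp: filterlim_at less_imp_neq intro!: always_eventually)
    qed
    then have "(\<lambda>k. - (L k / s k)) \<longlonglongrightarrow> - m"
      unfolding phi_1 by (simp add: laplace L_def)
    then show ?thesis by (simp add: tendsto_minus_cancel_left)
  qed
  \<comment> \<open>The quotients tend to \<open>m\<close>, which is positive, so \<open>L k\<close>
    is eventually nonzero; an infinite transform would have been read as 0.\<close>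
  have finite_laplace: "\<forall>\<^sub>F k in sequentially. integrable R (\<lambda>x. exp (s k * x))"
    using order_tendstoD(1)[OF Ls m_pos]
  proof eventually_elim
    case (elim k)
    then have "L k \<noteq> 0" by auto
    then have "(\<integral>\<^sup>+x. ennreal (exp (s k * x)) \<partial>R) \<noteq> \<infinity>" unfolding L_def by (rule real_of_elog)
    then show ?case
      using R_sets by (intro integrableI_nonneg) (auto simp: measurable_cong_sets[OF R_sets refl] top.not_eq_extremum)
  qed
  \<comment> \<open>One finite exponential moment on the right suffices for the tail estimates;
    \<open>s K\<close> takes the place of \<open>s1\<close>.\<close>
  then obtain K where K: "integrable R (\<lambda>x. exp (s K * x))" by (auto simp: eventually_sequentially)
  interpret tail: stretched_tail nu mu a lam b R l l_inf "l_inf + 1" z0 "s K"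
  proof (intro stretched_tail.intro stretched_tail_axioms.intro)
    show "offspring_law mu" by (rule B.law.offspring_law_axioms)
    show "tail_shape lam b" by (rule shape.tail_shape_axioms)
    show "0 < measure_pmf.expectation nu real" using kappa(1) by (simp add: kappa_def)
    show "ennreal (measure_pmf.expectation nu real) * (\<integral>\<^sup>+y. g y \<partial>mu) = (\<integral>\<^sup>+x. ennreal (exp x) * g x \<partial>R)"
      if "g \<in> borel_measurable borel" for g
      using change[OF that] by (simp only: kappa_def)
    show "l y \<le> l_inf + 1" if "y \<le> z0" for y
      using x1[of y] that z0 by simp
    show "emeasure R A = (\<integral>\<^sup>+y\<in>A. ennreal (l y * shape.F (- y)) \<partial>lborel)"
      if "A \<in> sets borel" "A \<subseteq> {..z0}" for A
      using that by (rule left)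
  qed (fact R_prob R_sets mean_integrable z0(3) l_measurable l_nonneg l_lim s(1) K)+
  \<comment> \<open>Along the sequence \<open>s\<close> the same quotients converge to
    \<open>m\<close> by the derivative assumption and to the mean of X by
    \<open>exp_mean_slope\<close>.\<close>
  have mean: "(\<integral>x. x \<partial>R) = m"
  proof -
    have "(\<lambda>k. ln (\<integral>x. exp (s k * x) \<partial>R) / s k) \<longlonglongrightarrow> (\<integral>x. x \<partial>R)"
      by (rule exp_mean_slope[OF R_prob R_sets s(1) K tail.R_int s])
    moreover have "\<forall>\<^sub>F k in sequentially. L k / s k = ln (\<integral>x. exp (s k * x) \<partial>R) / s k"
      using finite_laplace
    proof eventually_elim
      case (elim k)
      have "0 \<le> (\<integral>x. exp (s k * x) \<partial>R)" by (intro integral_nonneg_AE) auto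
      moreover have "(\<integral>x. exp (s k * x) \<partial>R) \<noteq> 0"
      proof
        assume "(\<integral>x. exp (s k * x) \<partial>R) = 0"
        then have "AE x in R. exp (s k * x) = 0"
          using integral_nonneg_eq_0_iff_AE[OF elim] by simp
        then show False using RR.AE_False by simp
      qed
      ultimately have "0 < (\<integral>x. exp (s k * x) \<partial>R)" by (metis order_le_less)
      moreover have "(\<integral>\<^sup>+x. ennreal (exp (s k * x)) \<partial>R) = ennreal (\<integral>x. exp (s k * x) \<partial>R)"
        by (rule nn_integral_eq_integral[OF elim]) simp
      ultimately show ?case unfolding L_def by (simp add: real_of_elog_ennreal)
    qed
    then have "(\<lambda>k. ln (\<integral>x. exp (s k * x) \<partial>R) / s k) \<longlonglongrightarrow> m"
      by (rule Lim_transform_eventually[OF Ls])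
    ultimately show ?thesis by (rule LIMSEQ_unique)
  qed
  interpret T: brw_tail P nu mu N Y a lam b R l l_inf "l_inf + 1" z0 "s K" m W_inf
    by (intro brw_tail.intro brw_tail_axioms.intro stretched_step.intro stretched_step_axioms.intro
        brw tail.stretched_tail_axioms mean m_pos W_inf_rv W_inf_lim)
  have "(\<lambda>n. measure P {\<omega> \<in> space P. ereal (T.level x n) < min_position N Y n \<omega>}) \<longlonglongrightarrow> T.laplace (T.full_rate x)"
    by (rule T.prob_tendsto[OF l_inf_pos])
  moreover have "T.full_rate x * w = l_inf * m powr a * enn2real (C_star P N Y) * exp x * w" for w
    using T.Ctot_nonneg by (simp add: T.full_rate_def T.C_star_eq)
  ultimately show ?thesis
    by (simp add: T.C_star_eq T.laplace_def T.level_def)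
qed

end
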